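(* For every clause-defined base class $\mathcal C$, the enumeration problem Min-Strong-$\mathcal C$-Backdoors, restricted to input formulas in 3CNF, is in $\mathrm{TotalFPT}$.
   Context: Parameterized enumeration: a parameterized enumeration problem with ordering consists of a set of instances $I$, a polynomial-time computable parameterization $\kappa\colon I\to\mathbb N$, a function assigning to each instance $x$ a finite set $\mathrm{Sol}(x)$ of solutions, and an ordering of solutions; in this paper solutions are finite sets and are ordered by non-decreasing cardinality. An enumeration algorithm for such a problem, on every instance $x$, terminates after finitely many steps and outputs exactly the elements of $\mathrm{Sol}(x)$, each exactly once, such that whenever $y,z\in\mathrm{Sol}(x)$ with $|y|<|z|$, $y$ is output before $z$. The problem is in $\mathrm{TotalFPT}$ if it has an enumeration algorithm whose total running time on every instance $x$ is at most $t(\kappa(x))\cdot p(|x|)$ for some computable $t\colon\mathbb N\to\mathbb N$ and polynomial $p$. It is in $\mathrm{DelayFPT}$ if it has an enumeration algorithm such that, for some computable $t$ and polynomial $p$ and every instance $x$, the time from the start to the first output, the time between any two consecutive outputs, and the time from the last output to termination are each at most $t(\kappa(x))\cdot p(|x|)$. Backdoors: for a set $X$ of propositional variables, $\Theta(X)$ is the set of all truth assignments to $X$; for a CNF formula $\varphi$ and $\theta\in\Theta(X)$, $\theta(\varphi)$ is obtained by removing clauses containing a literal satisfied by $\theta$ and removing from the remaining clauses all literals falsified by $\theta$. A class $\mathcal C$ of CNF formulas is a base class if membership in $\mathcal C$ is decidable in polynomial time, satisfiability of formulas in $\mathcal C$ is decidable in polynomial time, and $\mathcal C$ is closed under renaming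 of variables. $\mathcal C$ is clause-defined if for every CNF formula $\varphi$: $\varphi\in\mathcal C$ iff $\{C\}\in\mathcal C$ for every clause $C$ of $\varphi$. A set $S$ of variables of $\varphi$ is a weak $\mathcal C$-backdoor of $\varphi$ if some $\theta\in\Theta(S)$ satisfies $\theta(\varphi)\in\mathcal C$ and $\theta(\varphi)$ is satisfiable; $S$ is a strong $\mathcal C$-backdoor if $\theta(\varphi)\in\mathcal C$ for all $\theta\in\Theta(S)$. Instances are pairs $(\varphi,k)$ with $\varphi$ a 3CNF formula and $k\in\mathbb N$; the parameter is $k$. Min-Strong-$\mathcal C$-Backdoors: output all inclusion-minimal strong $\mathcal C$-backdoors of $\varphi$ of size at most $k$, ordered by non-decreasing size. All-Strong-$\mathcal C$-Backdoors: output all strong $\mathcal C$-backdoors of size at most $k$, ordered by non-decreasing size. Min-/All-Weak-$\mathcal C$-Backdoors are defined analogously with weak backdoors. *)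

theory Defs
  imports Main "HOL-Computational_Algebra.Polynomial"
begin

text \<open>Variables are natural numbers; a literal is a pair (v, b) where b = True means the
positive literal v and b = False the negative literal. A clause is a set of literals and a
CNF formula is a set of clauses.\<close>

type_synonym lit = "nat \<times> bool"
type_synonym clause = "lit set"
type_synonym formula = "clause set"

definition cnf :: "formula \<Rightarrow> bool" where
  "cnf \<phi> \<longleftrightarrow> finite \<phi> \<and> (\<forall>C\<in>\<phi>. finite C)"

definition vars :: "formula \<Rightarrow> nat set" where
  "vars \<phi> = {v. \<exists>C\<in>\<phi>. \<exists>b. (v, b) \<in> C}"

definition satisfiable :: "formula \<Rightarrow> bool" where
  "satisfiable \<phi> \<longleftrightarrow> (\<exists>\<tau> :: nat \<Rightarrow> bool. \<forall>C\<in>\<phi>. \<exists>(v, b)\<in>C. \<tau> v = b)"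

text \<open>The reduct theta(phi) for a truth assignment theta to the variable set X. A truth
assignment to X is represented by any total function restricted to X; ranging over all
total functions yields exactly all elements of Theta(X).\<close>

definition reduct :: "nat set \<Rightarrow> (nat \<Rightarrow> bool) \<Rightarrow> formula \<Rightarrow> formula" where
  "reduct X \<theta> \<phi> =
     {C - {(v, b). v \<in> X \<and> \<theta> v \<noteq> b} | C. C \<in> \<phi> \<and> \<not> (\<exists>(v, b)\<in>C. v \<in> X \<and> \<theta> v = b)}"

definition rename :: "(nat \<Rightarrow> nat) \<Rightarrow> formula \<Rightarrow> formula" where
  "rename \<rho> \<phi> = (\<lambda>C. (\<lambda>(v, b). (\<rho> v, b)) ` C) ` \<phi>"

definition strong_backdoor :: "formula set \<Rightarrow> formula \<Rightarrow> nat set \<Rightarrow> bool" where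
  "strong_backdoor \<C> \<phi> S \<longleftrightarrow> S \<subseteq> vars \<phi> \<and> (\<forall>\<theta>. reduct S \<theta> \<phi> \<in> \<C>)"

definition min_strong_backdoor :: "formula set \<Rightarrow> formula \<Rightarrow> nat set \<Rightarrow> bool" where
  "min_strong_backdoor \<C> \<phi> S \<longleftrightarrow>
     strong_backdoor \<C> \<phi> S \<and> (\<forall>S'. S' \<subset> S \<longrightarrow> \<not> strong_backdoor \<C> \<phi> S')"

text \<open>States and tape symbols are natural numbers; 0 is the blank symbol and 0 the start
state. The transition function maps (state, read symbol) either to None (halt) or to
(new state, written symbol, head move in {-1,0,1}, optionally one emitted output symbol).
Well-formedness forces the transition table to be finite.\<close>

type_synonym tm = "nat \<Rightarrow> nat \<Rightarrow> (nat \<times> nat \<times> int \<times> nat option) option"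
type_synonym config = "nat \<times> (int \<Rightarrow> nat) \<times> int"

definition wf_tm :: "tm \<Rightarrow> bool" where
  "wf_tm M \<longleftrightarrow> (\<exists>N::nat.
     (\<forall>q s. (N \<le> q \<or> N \<le> s) \<longrightarrow> M q s = None) \<and>
     (\<forall>q s q' s' d out. M q s = Some (q', s', d, out) \<longrightarrow>
        q' < N \<and> s' < N \<and> d \<in> {-1, 0, 1} \<and> (\<forall>a. out = Some a \<longrightarrow> a < N)))"

definition init_config :: "nat list \<Rightarrow> config" where
  "init_config w = (0, (\<lambda>i. if 0 \<le> i \<and> nat i < length w then w ! nat i else 0), 0)"

fun tm_step :: "tm \<Rightarrow> config \<Rightarrow> config" where
  "tm_step M (q, tp, p) =
     (case M q (tp p) of
        None \<Rightarrow> (q, tp, p)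
      | Some (q', s, d, _) \<Rightarrow> (q', tp(p := s), p + d))"

fun tm_emit :: "tm \<Rightarrow> config \<Rightarrow> nat list" where
  "tm_emit M (q, tp, p) =
     (case M q (tp p) of
        Some (_, _, _, Some a) \<Rightarrow> [a]
      | _ \<Rightarrow> [])"

fun tm_halted :: "tm \<Rightarrow> config \<Rightarrow> bool" where
  "tm_halted M (q, tp, p) = (M q (tp p) = None)"

definition run :: "tm \<Rightarrow> nat list \<Rightarrow> nat \<Rightarrow> config" where
  "run M w n = (tm_step M ^^ n) (init_config w)"

definition tm_output :: "tm \<Rightarrow> nat list \<Rightarrow> nat \<Rightarrow> nat list" where
  "tm_output M w n = concat (map (\<lambda>i. tm_emit M (run M w i)) [0..<n])"

fun bin :: "nat \<Rightarrow> nat list" where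
  "bin n = (if n = 0 then [] else bin (n div 2) @ [n mod 2])"

definition enc_num :: "nat \<Rightarrow> nat list" where
  "enc_num n = map (\<lambda>d. d + 2) (bin n)"

definition enc_lit :: "lit \<Rightarrow> nat list" where
  "enc_lit l = (if snd l then 4 else 5) # enc_num (fst l)"

definition enc_clause :: "lit list \<Rightarrow> nat list" where
  "enc_clause c = concat (map enc_lit c) @ [6]"

definition enc_formula :: "lit list list \<Rightarrow> nat list" where
  "enc_formula cs = concat (map enc_clause cs)"

definition formula_of :: "lit list list \<Rightarrow> formula" where
  "formula_of cs = set (map set cs)"

definition enc_instance :: "lit list list \<Rightarrow> nat \<Rightarrow> nat list" where
  "enc_instance cs k = enc_formula cs @ [7] @ enc_num k"

text \<open>Canonical encoding of a finite set of variables (an output solution); contains no 1.\<close>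
definition enc_varset :: "nat set \<Rightarrow> nat list" where
  "enc_varset S = concat (map (\<lambda>v. enc_num v @ [4]) (sorted_list_of_set S))"

definition poly_time_decides :: "tm \<Rightarrow> (lit list list \<Rightarrow> bool) \<Rightarrow> (lit list list \<Rightarrow> bool) \<Rightarrow> bool" where
  "poly_time_decides M Dom P \<longleftrightarrow> wf_tm M \<and> (\<exists>p :: nat poly. \<forall>cs. Dom cs \<longrightarrow>
     (\<exists>T. tm_halted M (run M (enc_formula cs) T) \<and> T \<le> poly p (length (enc_formula cs)) \<and>
          tm_output M (enc_formula cs) T = [if P cs then 3 else 2]))"

definition computable_fun :: "(nat \<Rightarrow> nat) \<Rightarrow> bool" where
  "computable_fun t \<longleftrightarrow> (\<exists>M. wf_tm M \<and> (\<forall>n. \<exists>T.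
     tm_halted M (run M (replicate n 2) T) \<and> tm_output M (replicate n 2) T = replicate (t n) 2))"

definition base_class :: "formula set \<Rightarrow> bool" where
  "base_class \<C> \<longleftrightarrow>
     (\<exists>M. poly_time_decides M (\<lambda>_. True) (\<lambda>cs. formula_of cs \<in> \<C>)) \<and>
     (\<exists>M. poly_time_decides M (\<lambda>cs. formula_of cs \<in> \<C>) (\<lambda>cs. satisfiable (formula_of cs))) \<and>
     (\<forall>\<phi> \<rho>. cnf \<phi> \<and> \<phi> \<in> \<C> \<and> inj \<rho> \<longrightarrow> rename \<rho> \<phi> \<in> \<C>)"

definition clause_defined :: "formula set \<Rightarrow> bool" where
  "clause_defined \<C> \<longleftrightarrow> (\<forall>\<phi>. cnf \<phi> \<longrightarrow> (\<phi> \<in> \<C> \<longleftrightarrow> (\<forall>C\<in>\<phi>. {C} \<in> \<C>)))"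

definition enum_run :: "tm \<Rightarrow> nat list \<Rightarrow> nat \<Rightarrow> nat set list \<Rightarrow> bool" where
  "enum_run M w T ys \<longleftrightarrow> tm_halted M (run M w T) \<and>
     tm_output M w T = concat (map (\<lambda>y. enc_varset y @ [1]) ys)"

definition correct_enum :: "nat set set \<Rightarrow> nat set list \<Rightarrow> bool" where
  "correct_enum Sol ys \<longleftrightarrow> distinct ys \<and> set ys = Sol \<and>
     (\<forall>i j. i < length ys \<and> j < length ys \<and> card (ys ! i) < card (ys ! j) \<longrightarrow> i < j)"

definition min_strong_backdoors_3cnf_in_TotalFPT :: "formula set \<Rightarrow> bool" where
  "min_strong_backdoors_3cnf_in_TotalFPT \<C> \<longleftrightarrow>
     (\<exists>M t (p :: nat poly). wf_tm M \<and> computable_fun t \<and>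
       (\<forall>cs k. (\<forall>c\<in>set cs. card (set c) \<le> 3) \<longrightarrow>
          (\<exists>T ys. enum_run M (enc_instance cs k) T ys \<and>
             correct_enum {S. min_strong_backdoor \<C> (formula_of cs) S \<and> card S \<le> k} ys \<and>
             T \<le> t k * poly p (length (enc_instance cs k)))))"

end

theory Submission
  imports Defs
begin

text \<open>Whether \<open>{D}\<close> belongs to a clause-defined base class depends, by closure under
  renaming, only on the numbers of variables that occur positively, negatively, and in both ways in
  \<open>D\<close>. For clauses with at most three literals this is a finite table, so the machine deciding the
  class is never run.

  A set \<open>X\<close> of variables is a strong backdoor iff no clause obstructs it, and if \<open>D\<close>
  obstructs \<open>X\<close>, then every strong backdoor that includes \<open>X\<close> contains one of the at
  most three variables of \<open>D\<close> outside \<open>X\<close>. A breadth-first search over \<open>k +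
  1\<close> levels that branches on these variables meets every minimal strong backdoor of size at most
  \<open>k\<close>, and the sets it meets come by increasing size. Hence a strong backdoor that it meets is
  minimal and new iff no set found earlier is included in it. Level \<open>j\<close> has at most \<open>3 ^
  j\<close> sets.

  To obtain a Turing machine, programs over six stacks are compiled to it, one track of the tape for each stack.
  Functions on encoded trees that such programs compute in polynomial time are closed under composition,
  pairing, case distinction, and folds with polynomially bounded intermediate results. A fold without such a
  bound takes time polynomial in the total size of the intermediate results; this covers the search
  itself.\<close>

text \<open>The search takes fixed-parameter time, while the bounds that survive composition of
  programs are polynomial. The exponential part is therefore confined to the measure in
  \<open>PTB\<close>, the summed sizes of the intermediate results of two folds: the search, and the
  conversion of the binary parameter into a list of k units. Both are polynomial in the single
  quantity z = 3 ^ k * (n + 1), where n is the input length. The whole time is at most (z + 2) ^ K,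
  where K does not depend on the instance, and this splits into (3 ^ K) ^ k and a polynomial in n.
  Since K comes out of the construction, the powers of an arbitrary base have to be shown
  computable.

  A clause of the input is a list in which literals may repeat and a variable may have both signs.
  The width bound limits only the distinct literals, so repetitions are removed before counting, and
  tautological clauses force a third index on the table. The entries of the table are constants
  built into the program; a machine exists for each class without a uniform way to obtain
  it.\<close>

text \<open>Stacks \<open>0\<close> to \<open>5\<close> become tracks of the tape; stack \<open>0\<close> holds
  the input, with its end on top. Pushing to the virtual stack \<open>6\<close> emits an output symbol.\<close>

datatype com = Skip | Push nat nat | Pop nat | Seq com com
  | Cond nat "nat set" com com | Loop nat "nat set" com

type_synonym stacks = "nat \<Rightarrow> nat list"

text \<open>The default 0 never clashes with a stack entry, since well-formed programs push only
  symbols from 1 to 7. It agrees with the tape, where a track is 0 above its stack.\<close>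

definition top_of :: "nat list \<Rightarrow> nat" where
  "top_of xs = (case xs of [] \<Rightarrow> 0 | a # _ \<Rightarrow> a)"

lemma top_of_simps [simp]: "top_of [] = 0" "top_of (a # xs) = a"
  by (simp_all add: top_of_def)

fun cstep :: "com list \<times> stacks \<Rightarrow> com list \<times> stacks" where
  "cstep ([], s) = ([], s)"
| "cstep (Skip # k, s) = (k, s)"
| "cstep (Push i a # k, s) = (k, s(i := a # s i))"
| "cstep (Pop i # k, s) = (k, s(i := tl (s i)))"
| "cstep (Seq c d # k, s) = (c # d # k, s)"
| "cstep (Cond i A c d # k, s) = ((if top_of (s i) \<in> A then c else d) # k, s)"
| "cstep (Loop i A c # k, s) = (if top_of (s i) \<in> A then c # Loop i A c # k else k, s)"

primrec wf_com :: "com \<Rightarrow> bool" where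
  "wf_com Skip = True"
| "wf_com (Push i a) = (i \<le> 6 \<and> 0 < a \<and> a < 8)"
| "wf_com (Pop i) = (i < 6)"
| "wf_com (Seq c d) = (wf_com c \<and> wf_com d)"
| "wf_com (Cond i A c d) = (i < 6 \<and> wf_com c \<and> wf_com d)"
| "wf_com (Loop i A c) = (i < 6 \<and> wf_com c)"

section \<open>Continuations as control states\<close>

primrec conts :: "com \<Rightarrow> com list \<Rightarrow> com list set" where
  "conts Skip k = {Skip # k}"
| "conts (Push i a) k = {Push i a # k}"
| "conts (Pop i) k = {Pop i # k}"
| "conts (Seq c d) k = insert (Seq c d # k) (conts c (d # k) \<union> conts d k)"
| "conts (Cond i A c d) k = insert (Cond i A c d # k) (conts c k \<union> conts d k)"
| "conts (Loop i A c) k = insert (Loop i A c # k) (conts c (Loop i A c # k))"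

lemma finite_conts: "finite (conts c k)"
  by (induction c arbitrary: k) auto

lemma head_in_conts: "c # k \<in> conts c k"
  by (cases c) auto

text \<open>A loop returns to a continuation that is already listed, and every branch ends in
  \<open>k\<close>, so finitely many continuations suffice. This makes them usable as states of a
  machine.\<close>

lemma conts_closed: "k' \<in> conts c k \<Longrightarrow> fst (cstep (k', s)) \<in> insert k (conts c k)"
proof (induction c arbitrary: k)
  case (Seq c d)
  from Seq.prems consider "k' = Seq c d # k" | "k' \<in> conts c (d # k)" | "k' \<in> conts d k" by auto
  then show ?case
    using head_in_conts[of c "d # k"] head_in_conts[of d k] Seq.IH(1)[of "d # k"] Seq.IH(2)[of k]
    by cases auto
next
  case (Cond i A c d)
  from Cond.prems consider "k' = Cond i A c d # k" | "k' \<in> conts c k" | "k' \<in> conts d k" by auto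
  then show ?case
    using head_in_conts[of c k] head_in_conts[of d k] Cond.IH(1)[of k] Cond.IH(2)[of k]
    by cases auto
next
  case (Loop i A c)
  from Loop.prems consider "k' = Loop i A c # k" | "k' \<in> conts c (Loop i A c # k)" by auto
  then show ?case
    using head_in_conts[of c "Loop i A c # k"] Loop.IH by cases auto
qed auto

lemma conts_wf:
  "k' \<in> conts c k \<Longrightarrow> wf_com c \<Longrightarrow> \<forall>d\<in>set k. wf_com d \<Longrightarrow> d \<in> set k' \<Longrightarrow> wf_com d"
proof (induction c arbitrary: k)
  case (Seq c e)
  from Seq.prems consider "k' = Seq c e # k" | "k' \<in> conts c (e # k)" | "k' \<in> conts e k" by auto
  then show ?case
    using Seq.prems Seq.IH(1)[of "e # k"] Seq.IH(2)[of k] by cases auto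
next
  case (Cond i A c e)
  from Cond.prems consider "k' = Cond i A c e # k" | "k' \<in> conts c k" | "k' \<in> conts e k" by auto
  then show ?case
    using Cond.prems Cond.IH(1)[of k] Cond.IH(2)[of k] by cases auto
next
  case (Loop i A c)
  from Loop.prems consider "k' = Loop i A c # k" | "k' \<in> conts c (Loop i A c # k)" by auto
  then show ?case
    using Loop.prems Loop.IH[of "Loop i A c # k"] by cases auto
qed auto

section \<open>Finite runs of a Turing machine with their output\<close>

inductive trun :: "tm \<Rightarrow> nat \<Rightarrow> config \<Rightarrow> config \<Rightarrow> nat list \<Rightarrow> bool" where
  trun_refl: "trun M 0 c c []"
| trun_step: "trun M n (tm_step M c) c' out \<Longrightarrow> trun M (Suc n) c c' (tm_emit M c @ out)"

lemma trun_trans: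
  "trun M n c c' out \<Longrightarrow> trun M m c' c'' out' \<Longrightarrow> trun M (n + m) c c'' (out @ out')"
  by (induction rule: trun.induct) (auto dest: trun_step)

lemma trun_one:
  "M q (tp p) = Some (q', a, d, e) \<Longrightarrow>
    trun M (Suc 0) (q, tp, p) (q', tp(p := a), p + d) (case e of None \<Rightarrow> [] | Some b \<Rightarrow> [b])"
  using trun_step[OF trun_refl, of M "(q, tp, p)"] by (simp split: option.splits)

lemma trun_Suc:
  assumes "M q (tp p) = Some (q', a, d, None)" "trun M n (q', tp(p := a), p + d) c' out"
  shows "trun M (Suc n) (q, tp, p) c' out"
  using trun_trans[OF trun_one[of M q tp p q' a d None, OF assms(1)] assms(2)] by simp

lemma trun_stay:
  assumes "M q (tp p) = Some (q', tp p, d, None)" "trun M n (q', tp, p + d) c' out"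
  shows "trun M (Suc n) (q, tp, p) c' out"
  using trun_Suc[of M q tp p q' "tp p" d n c' out] assms by simp

lemma trun_run_aux:
  "trun M n c c' out \<Longrightarrow> (tm_step M ^^ n) c = c' \<and>
     concat (map (\<lambda>i. tm_emit M ((tm_step M ^^ i) c)) [0..<n]) = out"
proof (induction rule: trun.induct)
  case (trun_step M n c c' out)
  have "map (\<lambda>i. tm_emit M ((tm_step M ^^ i) c)) [0..<Suc n] =
      tm_emit M c # map (\<lambda>i. tm_emit M ((tm_step M ^^ i) (tm_step M c))) [0..<n]"
    unfolding upt_conv_Cons[OF zero_less_Suc] by (simp add: map_Suc_upt[symmetric] funpow_swap1 del: upt_Suc)
  with trun_step show ?case by (simp add: funpow_swap1 del: upt_Suc)
qed auto

lemma trun_run: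
  assumes "trun M n (init_config w) c' out"
  shows "run M w n = c'" "tm_output M w n = out"
  using trun_run_aux[OF assms] by (auto simp: run_def tm_output_def)

section \<open>Compiling stack programs to Turing machines\<close>

text \<open>A program step that touches a track is a round trip of the head. At rest it stands on
  cell -1 (\<open>Home\<close>); it walks right to the first cell above the stack concerned, steps
  back if the top has to be read, and returns. The two \<open>Init\<close> phases only install the
  left marker.\<close>

datatype phase = Init1 | Init2 | Home | Go_Right | At_Top | Go_Back

primrec stack_of :: "com \<Rightarrow> nat" where
  "stack_of Skip = 0"
| "stack_of (Push i a) = i"
| "stack_of (Pop i) = i"
| "stack_of (Seq c d) = 0"
| "stack_of (Cond i A c d) = i"
| "stack_of (Loop i A c) = i"

fun delta_home ::
  "com list \<Rightarrow> nat list \<Rightarrow> ((com list \<times> phase) \<times> nat list \<times> int \<times> nat option) option" where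
  "delta_home [] xs = None"
| "delta_home (Skip # k) xs = Some ((k, Home), xs, 0, None)"
| "delta_home (Seq c d # k) xs = Some ((c # d # k, Home), xs, 0, None)"
| "delta_home (Push i a # k) xs =
     (if i = 6 then Some ((k, Home), xs, 0, Some a) else Some ((Push i a # k, Go_Right), xs, 1, None))"
| "delta_home k xs = Some ((k, Go_Right), xs, 1, None)"

text \<open>In \<open>At_Top\<close> the next continuation comes from \<open>cstep\<close> itself,
  run on stacks that show just the symbol read. This is sound because a continuation depends on
  nothing but the top of one stack.\<close>

fun delta ::
  "com list \<times> phase \<Rightarrow> nat list \<Rightarrow> ((com list \<times> phase) \<times> nat list \<times> int \<times> nat option) option" where
  "delta (k, Init1) xs = Some ((k, Init2), xs, -1, None)"
| "delta (k, Init2) xs = Some ((k, Home), [], 0, None)"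
| "delta (k, Home) xs = delta_home k xs"
| "delta (k, Go_Right) xs = (if k = [] then None else
     if xs ! stack_of (hd k) \<noteq> 0 then Some ((k, Go_Right), xs, 1, None) else
       (case hd k of Push i a \<Rightarrow> Some ((tl k, Go_Back), xs[i := a], -1, None)
          | _ \<Rightarrow> Some ((k, At_Top), xs, -1, None)))"
| "delta (k, At_Top) xs = (if k = [] then None else
     Some ((fst (cstep (k, \<lambda>_. [if xs = [] then 0 else xs ! stack_of (hd k)])), Go_Back),
           (case hd k of Pop i \<Rightarrow> xs[i := 0] | _ \<Rightarrow> xs), 0, None))"
| "delta (k, Go_Back) xs =
     (if xs = [] then Some ((k, Home), xs, 0, None) else Some ((k, Go_Back), xs, -1, None))"

text \<open>The empty list is the symbol that marks the cell to the left of all stacks.\<close>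

definition syms :: "nat list set" where
  "syms = insert [] {xs. length xs = 6 \<and> (\<forall>a\<in>set xs. a < 8)}"

text \<open>Track 0 is the least significant digit in base 8. A raw input symbol is therefore
  already the code of a cell that carries it on track 0, and the blank 0 is the code of the empty
  cell, so the input needs no conversion. The marker gets \<open>8 ^ 6\<close>, the first number
  that six digits do not reach.\<close>

definition code_sym :: "nat list \<Rightarrow> nat" where
  "code_sym xs = (if xs = [] then 8 ^ 6 else foldr (\<lambda>a r. a + 8 * r) xs 0)"

lemma horner_less: "\<forall>a\<in>set xs. a < 8 \<Longrightarrow> foldr (\<lambda>a r. a + 8 * r) xs 0 < (8 :: nat) ^ length xs"
  by (induction xs) auto

lemma horner_inj:
  "length xs = length ys \<Longrightarrow> \<forall>a\<in>set xs. a < 8 \<Longrightarrow> \<forall>a\<in>set ys. a < 8 \<Longrightarrow>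
     foldr (\<lambda>a r. a + 8 * r) xs 0 = foldr (\<lambda>a r. a + 8 * r) ys (0::nat) \<Longrightarrow> xs = ys"
proof (induction xs ys rule: list_induct2)
  case (Cons x xs y ys)
  let ?h = "\<lambda>zs. foldr (\<lambda>a r. a + 8 * r) zs (0::nat)"
  have eq: "x + 8 * ?h xs = y + 8 * ?h ys" using Cons.prems by simp
  moreover have "x < 8" "y < 8" using Cons.prems by auto
  ultimately have "x = y \<and> ?h xs = ?h ys" by presburger
  with Cons show ?case by auto
qed auto

lemma inj_code_sym: "inj_on code_sym syms"
proof (rule inj_onI)
  fix xs ys assume *: "xs \<in> syms" "ys \<in> syms" "code_sym xs = code_sym ys"
  have less: "code_sym zs < 8 ^ 6" if "zs \<in> syms" "zs \<noteq> []" for zs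
    using that horner_less[of zs] by (auto simp: syms_def code_sym_def)
  show "xs = ys"
  proof (cases "xs = [] \<or> ys = []")
    case True
    then show ?thesis using *(3) less[OF *(1)] less[OF *(2)] by (auto simp: code_sym_def split: if_splits)
  next
    case False
    then show ?thesis using * horner_inj[of xs ys] by (auto simp: syms_def code_sym_def)
  qed
qed

lemma code_sym_le: "xs \<in> syms \<Longrightarrow> code_sym xs \<le> 8 ^ 6"
  using horner_less[of xs] by (auto simp: syms_def code_sym_def)

section \<open>Stacks as tracks of the tape\<close>

definition cell :: "stacks \<Rightarrow> nat \<Rightarrow> nat list" where
  "cell s p = map (\<lambda>i. if p < length (s i) then rev (s i) ! p else 0) [0..<6]"

text \<open>Stacks grow to the right with their bottom at cell 0, which is why \<open>cell\<close>
  reverses them: a push or a pop changes one cell only.\<close>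

definition tape :: "stacks \<Rightarrow> int \<Rightarrow> nat" where
  "tape s j = (if j = -1 then code_sym [] else if j < 0 then 0 else code_sym (cell s (nat j)))"

definition ok_stacks :: "stacks \<Rightarrow> bool" where
  "ok_stacks s \<longleftrightarrow> (\<forall>i<6. \<forall>a\<in>set (s i). 0 < a \<and> a < 8)"

lemma length_cell [simp]: "length (cell s p) = 6" by (simp add: cell_def)

lemma nth_cell: "i < 6 \<Longrightarrow> cell s p ! i = (if p < length (s i) then rev (s i) ! p else 0)"
  by (simp add: cell_def)

lemma cell_not_Nil [simp]: "cell s p \<noteq> []"
  by (metis length_cell list.size(3) zero_neq_numeral)

lemma cell_in_syms: "ok_stacks s \<Longrightarrow> cell s p \<in> syms"
proof -
  assume ok: "ok_stacks s"
  have "cell s p ! i < 8" if "i < 6" for i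
  proof (cases "p < length (s i)")
    case True
    then have "rev (s i) ! p \<in> set (s i)" by (metis length_rev nth_mem set_rev)
    then show ?thesis using ok that True by (auto simp: nth_cell ok_stacks_def)
  qed (use that in \<open>simp add: nth_cell\<close>)
  then show ?thesis by (auto simp: syms_def in_set_conv_nth)
qed

lemma cell_nonzero: "ok_stacks s \<Longrightarrow> i < 6 \<Longrightarrow> p < length (s i) \<Longrightarrow> cell s p ! i \<noteq> 0"
  by (metis length_rev nth_cell nth_mem ok_stacks_def set_rev bot_nat_0.not_eq_extremum)

lemma tape_push:
  assumes "i < 6"
  shows "tape (s(i := a # s i)) =
     (tape s)(int (length (s i)) := code_sym ((cell s (length (s i)))[i := a]))"
proof
  fix j
  have "cell (s(i := a # s i)) p = (if p = length (s i) then (cell s p)[i := a] else cell s p)" for p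
    using assms by (intro nth_equalityI) (auto simp: nth_cell nth_list_update nth_append)
  then show "tape (s(i := a # s i)) j =
     ((tape s)(int (length (s i)) := code_sym ((cell s (length (s i)))[i := a]))) j"
    by (auto simp: tape_def)
qed

lemma tape_pop:
  assumes "i < 6" "s i = a # xs"
  shows "tape (s(i := xs)) = (tape s)(int (length xs) := code_sym ((cell s (length xs))[i := 0]))"
proof
  fix j
  have "cell (s(i := xs)) p = (if p = length xs then (cell s p)[i := 0] else cell s p)" for p
    using assms by (intro nth_equalityI) (auto simp: nth_cell nth_list_update nth_append)
  then show "tape (s(i := xs)) j =
     ((tape s)(int (length xs) := code_sym ((cell s (length xs))[i := 0]))) j"
    by (auto simp: tape_def)
qed

lemma tape_out: "tape (s(6 := xs)) = tape s"
proof -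
  have "cell (s(6 := xs)) p = cell s p" for p by (simp add: cell_def)
  then show ?thesis by (auto simp: tape_def fun_eq_iff)
qed

lemma in_set_tl: "a \<in> set (tl xs) \<Longrightarrow> a \<in> set xs"
  by (cases xs) auto

lemma ok_stacks_cstep:
  assumes "ok_stacks s" "\<forall>d\<in>set k. wf_com d"
  shows "ok_stacks (snd (cstep (k, s)))"
  using assms by (cases "(k, s)" rule: cstep.cases) (auto simp: ok_stacks_def dest: in_set_tl)

lemma length_cstep: "length (snd (cstep (k, s)) i) \<le> Suc (length (s i))"
  by (cases "(k, s)" rule: cstep.cases) auto

section \<open>Simulation of a program by its machine\<close>

locale compiled =
  fixes K :: "com list set" and code_state :: "com list \<times> phase \<Rightarrow> nat" and M :: tm
  assumes closed: "k \<in> K \<Longrightarrow> fst (cstep (k, s)) \<in> K"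
    and wf_K: "k \<in> K \<Longrightarrow> d \<in> set k \<Longrightarrow> wf_com d"
    and M: "k \<in> K \<Longrightarrow> xs \<in> syms \<Longrightarrow> M (code_state (k, ph)) (code_sym xs) =
      map_option (\<lambda>(q, ys, d, e). (code_state q, code_sym ys, d, e)) (delta (k, ph) xs)"
begin

lemma Nil_in_syms: "[] \<in> syms" by (simp add: syms_def)

lemma read_home:
  "k \<in> K \<Longrightarrow> M (code_state (k, ph)) (tape s (-1)) =
     map_option (\<lambda>(q, ys, d, e). (code_state q, code_sym ys, d, e)) (delta (k, ph) [])"
  using M[OF _ Nil_in_syms] by (simp add: tape_def)

lemma read_cell:
  "k \<in> K \<Longrightarrow> ok_stacks s \<Longrightarrow> M (code_state (k, ph)) (tape s (int p)) =
     map_option (\<lambda>(q, ys, d, e). (code_state q, code_sym ys, d, e)) (delta (k, ph) (cell s p))"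
  using M[OF _ cell_in_syms] by (simp add: tape_def)

lemma go_right:
  assumes "k \<in> K" "ok_stacks s" "k \<noteq> []" "stack_of (hd k) < 6" "p \<le> length (s (stack_of (hd k)))"
  shows "trun M p (code_state (k, Go_Right), tape s, 0) (code_state (k, Go_Right), tape s, int p) []"
  using assms(5)
proof (induction p)
  case (Suc p)
  have "cell s p ! stack_of (hd k) \<noteq> 0" using Suc cell_nonzero assms by auto
  then have "M (code_state (k, Go_Right)) (tape s (int p)) =
     Some (code_state (k, Go_Right), code_sym (cell s p), 1, None)"
    using assms by (simp add: read_cell)
  then have "trun M (Suc 0) (code_state (k, Go_Right), tape s, int p)
      (code_state (k, Go_Right), tape s, int p + 1) []"
    by (intro trun_stay[where d = 1 and q' = "code_state (k, Go_Right)"])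
       (auto simp: tape_def intro: trun_refl)
  from trun_trans[OF Suc.IH this] show ?case
    using Suc.prems by (simp add: add.commute)
qed (auto intro: trun_refl)

text \<open>Starting at \<open>int p - 1\<close> lets p = 0 stand for a head that is already on the
  marker. The extra step is the change of phase there.\<close>

lemma go_back:
  assumes "k \<in> K" "ok_stacks s"
  shows "trun M (Suc p) (code_state (k, Go_Back), tape s, int p - 1) (code_state (k, Home), tape s, -1) []"
proof (induction p)
  case 0
  have "M (code_state (k, Go_Back)) (tape s (-1)) = Some (code_state (k, Home), tape s (-1), 0, None)"
    using assms(1) by (simp add: read_home) (simp add: tape_def)
  from trun_stay[of M "code_state (k, Go_Back)" "tape s" "-1", OF this] show ?case
    by (simp add: trun_refl)
next
  case (Suc p)
  have "M (code_state (k, Go_Back)) (tape s (int p)) =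
     Some (code_state (k, Go_Back), tape s (int p), -1, None)"
    using assms by (simp add: read_cell) (simp add: tape_def)
  from trun_stay[of M "code_state (k, Go_Back)" "tape s" "int p", OF this] Suc show ?case
    by simp
qed

text \<open>One step leaves the marker, \<open>length (s i)\<close> steps reach the free cell, one
  writes, and the way back takes \<open>length (s i) + 1\<close>.\<close>

lemma simulate_push:
  assumes "Push i a # k \<in> K" "k \<in> K" "ok_stacks s" "i < 6" "0 < a" "a < 8"
  shows "trun M (2 * length (s i) + 3) (code_state (Push i a # k, Home), tape s, -1)
     (code_state (k, Home), tape (s(i := a # s i)), -1) []"
proof -
  let ?k = "Push i a # k" and ?n = "length (s i)" and ?s = "s(i := a # s i)"
  have "trun M (Suc (?n + Suc (Suc ?n))) (code_state (?k, Home), tape s, -1)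
     (code_state (k, Home), tape ?s, -1) ([] @ [])"
  proof (rule trun_stay)
    show "M (code_state (?k, Home)) (tape s (-1)) = Some (code_state (?k, Go_Right), tape s (-1), 1, None)"
      using assms by (simp add: read_home) (simp add: tape_def)
    have "trun M (Suc (Suc ?n)) (code_state (?k, Go_Right), tape s, int ?n)
       (code_state (k, Home), tape ?s, -1) []"
    proof (rule trun_Suc)
      show "M (code_state (?k, Go_Right)) (tape s (int ?n)) =
          Some (code_state (k, Go_Back), code_sym ((cell s ?n)[i := a]), -1, None)"
        using assms by (simp add: read_cell nth_cell)
      have "ok_stacks ?s" using assms by (auto simp: ok_stacks_def)
      from go_back[OF \<open>k \<in> K\<close> this, of ?n]
      show "trun M (Suc ?n) (code_state (k, Go_Back),
          (tape s)(int ?n := code_sym ((cell s ?n)[i := a])), int ?n + - 1)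
          (code_state (k, Home), tape ?s, -1) []"
        using assms by (simp add: tape_push)
    qed
    with go_right[of ?k s ?n] assms
    show "trun M (?n + Suc (Suc ?n)) (code_state (?k, Go_Right), tape s, - 1 + 1)
       (code_state (k, Home), tape ?s, -1) ([] @ [])"
      by (intro trun_trans) auto
  qed
  then show ?thesis by (simp add: numeral_3_eq_3 mult_2)
qed

lemma simulate_read:
  assumes "c # k \<in> K" "ok_stacks s" and i: "stack_of c = i" "i < 6"
    and c: "(\<exists>i. c = Pop i) \<or> (\<exists>i A d e. c = Cond i A d e) \<or> (\<exists>i A d. c = Loop i A d)"
    and step: "cstep (c # k, s) = (k', s')"
  shows "trun M (2 * length (s i) + 4) (code_state (c # k, Home), tape s, -1)
     (code_state (k', Home), tape s', -1) []"
proof -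
  let ?k = "c # k" and ?n = "length (s i)"
  have k': "k' \<in> K" using closed[OF assms(1), of s] step by simp
  have ok': "ok_stacks s'" using ok_stacks_cstep[OF assms(2), of "c # k"] wf_K[OF assms(1)] step by auto
  have right: "\<And>xs. xs ! stack_of c = 0 \<Longrightarrow>
      delta (?k, Go_Right) xs = Some ((?k, At_Top), xs, -1, None)"
    and home: "delta (?k, Home) [] = Some ((?k, Go_Right), [], 1, None)"
    using c by auto
  have next_cont: "fst (cstep (?k, \<lambda>_. [top_of (s i)])) = k'"
    using c step i by auto
  have "trun M (Suc (?n + Suc (Suc (Suc ?n)))) (code_state (?k, Home), tape s, -1)
     (code_state (k', Home), tape s', -1) ([] @ [])"
  proof (rule trun_stay)
    show "M (code_state (?k, Home)) (tape s (-1)) = Some (code_state (?k, Go_Right), tape s (-1), 1, None)"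
      using assms(1) home by (simp add: read_home del: delta.simps) (simp add: tape_def)
    have "trun M (Suc (Suc (Suc ?n))) (code_state (?k, Go_Right), tape s, int ?n)
       (code_state (k', Home), tape s', -1) []"
    proof (rule trun_stay)
      show "M (code_state (?k, Go_Right)) (tape s (int ?n)) =
          Some (code_state (?k, At_Top), tape s (int ?n), -1, None)"
        using assms(1,2) i by (simp add: read_cell nth_cell right del: delta.simps) (simp add: tape_def)
      let ?y = "(case c of Pop i \<Rightarrow> code_sym ((cell s (?n - 1))[i := 0]) | _ \<Rightarrow> code_sym (cell s (?n - 1)))"
      \<comment> \<open>On an empty stack the step to the left lands on the marker. The update
        \<open>[][i := 0]\<close> leaves it intact, so popping an empty stack changes
        nothing.\<close>
      let ?z = "if s i = [] then code_sym [] else ?y"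
      show "trun M (Suc (Suc ?n)) (code_state (?k, At_Top), tape s, int ?n + - 1)
         (code_state (k', Home), tape s', -1) []"
      proof (rule trun_Suc)
        show "M (code_state (?k, At_Top)) (tape s (int ?n + - 1)) =
            Some (code_state (k', Go_Back), ?z, 0, None)"
        proof (cases "s i")
          case Nil
          then show ?thesis using assms(1) next_cont c by (auto simp: read_home)
        next
          case (Cons a xs)
          then have "cell s (length xs) ! stack_of c = top_of (s i)" using i by (simp add: nth_cell
              nth_append)
          then show ?thesis using Cons assms(1,2) next_cont c by (auto simp: read_cell)
        qed
        have "(tape s)(int ?n + - 1 := ?z) = tape s'"
        proof (cases "s i")
          case Nil
          then have "tape s' = tape s" using c step i by (auto split: if_splits simp: fun_upd_idem)
          with Nil show ?thesis by (simp add: tape_def fun_eq_iff)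
        next
          case (Cons a xs)
          show ?thesis
          proof (cases "\<exists>i. c = Pop i")
            case True
            then show ?thesis using Cons i step tape_pop[of i s a xs] by auto
          next
            case False
            then have "s' = s" using c step by (auto split: if_splits)
            moreover have "?z = code_sym (cell s (length xs))" using False Cons c by auto
            ultimately show ?thesis using Cons by (simp add: fun_upd_idem tape_def)
          qed
        qed
        then show "trun M (Suc ?n) (code_state (k', Go_Back), (tape s)(int ?n + - 1 := ?z), int ?n + - 1 + 0)
            (code_state (k', Home), tape s', -1) []"
          using go_back[OF k' ok', of ?n] by simp
      qed
    qed
    with go_right[of ?k s ?n] assms
    show "trun M (?n + Suc (Suc (Suc ?n))) (code_state (?k, Go_Right), tape s, - 1 + 1)
       (code_state (k', Home), tape s', -1) ([] @ [])"
      by (intro trun_trans) auto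
  qed
  then show ?thesis by (simp add: eval_nat_numeral mult_2)
qed

lemma simulate_step:
  assumes "k \<in> K" "k \<noteq> []" "ok_stacks s" "\<forall>i<6. length (s i) \<le> L" "cstep (k, s) = (k', s')"
  shows "\<exists>n out. trun M n (code_state (k, Home), tape s, -1) (code_state (k', Home), tape s', -1) out
     \<and> n \<le> 2 * L + 4 \<and> rev (s' 6) = rev (s 6) @ out"
proof -
  obtain c r where k: "k = c # r" using assms(2) by (cases k) auto
  have k': "k' \<in> K" using closed[OF assms(1), of s] assms(5) by simp
  have wfc: "wf_com c" using wf_K[OF assms(1)] k by auto
  show ?thesis
  proof (cases "(\<exists>i. c = Pop i) \<or> (\<exists>i A d e. c = Cond i A d e) \<or> (\<exists>i A d. c = Loop i A d)")
    case True
    then have i: "stack_of c < 6" using wfc by auto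
    have "s' 6 = s 6" using True wfc assms(5) k by auto
    moreover have "2 * length (s (stack_of c)) + 4 \<le> 2 * L + 4" using assms(4) i by simp
    ultimately show ?thesis
      using simulate_read[OF _ assms(3) refl i True, of r k' s'] assms k by (metis append_Nil2)
  next
    case no_read: False
    show ?thesis
    proof (cases "\<exists>i a. c = Push i a")
      case True
      then obtain i a where c: "c = Push i a" by blast
      show ?thesis
      proof (cases "i = 6")
        case True
        have "M (code_state (k, Home)) (tape s (-1)) = Some (code_state (r, Home), tape s (-1), 0, Some a)"
          using assms(1) True by (simp add: k c read_home) (simp add: tape_def)
        from trun_one[of M "code_state (k, Home)" "tape s" "-1", OF this] show ?thesis
          using assms(5) True by (intro exI[of _ "Suc 0"] exI[of _ "[a]"]) (auto simp: k c tape_out)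
      next
        case False
        then have i: "i < 6" "0 < a" "a < 8" using wfc c by auto
        then have "2 * length (s i) + 3 \<le> 2 * L + 4" using assms(4) by force
        moreover have "k' = r" "s' = s(i := a # s i)" using assms(5) k c by auto
        ultimately show ?thesis
          using simulate_push[of i a r s] assms(1,3) k' i k c False by (metis append_Nil2 fun_upd_other)
      qed
    next
      case False
      then have "s' = s" and "delta (k, Home) [] = Some ((k', Home), [], 0, None)"
        using no_read assms(5) by (cases c; auto simp: k)+
      then have "M (code_state (k, Home)) (tape s (-1)) = Some (code_state (k', Home), tape s (-1), 0, None)"
        using assms(1) by (simp add: read_home del: delta.simps) (simp add: tape_def)
      from trun_one[of M "code_state (k, Home)" "tape s" "-1", OF this] show ?thesis
        using \<open>s' = s\<close> by (intro exI[of _ "Suc 0"] exI[of _ "[]"]) auto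
    qed
  qed
qed

text \<open>A program step lengthens a stack by at most one, so during n steps none exceeds
  \<open>L + n\<close>, and this bounds every round trip. The slowdown is quadratic.\<close>

lemma simulate:
  assumes "k \<in> K" "ok_stacks s" "\<forall>i<6. length (s i) \<le> L" "(cstep ^^ n) (k, s) = (k', s')"
  shows "\<exists>m out. trun M m (code_state (k, Home), tape s, -1) (code_state (k', Home), tape s', -1) out
     \<and> m \<le> n * (2 * (L + n) + 4) \<and> rev (s' 6) = rev (s 6) @ out"
  using assms
proof (induction n arbitrary: k s L)
  case 0
  then show ?case by (auto intro: trun_refl)
next
  case (Suc n)
  show ?case
  proof (cases "k = []")
    case True
    have "(cstep ^^ j) ([], s) = ([], s)" for j by (induction j) auto
    with Suc.prems True have "k' = k" "s' = s" by (metis Pair_inject)+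
    then show ?thesis by (intro exI[of _ 0] exI[of _ "[]"]) (auto intro: trun_refl)
  next
    case False
    obtain k1 s1 where step: "cstep (k, s) = (k1, s1)" by fastforce
    from simulate_step[OF Suc.prems(1) False Suc.prems(2,3) step] obtain m out where m:
      "trun M m (code_state (k, Home), tape s, -1) (code_state (k1, Home), tape s1, -1) out"
      "m \<le> 2 * L + 4" "rev (s1 6) = rev (s 6) @ out" by blast
    have "k1 \<in> K" using closed[OF Suc.prems(1), of s] step by simp
    moreover have "ok_stacks s1" using ok_stacks_cstep[OF Suc.prems(2)] wf_K[OF Suc.prems(1)] step
      by (metis snd_conv)
    moreover have "\<forall>i<6. length (s1 i) \<le> Suc L"
      using length_cstep[of k s] Suc.prems(3) step by (metis Suc_le_mono le_trans snd_conv)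
    moreover have "(cstep ^^ n) (k1, s1) = (k', s')"
      using Suc.prems(4) step by (simp add: funpow_swap1)
    ultimately obtain m' out' where m':
      "trun M m' (code_state (k1, Home), tape s1, -1) (code_state (k', Home), tape s', -1) out'"
      "m' \<le> n * (2 * (Suc L + n) + 4)" "rev (s' 6) = rev (s1 6) @ out'"
      using Suc.IH by blast
    have "m + m' \<le> Suc n * (2 * (L + Suc n) + 4)"
      using m(2) m'(2) by (simp add: algebra_simps)
    with trun_trans[OF m(1) m'(1)] m(3) m'(3) show ?thesis
      by (metis append.assoc)
  qed
qed

end

theorem compile:
  assumes "wf_com c"
  shows "\<exists>M. wf_tm M \<and> (\<forall>w n s. (\<forall>a\<in>set w. 0 < a \<and> a < 8) \<longrightarrow>
     (cstep ^^ n) ([c], (\<lambda>_. [])(0 := rev w)) = ([], s) \<longrightarrow>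
     (\<exists>T. T \<le> n * (2 * (length w + n) + 4) + 2 \<and> tm_halted M (run M w T) \<and>
        tm_output M w T = rev (s 6)))"
proof -
  define K where "K = insert [] (conts c [])"
  define Q where "Q = K \<times> (UNIV :: phase set)"
  have "finite (UNIV :: phase set)"
  proof -
    have "(UNIV :: phase set) = {Init1, Init2, Home, Go_Right, At_Top, Go_Back}"
      by (auto intro: phase.exhaust)
    then show ?thesis by (metis finite.emptyI finite.insertI)
  qed
  then have "finite Q" by (simp add: Q_def K_def finite_conts)
  then obtain f :: "com list \<times> phase \<Rightarrow> nat" and l where f: "inj_on f Q" "f ` Q = {i. i < l}"
    using finite_imp_inj_to_nat_seg by metis
  \<comment> \<open>Machines start in state 0, so the initial state gets this number and the others
    are shifted by one.\<close>
  define code where "code q = (if q = ([c], Init1) then 0 else Suc (f q))" for q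
  have inj_code: "inj_on code Q" using f(1) by (auto simp: inj_on_def code_def)
  have code_le: "code q \<le> l" if "q \<in> Q" for q
  proof -
    have "f q \<in> {i. i < l}" using f(2) that by blast
    then show ?thesis by (simp add: code_def Suc_le_eq)
  qed
  define M :: tm where "M n a = (if n \<in> code ` Q \<and> a \<in> code_sym ` syms
      then map_option (\<lambda>(q, ys, d, e). (code q, code_sym ys, d, e))
        (delta (the_inv_into Q code n) (the_inv_into syms code_sym a)) else None)" for n a
  have M_eq: "M (code q) (code_sym xs) =
      map_option (\<lambda>(q, ys, d, e). (code q, code_sym ys, d, e)) (delta q xs)"
    if "q \<in> Q" "xs \<in> syms" for q xs
    using that by (simp add: M_def the_inv_into_f_f inj_code inj_code_sym)
  have closed: "fst (cstep (k, s)) \<in> K" if "k \<in> K" for k s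
    using that conts_closed[of k c "[]" s] by (auto simp: K_def)
  have wf_K: "wf_com d" if "k \<in> K" "d \<in> set k" for k d
    using that conts_wf[of k c "[]" d] assms by (auto simp: K_def)
  have c_in_K: "[c] \<in> K" by (simp add: K_def head_in_conts)
  interpret compiled K code M
    by unfold_locales (use closed wf_K M_eq in \<open>auto simp: Q_def\<close>)
  have delta_closed: "q' \<in> Q \<and> ys \<in> syms \<and> d \<in> {-1, 0, 1} \<and> (\<forall>a. e = Some a \<longrightarrow> a < 8)"
    if dq: "delta q xs = Some (q', ys, d, e)" and qQ: "q \<in> Q" and xs: "xs \<in> syms" for q xs q' ys d e
  proof -
    obtain k ph where q: "q = (k, ph)" "k \<in> K" using qQ by (auto simp: Q_def)
    have upd: "xs[i := a] \<in> syms" if "a < 8" for i a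
      using that \<open>xs \<in> syms\<close> set_update_subset_insert[of xs i a] by (auto simp: syms_def)
    show ?thesis
    proof (cases ph)
      case Home
      have "delta_home k xs = Some (q', ys, d, e)" using dq xs q Home by simp
      then show ?thesis using closed[OF q(2), of "\<lambda>_. []"] xs q(2) wf_K[OF q(2), of "hd k"]
        by (cases "(k, xs)" rule: delta_home.cases) (auto simp: Q_def split: if_splits)
    next
      case Go_Right
      show ?thesis
      proof (cases "k = [] \<or> xs ! stack_of (hd k) \<noteq> 0")
        case True
        then show ?thesis using dq xs q Go_Right by (auto simp: Q_def split: if_splits)
      next
        case False
        then obtain b r where k: "k = b # r" by (cases k) auto
        show ?thesis using dq xs q Go_Right False closed[OF q(2), of "\<lambda>_. []"] wf_K[OF q(2), of b]
          by (cases b) (auto simp: Q_def k upd)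
      qed
    next
      case At_Top
      then show ?thesis using dq xs q closed[OF q(2)]
        by (auto simp: Q_def upd split: if_splits com.splits)
    qed (use dq xs q in \<open>auto simp: Q_def syms_def split: if_splits\<close>)
  qed
  have wf: "wf_tm M"
    unfolding wf_tm_def
  \<comment> \<open>One bound has to exceed the state codes (at most \<open>l\<close>), the symbol
    codes (at most \<open>8 ^ 6\<close>) and the emitted symbols (below 8).\<close>
  proof (intro exI[of _ "l + 8 ^ 6 + 9"] conjI allI impI)
    fix q a assume "l + 8 ^ 6 + 9 \<le> q \<or> l + 8 ^ 6 + 9 \<le> a"
    then show "M q a = None"
      unfolding M_def using code_le code_sym_le by fastforce
  next
    fix q a q' b d e assume "M q a = Some (q', b, d, e)"
    then obtain q0 xs q1 ys where *: "q0 \<in> Q" "xs \<in> syms" "delta q0 xs = Some (q1, ys, d, e)"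
      "q' = code q1" "b = code_sym ys"
      unfolding M_def by (auto split: if_splits simp: the_inv_into_f_f inj_code inj_code_sym)
    from delta_closed[OF *(3,1,2)] have cl: "q1 \<in> Q" "ys \<in> syms" "d \<in> {-1, 0, 1}"
      "\<And>a. e = Some a \<Longrightarrow> a < 8" by auto
    show "q' < l + 8 ^ 6 + 9" "b < l + 8 ^ 6 + 9"
      using code_le[OF cl(1)] code_sym_le[OF cl(2)] *(4,5) by simp_all
    show "d \<in> {-1, 0, 1}" by fact
    show "a < l + 8 ^ 6 + 9" if "e = Some a" for a using cl(4)[OF that] by simp
  qed
  moreover have "\<exists>T. T \<le> n * (2 * (length w + n) + 4) + 2 \<and> tm_halted M (run M w T) \<and>
      tm_output M w T = rev (s 6)"
    if w: "\<forall>a\<in>set w. 0 < a \<and> a < 8" and n: "(cstep ^^ n) ([c], (\<lambda>_. [])(0 := rev w)) = ([], s)" for w n s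
  proof -
    let ?s0 = "(\<lambda>_. [])(0 := rev w) :: stacks"
    have ok: "ok_stacks ?s0" using w by (auto simp: ok_stacks_def)
    have tp: "fst (snd (init_config w)) j = (if j = -1 then 0 else tape ?s0 j)" for j
      by (auto simp: init_config_def tape_def cell_def upt_rec code_sym_def)
    define tp0 where "tp0 = (\<lambda>i. if 0 \<le> i \<and> nat i < length w then w ! nat i else 0)"
    \<comment> \<open>The initial tape differs from the tape of the start stacks only on cell -1,
      where the blank is read as the empty cell.\<close>
    have tp0: "tp0 j = (if j = -1 then code_sym (replicate 6 0) else tape ?s0 j)" for j
      using tp[of j] by (simp add: init_config_def tp0_def code_sym_def eval_nat_numeral)
    have blank: "replicate 6 0 \<in> syms" by (simp add: syms_def)
    have "trun M (Suc (Suc 0)) (code ([c], Init1), tp0, 0) (code ([c], Home), tape ?s0, -1) []"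
    proof (rule trun_stay)
      show "M (code ([c], Init1)) (tp0 0) = Some (code ([c], Init2), tp0 0, -1, None)"
        using read_cell[OF c_in_K ok, of Init1 0] by (simp add: tp0) (simp add: tape_def)
      show "trun M (Suc 0) (code ([c], Init2), tp0, 0 + -1) (code ([c], Home), tape ?s0, -1) []"
      proof (rule trun_Suc)
        show "M (code ([c], Init2)) (tp0 (0 + - 1)) = Some (code ([c], Home), code_sym [], 0, None)"
          using M[OF c_in_K blank, of Init2] by (simp add: tp0)
        have "tp0(-1 := code_sym []) = tape ?s0" using tp0 by (auto simp: fun_eq_iff tape_def)
        then show "trun M 0 (code ([c], Home), tp0(0 + - 1 := code_sym []), 0 + - 1 + 0)
            (code ([c], Home), tape ?s0, - 1) []" by (simp add: trun_refl)
      qed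
    qed
    moreover have "\<forall>i<6. length (?s0 i) \<le> length w" by simp
    from simulate[OF c_in_K ok this n] obtain m out where
      "trun M m (code ([c], Home), tape ?s0, -1) (code ([], Home), tape s, -1) out"
      "m \<le> n * (2 * (length w + n) + 4)" "rev (s 6) = out" by auto
    moreover have "init_config w = (code ([c], Init1), tp0, 0)"
      by (simp add: init_config_def tp0_def code_def)
    ultimately have "trun M (Suc (Suc 0) + m) (init_config w) (code ([], Home), tape s, -1) (rev (s 6))"
      using trun_trans by fastforce
    note r = trun_run[OF this]
    have "tm_halted M (code ([], Home), tape s, -1)"
      using read_home[of "[]" Home s] by (simp add: K_def)
    then show ?thesis
      using r \<open>m \<le> _\<close> by (intro exI[of _ "Suc (Suc 0) + m"]) auto
  qed
  ultimately show ?thesis by blast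
qed

section \<open>Tree manipulation on a stack\<close>

definition steps :: "nat \<Rightarrow> com list \<times> stacks \<Rightarrow> com list \<times> stacks \<Rightarrow> bool" where
  "steps b x y \<longleftrightarrow> (\<exists>n\<le>b. (cstep ^^ n) x = y)"

text \<open>The quantifier over all continuations makes the statement usable inside any program;
  \<open>b\<close> is only an upper bound, so that time bounds can be rounded up.\<close>

definition exec :: "com \<Rightarrow> stacks \<Rightarrow> nat \<Rightarrow> stacks \<Rightarrow> bool" where
  "exec c s b s' \<longleftrightarrow> (\<forall>k. steps b (c # k, s) (k, s'))"

lemma steps_trans: "steps a x y \<Longrightarrow> steps b y z \<Longrightarrow> a + b \<le> c \<Longrightarrow> steps c x z"
  unfolding steps_def
proof (elim exE conjE)
  fix n m assume "n \<le> a" "m \<le> b" "a + b \<le> c" "(cstep ^^ n) x = y" "(cstep ^^ m) y = z"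
  then have "m + n \<le> c" "(cstep ^^ (m + n)) x = z" by (auto simp: funpow_add)
  then show "\<exists>n\<le>c. (cstep ^^ n) x = z" by blast
qed

lemma steps_one: "cstep x = y \<Longrightarrow> 1 \<le> b \<Longrightarrow> steps b x y"
  unfolding steps_def by (intro exI[of _ 1]) auto

lemma steps_Suc: "steps b (cstep x) y \<Longrightarrow> b < c \<Longrightarrow> steps c x y"
  by (rule steps_trans[OF steps_one[OF refl order_refl]]) (simp_all add: Suc_le_eq)

lemma exec_Skip: "1 \<le> b \<Longrightarrow> exec Skip s b s"
  by (auto simp: exec_def intro!: steps_one)

lemma exec_Push: "s' = s(i := a # s i) \<Longrightarrow> 1 \<le> b \<Longrightarrow> exec (Push i a) s b s'"
  by (auto simp: exec_def intro!: steps_one)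

lemma exec_Pop: "s' = s(i := tl (s i)) \<Longrightarrow> 1 \<le> b \<Longrightarrow> exec (Pop i) s b s'"
  by (auto simp: exec_def intro!: steps_one)

lemma exec_Seq:
  assumes "exec c s a s1" "exec d s1 b s2" "a + b + 1 \<le> n"
  shows "exec (Seq c d) s n s2"
  unfolding exec_def
proof
  fix k
  have run: "steps (a + b) (c # d # k, s) (k, s2)"
    by (rule steps_trans[OF assms(1)[unfolded exec_def, rule_format]
          assms(2)[unfolded exec_def, rule_format] order_refl])
  show "steps n (Seq c d # k, s) (k, s2)"
    by (rule steps_Suc[of "a + b"]) (use run assms(3) in auto)
qed

lemma exec_Cond:
  assumes "top_of (s i) \<in> A \<Longrightarrow> exec c s b s'" "top_of (s i) \<notin> A \<Longrightarrow> exec d s b s'" "b + 1 \<le> n"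
  shows "exec (Cond i A c d) s n s'"
  unfolding exec_def
proof
  fix k
  show "steps n (Cond i A c d # k, s) (k, s')"
    by (rule steps_Suc[of b]) (use assms in \<open>auto simp: exec_def\<close>)
qed

lemma exec_Loop_done: "top_of (s i) \<notin> A \<Longrightarrow> 1 \<le> n \<Longrightarrow> exec (Loop i A c) s n s"
  unfolding exec_def by (auto intro!: steps_one)

lemma exec_Loop_step:
  assumes "top_of (s i) \<in> A" "exec c s a s1" "exec (Loop i A c) s1 b s2" "a + b + 1 \<le> n"
  shows "exec (Loop i A c) s n s2"
  unfolding exec_def
proof
  fix k
  have run: "steps (a + b) (c # Loop i A c # k, s) (k, s2)"
    by (rule steps_trans[OF assms(2)[unfolded exec_def, rule_format]
          assms(3)[unfolded exec_def, rule_format] order_refl])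
  show "steps n (Loop i A c # k, s) (k, s2)"
    by (rule steps_Suc[of "a + b"]) (use run assms(1,4) in auto)
qed

lemma exec_mono: "exec c s a s' \<Longrightarrow> a \<le> b \<Longrightarrow> exec c s b s'"
  unfolding exec_def steps_def using le_trans by blast

text \<open>A step pushes at most one symbol. Hence a time bound is also a bound on the size of the
  result, without a separate analysis.\<close>

lemma exec_length: "exec c s b s' \<Longrightarrow> length (s' i) \<le> length (s i) + b"
proof -
  have *: "length (snd ((cstep ^^ n) x) i) \<le> length (snd x i) + n" for n x
  proof (induction n)
    case (Suc n)
    then show ?case
      using length_cstep[of "fst ((cstep ^^ n) x)" "snd ((cstep ^^ n) x)" i] by simp
  qed simp
  assume "exec c s b s'"
  then obtain n where "n \<le> b" "(cstep ^^ n) ([c], s) = ([], s')" by (auto simp: exec_def steps_def)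
  with *[of n "([c], s)"] show ?thesis by simp
qed

section \<open>Trees serialized on a stack\<close>

datatype tree = Leaf | Node tree tree

text \<open>Preorder with 1 for a leaf and 2 for a node. The word is self-delimiting, so several
  trees can lie on one stack without separators.\<close>

primrec ser :: "tree \<Rightarrow> nat list" where
  "ser Leaf = [1]"
| "ser (Node l r) = 2 # ser l @ ser r"

lemma ser_length_pos: "0 < length (ser t)" by (cases t) auto

lemma set_ser: "set (ser t) \<subseteq> {1, 2}" by (induction t) auto

primrec push_all :: "nat list \<Rightarrow> nat \<Rightarrow> com" where
  "push_all [] a = Skip"
| "push_all (j # js) a = Seq (Push j a) (push_all js a)"

definition add_all :: "nat list \<Rightarrow> nat list \<Rightarrow> stacks \<Rightarrow> stacks" where
  "add_all js u s = (\<lambda>i. if i \<in> set js then u @ s i else s i)"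

lemma exec_push_all:
  "distinct js \<Longrightarrow> exec (push_all js a) s (2 * length js + 1) (add_all js [a] s)"
proof (induction js arbitrary: s)
  case Nil
  then show ?case by (auto simp: add_all_def intro: exec_Skip)
next
  case (Cons j js)
  have eq: "add_all js [a] (s(j := a # s j)) = add_all (j # js) [a] s"
    using Cons.prems by (auto simp: add_all_def fun_eq_iff)
  have "exec (push_all js a) (s(j := a # s j)) (2 * length js + 1) (add_all (j # js) [a] s)"
    using Cons unfolding eq[symmetric] by simp
  from exec_Seq[OF exec_Push[OF refl order_refl] this] show ?case by simp
qed

text \<open>Stack 5 counts in unary the subtrees that remain to be read.\<close>

definition move_body :: "nat list \<Rightarrow> com" where
  "move_body js = Cond 1 {2} (Seq (Pop 1) (Seq (push_all js 2) (Push 5 1)))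
     (Seq (Pop 1) (Seq (push_all js 1) (Pop 5)))"

text \<open>A node turns one pending subtree into two and a leaf closes one, so the loop stops
  exactly behind the topmost tree. Each target receives it reversed: no target drops the tree, two
  targets copy it.\<close>

definition move :: "nat list \<Rightarrow> com" where
  "move js = Seq (Push 5 1) (Loop 5 {1} (move_body js))"

lemma pop_push_push:
  assumes "distinct js" "1 \<notin> set js" "5 \<notin> set js" "s 1 = a # u" "s 5 = d"
  shows "exec (Seq (Pop 1) (Seq (push_all js b) (Push 5 c))) s (5 + 2 * length js)
     ((add_all js [b] (s(1 := u)))(5 := c # d))"
proof -
  have "exec (push_all js b) (s(1 := u)) (2 * length js + 1) (add_all js [b] (s(1 := u)))"
    by (rule exec_push_all[OF assms(1)])
  moreover have "exec (Push 5 c) (add_all js [b] (s(1 := u))) 1 ((add_all js [b] (s(1 := u)))(5 := c # d))"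
    using assms by (intro exec_Push) (simp_all add: add_all_def)
  moreover have "exec (Pop 1) s 1 (s(1 := u))" using assms by (intro exec_Pop) simp_all
  ultimately show ?thesis by (auto intro: exec_Seq[OF _ exec_Seq[OF _ _ order_refl]])
qed

lemma pop_push_pop:
  assumes "distinct js" "1 \<notin> set js" "5 \<notin> set js" "s 1 = a # u" "s 5 = c # d"
  shows "exec (Seq (Pop 1) (Seq (push_all js b) (Pop 5))) s (5 + 2 * length js)
     ((add_all js [b] (s(1 := u)))(5 := d))"
proof -
  have "exec (push_all js b) (s(1 := u)) (2 * length js + 1) (add_all js [b] (s(1 := u)))"
    by (rule exec_push_all[OF assms(1)])
  moreover have "exec (Pop 5) (add_all js [b] (s(1 := u))) 1 ((add_all js [b] (s(1 := u)))(5 := d))"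
    using assms by (intro exec_Pop) (simp_all add: add_all_def)
  moreover have "exec (Pop 1) s 1 (s(1 := u))" using assms by (intro exec_Pop) simp_all
  ultimately show ?thesis by (auto intro: exec_Seq[OF _ exec_Seq[OF _ _ order_refl]])
qed

text \<open>The claim is about the loop together with whatever it does afterwards. Both subtrees of
  a node are consumed by iterations of the same loop, so only a statement in this form can be
  applied twice in the induction step.\<close>

lemma move_loop:
  fixes t r d
  assumes "distinct js" "1 \<notin> set js" "5 \<notin> set js"
    and "s 1 = ser t @ r" "s 5 = 1 # d"
    and "exec (Loop 5 {1} (move_body js)) ((add_all js (rev (ser t)) s)(1 := r, 5 := d)) b s'"
    and "length (ser t) * (2 * length js + 8) + b \<le> n"
  shows "exec (Loop 5 {1} (move_body js)) s n s'"
  using assms(4-)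
proof (induction t arbitrary: s r d b n)
  case Leaf
  let ?s = "(add_all js (rev (ser Leaf)) s)(1 := r, 5 := d)"
  have eq: "?s = (add_all js [1] (s(1 := r)))(5 := d)"
    using assms(2,3) by (auto simp: add_all_def fun_eq_iff)
  have body: "exec (move_body js) s (6 + 2 * length js) ?s"
    unfolding move_body_def eq
    by (rule exec_Cond[where b = "5 + 2 * length js"])
      (use pop_push_pop[OF assms(1-3), of s 1 r 1 d 1] Leaf.prems in auto)
  show ?case
    by (rule exec_Loop_step[OF _ body Leaf.prems(3)]) (use Leaf.prems in auto)
next
  case (Node t1 t2)
  let ?s = "(add_all js [2] (s(1 := ser t1 @ ser t2 @ r)))(5 := 1 # 1 # d)"
  have body: "exec (move_body js) s (6 + 2 * length js) ?s"
    unfolding move_body_def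
    by (rule exec_Cond[where b = "5 + 2 * length js"])
      (use pop_push_push[OF assms(1-3), of s 2 "ser t1 @ ser t2 @ r" "1 # d" 2 1] Node.prems in auto)
  let ?c = "2 * length js + 8"
  let ?t = "(add_all js (rev (ser t1)) ?s)(1 := ser t2 @ r, 5 := 1 # d)"
  let ?f = "(add_all js (rev (ser (Node t1 t2))) s)(1 := r, 5 := d)"
  have "(add_all js (rev (ser t2)) ?t)(1 := r, 5 := d) = ?f"
    using assms(2,3) by (simp add: add_all_def fun_eq_iff)
  with Node.prems(3) have 1: "exec (Loop 5 {1} (move_body js))
      ((add_all js (rev (ser t2)) ?t)(1 := r, 5 := d)) b s'" by metis
  have 2: "exec (Loop 5 {1} (move_body js)) ?t (length (ser t2) * ?c + b) s'"
    by (rule Node.IH(2)[OF _ _ 1]) (use assms(2,3) in \<open>simp_all add: add_all_def\<close>)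
  have 3: "exec (Loop 5 {1} (move_body js)) ?s (length (ser t1) * ?c + (length (ser t2) * ?c + b)) s'"
    by (rule Node.IH(1)[OF _ _ 2]) (use assms(2,3) in \<open>simp_all add: add_all_def\<close>)
  show ?case
    by (rule exec_Loop_step[OF _ body 3]) (use Node.prems in \<open>simp_all add: algebra_simps\<close>)
qed

lemma exec_move:
  assumes "distinct js" "1 \<notin> set js" "5 \<notin> set js" "s 1 = ser t @ r" "s 5 = []"
    and "length (ser t) * (2 * length js + 8) + 3 \<le> n"
  shows "exec (move js) s n ((add_all js (rev (ser t)) s)(1 := r))"
  unfolding move_def
proof (rule exec_Seq[OF exec_Push[OF refl, of 1]])
  show "exec (Loop 5 {1} (move_body js)) (s(5 := 1 # s 5)) (length (ser t) * (2 * length js + 8) + 1)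
      ((add_all js (rev (ser t)) s)(1 := r))"
  proof (rule move_loop[OF assms(1-3)])
    have "(add_all js (rev (ser t)) (s(5 := 1 # s 5)))(1 := r, 5 := []) = (add_all js (rev (ser t)) s)(1
        := r)"
      using assms(3,5) by (auto simp: add_all_def fun_eq_iff)
    then show "exec (Loop 5 {1} (move_body js))
       ((add_all js (rev (ser t)) (s(5 := 1 # s 5)))(1 := r, 5 := [])) 1
       ((add_all js (rev (ser t)) s)(1 := r))"
      using assms(3,5) by (auto intro!: exec_Loop_done simp: add_all_def)
  qed (use assms in auto)
qed (use assms in auto)

definition unload :: "nat \<Rightarrow> com" where
  "unload j = Loop j {1, 2} (Cond j {1} (Seq (Pop j) (Push 1 1)) (Seq (Pop j) (Push 1 2)))"

lemma exec_unload:
  "set u \<subseteq> {1, 2} \<Longrightarrow> j \<noteq> 1 \<Longrightarrow> s j = u \<Longrightarrow> 5 * length u + 1 \<le> n \<Longrightarrow>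
     exec (unload j) s n (s(j := [], 1 := rev u @ s 1))"
proof (induction u arbitrary: s n)
  case Nil
  have "s(j := []) = s" using Nil.prems(3) by (rule fun_upd_idem)
  then have eq: "s(j := [], 1 := rev [] @ s 1) = s" by simp
  show ?case
    unfolding unload_def eq by (rule exec_Loop_done) (use Nil.prems in simp_all)
next
  case (Cons a u)
  let ?s = "s(j := u, 1 := a # s 1)"
  have pp: "exec (Seq (Pop j) (Push 1 a)) s 3 ?s"
    by (rule exec_Seq[OF exec_Pop[OF refl order_refl] exec_Push[OF _ order_refl]])
       (use Cons.prems in simp_all)
  have body: "exec (Cond j {1} (Seq (Pop j) (Push 1 1)) (Seq (Pop j) (Push 1 2))) s 4 ?s"
    by (rule exec_Cond[where b = 3]) (use Cons.prems pp in auto)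
  have eq: "?s(j := [], 1 := rev u @ ?s 1) = s(j := [], 1 := rev (a # u) @ s 1)"
    using Cons.prems(2) by (simp add: fun_eq_iff)
  have "exec (unload j) ?s (5 * length u + 1) (?s(j := [], 1 := rev u @ ?s 1))"
    by (rule Cons.IH) (use Cons.prems in simp_all)
  then have rest: "exec (Loop j {1, 2} (Cond j {1} (Seq (Pop j) (Push 1 1)) (Seq (Pop j) (Push 1 2)))) ?s
      (5 * length u + 1) (s(j := [], 1 := rev (a # u) @ s 1))"
    unfolding eq unfolding unload_def .
  show ?case
    unfolding unload_def by (rule exec_Loop_step[OF _ body rest]) (use Cons.prems in auto)
qed

text \<open>The calling convention: operations find and leave all data on stack 1, with the scratch
  stacks empty.\<close>

definition main :: "nat list \<Rightarrow> stacks" where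
  "main u = (\<lambda>_. [])(1 := u)"

definition dup :: com where "dup = Seq (move [2, 3]) (Seq (unload 2) (unload 3))"
definition drop_tree :: com where "drop_tree = move []"
definition swap :: com where "swap = Seq (move [2]) (Seq (move [3]) (Seq (unload 2) (unload 3)))"
text \<open>Exchanges the second and the third tree. A fold uses it to bring the accumulator next to
  the head of the list.\<close>

definition rot :: com where
  "rot = Seq (move [2]) (Seq (move [3]) (Seq (move [4]) (Seq (unload 3) (Seq (unload 4) (unload 2)))))"

lemma wf_tree_coms [simp]:
  "wf_com dup" "wf_com drop_tree" "wf_com swap" "wf_com rot"
  by (simp_all add: dup_def drop_tree_def swap_def rot_def move_def move_body_def unload_def)

lemma exec_unload_ser:
  assumes "j \<noteq> 1" "s j = rev (ser t)" "5 * length (ser t) + 1 \<le> n" "s' = s(j := [], 1 := ser t @ s 1)"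
  shows "exec (unload j) s n s'"
  using exec_unload[of "rev (ser t)" j s n] assms set_ser[of t] by auto

lemma exec_move_ser:
  assumes "distinct js" "1 \<notin> set js" "5 \<notin> set js" "s 1 = ser t @ r" "s 5 = []"
    "length (ser t) * (2 * length js + 8) + 3 \<le> n" "s' = (add_all js (rev (ser t)) s)(1 := r)"
  shows "exec (move js) s n s'"
  using exec_move[OF assms(1-6)] assms(7) by simp

lemma exec_drop_tree:
  "8 * length (ser t) + 3 \<le> n \<Longrightarrow> exec drop_tree (main (ser t @ r)) n (main r)"
  unfolding drop_tree_def
  by (rule exec_move_ser[where t = t and r = r]) (auto simp: main_def add_all_def fun_eq_iff)

lemma exec_dup:
  assumes "22 * length (ser t) + 10 \<le> n"
  shows "exec dup (main (ser t @ r)) n (main (ser t @ ser t @ r))"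
proof -
  define n1 where "n1 = length (ser t) * 12 + 3"
  define n2 where "n2 = 5 * length (ser t) + 1"
  let ?s = "(\<lambda>_. [])(1 := r, 2 := rev (ser t), 3 := rev (ser t)) :: stacks"
  let ?s' = "(\<lambda>_. [])(1 := ser t @ r, 3 := rev (ser t)) :: stacks"
  have 1: "exec (move [2, 3]) (main (ser t @ r)) n1 ?s"
    by (rule exec_move_ser[where t = t and r = r]) (auto simp: main_def add_all_def fun_eq_iff n1_def)
  have 2: "exec (unload 2) ?s n2 ?s'"
    by (rule exec_unload_ser[where t = t]) (auto simp: fun_eq_iff n2_def)
  have 3: "exec (unload 3) ?s' n2 (main (ser t @ ser t @ r))"
    by (rule exec_unload_ser[where t = t]) (auto simp: main_def fun_eq_iff n2_def)
  show ?thesis unfolding dup_def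
    by (rule exec_Seq[OF 1 exec_Seq[OF 2 3 order_refl]]) (use assms in \<open>simp add: n1_def n2_def\<close>)
qed

lemma exec_swap:
  assumes "15 * length (ser t) + 15 * length (ser u) + 20 \<le> n"
  shows "exec swap (main (ser t @ ser u @ r)) n (main (ser u @ ser t @ r))"
proof -
  define n1 where "n1 t = length (ser t) * 10 + 3" for t
  define n2 where "n2 t = 5 * length (ser t) + 1" for t
  let ?s1 = "(\<lambda>_. [])(1 := ser u @ r, 2 := rev (ser t)) :: stacks"
  let ?s2 = "(\<lambda>_. [])(1 := r, 2 := rev (ser t), 3 := rev (ser u)) :: stacks"
  let ?s3 = "(\<lambda>_. [])(1 := ser t @ r, 3 := rev (ser u)) :: stacks"
  have 1: "exec (move [2]) (main (ser t @ ser u @ r)) (n1 t) ?s1"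
    by (rule exec_move_ser[where t = t and r = "ser u @ r"])
      (auto simp: main_def add_all_def fun_eq_iff n1_def)
  have 2: "exec (move [3]) ?s1 (n1 u) ?s2"
    by (rule exec_move_ser[where t = u and r = r]) (auto simp: add_all_def fun_eq_iff n1_def)
  have 3: "exec (unload 2) ?s2 (n2 t) ?s3"
    by (rule exec_unload_ser[where t = t]) (auto simp: fun_eq_iff n2_def)
  have 4: "exec (unload 3) ?s3 (n2 u) (main (ser u @ ser t @ r))"
    by (rule exec_unload_ser[where t = u]) (auto simp: main_def fun_eq_iff n2_def)
  show ?thesis unfolding swap_def
    by (rule exec_Seq[OF 1 exec_Seq[OF 2 exec_Seq[OF 3 4 order_refl] order_refl]])
      (use assms in \<open>simp add: n1_def n2_def\<close>)
qed

lemma exec_rot: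
  assumes "15 * (length (ser t) + length (ser u) + length (ser v)) + 20 \<le> n"
  shows "exec rot (main (ser t @ ser u @ ser v @ r)) n (main (ser t @ ser v @ ser u @ r))"
proof -
  define n1 where "n1 t = length (ser t) * 10 + 3" for t
  define n2 where "n2 t = 5 * length (ser t) + 1" for t
  let ?s1 = "(\<lambda>_. [])(1 := ser u @ ser v @ r, 2 := rev (ser t)) :: stacks"
  let ?s2 = "(\<lambda>_. [])(1 := ser v @ r, 2 := rev (ser t), 3 := rev (ser u)) :: stacks"
  let ?s3 = "(\<lambda>_. [])(1 := r, 2 := rev (ser t), 3 := rev (ser u), 4 := rev (ser v)) :: stacks"
  let ?s4 = "(\<lambda>_. [])(1 := ser u @ r, 2 := rev (ser t), 4 := rev (ser v)) :: stacks"
  let ?s5 = "(\<lambda>_. [])(1 := ser v @ ser u @ r, 2 := rev (ser t)) :: stacks"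
  have 1: "exec (move [2]) (main (ser t @ ser u @ ser v @ r)) (n1 t) ?s1"
    by (rule exec_move_ser[where t = t and r = "ser u @ ser v @ r"])
      (auto simp: main_def add_all_def fun_eq_iff n1_def)
  have 2: "exec (move [3]) ?s1 (n1 u) ?s2"
    by (rule exec_move_ser[where t = u and r = "ser v @ r"])
      (auto simp: add_all_def fun_eq_iff n1_def)
  have 3: "exec (move [4]) ?s2 (n1 v) ?s3"
    by (rule exec_move_ser[where t = v and r = r]) (auto simp: add_all_def fun_eq_iff n1_def)
  have 4: "exec (unload 3) ?s3 (n2 u) ?s4"
    by (rule exec_unload_ser[where t = u]) (auto simp: fun_eq_iff n2_def)
  have 5: "exec (unload 4) ?s4 (n2 v) ?s5"
    by (rule exec_unload_ser[where t = v]) (auto simp: fun_eq_iff n2_def)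
  have 6: "exec (unload 2) ?s5 (n2 t) (main (ser t @ ser v @ ser u @ r))"
    by (rule exec_unload_ser[where t = t]) (auto simp: main_def fun_eq_iff n2_def)
  show ?thesis unfolding rot_def
    by (rule exec_Seq[OF 1 exec_Seq[OF 2 exec_Seq[OF 3 exec_Seq[OF 4 exec_Seq[OF 5 6
        order_refl] order_refl] order_refl] order_refl]])
      (use assms in \<open>simp add: n1_def n2_def\<close>)
qed

section \<open>Polynomial-time functions on encoded data\<close>

class enc =
  fixes tr :: "'a \<Rightarrow> tree"

instantiation unit :: enc
begin
definition tr_unit :: "unit \<Rightarrow> tree" where "tr_unit u = Leaf"
instance ..
end

text \<open>The topmost symbol alone decides a test: 2 for \<open>True\<close>, 1 for
  \<open>False\<close>. For lists the same symbol separates nonempty from empty.\<close>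

instantiation bool :: enc
begin
definition tr_bool :: "bool \<Rightarrow> tree" where "tr_bool b = (if b then Node Leaf Leaf else Leaf)"
instance ..
end

instantiation prod :: (enc, enc) enc
begin
definition tr_prod :: "'a \<times> 'b \<Rightarrow> tree" where "tr_prod p = Node (tr (fst p)) (tr (snd p))"
instance ..
end

instantiation list :: (enc) enc
begin
primrec tr_list :: "'a list \<Rightarrow> tree" where
  "tr_list [] = Leaf"
| "tr_list (x # xs) = Node (tr x) (tr_list xs)"
instance ..
end

definition bits :: "nat \<Rightarrow> bool list" where
  "bits n = map (\<lambda>d. d = 1) (bin n)"

text \<open>Binary digits keep a variable linear in the length of its code in the input; a unary
  encoding could be exponentially larger.\<close>

instantiation nat :: enc
begin
definition tr_nat :: "nat \<Rightarrow> tree" where "tr_nat n = tr (bits n)"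
instance ..
end

text \<open>Tape symbols, encoded in unary so that a program can print them.\<close>

datatype sym = Sym (unSym: nat)

instantiation sym :: enc
begin
definition tr_sym :: "sym \<Rightarrow> tree" where "tr_sym a = (Node Leaf ^^ unSym a) Leaf"
instance ..
end

definition sz :: "'a::enc \<Rightarrow> nat" where "sz x = length (ser (tr x))"

lemma tr_simps [simp]:
  "tr (a, b) = Node (tr a) (tr b)" "tr True = Node Leaf Leaf" "tr False = Leaf"
  "tr [] = Leaf" "tr (y # ys) = Node (tr y) (tr ys)"
  by (simp_all add: tr_prod_def tr_bool_def)

lemma sz_simps [simp]:
  "sz (a, b) = Suc (sz a + sz b)" "sz [] = 1" "sz (y # ys) = Suc (sz y + sz ys)"
  "sz True = 3" "sz False = 1"
  by (simp_all add: sz_def)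

lemma sz_pos: "0 < sz x"
  unfolding sz_def by (rule ser_length_pos)

lemma sz_bool: "sz (b :: bool) \<le> 3" by (cases b) auto

lemma sz_mem: "y \<in> set ys \<Longrightarrow> sz y < sz ys"
  by (induction ys) auto

lemma length_le_sz: "length ys < sz ys"
  by (induction ys) auto

text \<open>A single power of \<open>n + 2\<close> stands in for polynomials: the base is at least 2
  even for n = 0, so the exponent absorbs constants, and sums, products and compositions keep the
  form. Monotonicity allows larger arguments to be substituted.\<close>

definition polyb :: "(nat \<Rightarrow> nat) \<Rightarrow> bool" where
  "polyb q \<longleftrightarrow> mono q \<and> (\<exists>K. \<forall>n. q n \<le> (n + 2) ^ K)"

lemma polyb_mono: "polyb q \<Longrightarrow> a \<le> b \<Longrightarrow> q a \<le> q b"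
  by (auto simp: polyb_def mono_def)

lemma polyb_const: "polyb (\<lambda>n. c)"
proof -
  have "c \<le> (n + 2) ^ c" for n :: nat
    using less_exp[of c] power_mono[of 2 "n + 2" c] by (meson le_add2 less_imp_le_nat order_trans zero_le)
  then show ?thesis unfolding polyb_def mono_def by blast
qed

lemma polyb_id: "polyb (\<lambda>n. n)"
  unfolding polyb_def mono_def by (auto intro!: exI[of _ 1])

lemma polyb_mult:
  assumes "polyb f" "polyb g" shows "polyb (\<lambda>n. f n * g n)"
proof -
  obtain K L where "\<And>n. f n \<le> (n + 2) ^ K" "\<And>n. g n \<le> (n + 2) ^ L"
    using assms by (auto simp: polyb_def)
  then have "\<And>n. f n * g n \<le> (n + 2) ^ (K + L)" by (simp add: power_add mult_mono)
  then show ?thesis using assms by (auto simp: polyb_def mono_def intro!: mult_mono)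
qed

lemma polyb_add:
  assumes "polyb f" "polyb g" shows "polyb (\<lambda>n. f n + g n)"
proof -
  obtain K L where KL: "\<And>n. f n \<le> (n + 2) ^ K" "\<And>n. g n \<le> (n + 2) ^ L"
    using assms by (auto simp: polyb_def)
  have "f n + g n \<le> (n + 2) ^ (K + L + 1)" for n
  proof -
    have "f n \<le> (n + 2) ^ (K + L)" "g n \<le> (n + 2) ^ (K + L)"
      using KL[of n] by (meson le_add1 le_add2 le_trans power_increasing one_le_numeral trans_le_add2)+
    moreover have "2 * (n + 2) ^ (K + L) \<le> (n + 2) * (n + 2) ^ (K + L)" by (rule mult_right_mono) auto
    ultimately show ?thesis by simp
  qed
  then have "\<exists>K. \<forall>n. f n + g n \<le> (n + 2) ^ K" by blast
  then show ?thesis using assms by (auto simp: polyb_def mono_def intro!: add_mono)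
qed

lemma polyb_comp:
  assumes "polyb f" "polyb g" shows "polyb (\<lambda>n. f (g n))"
proof -
  obtain K L where KL: "\<And>n. f n \<le> (n + 2) ^ K" "\<And>n. g n \<le> (n + 2) ^ L"
    using assms by (auto simp: polyb_def)
  have "f (g n) \<le> (n + 2) ^ ((L + 2) * K)" for n
  proof -
    have "1 \<le> (n + 2) ^ L" by simp
    \<comment> \<open>The factor is rounded up from 3 to 4, which is at most
      \<open>(n + 2) ^ 2\<close>.\<close>
    then have "g n + 2 \<le> 4 * (n + 2) ^ L" using KL(2)[of n] by linarith
    also have "\<dots> \<le> (n + 2) ^ 2 * (n + 2) ^ L" by (rule mult_right_mono) (auto simp: power2_eq_square)
    also have "\<dots> = (n + 2) ^ (L + 2)" by (simp only: power_add mult.commute)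
    finally have "(g n + 2) ^ K \<le> ((n + 2) ^ (L + 2)) ^ K" by (rule power_mono) simp
    then show ?thesis unfolding power_mult by (rule order_trans[OF KL(1)])
  qed
  then show ?thesis using assms by (auto simp: polyb_def mono_def)
qed

lemma polyb_Suc: "polyb f \<Longrightarrow> polyb (\<lambda>n. Suc (f n))"
  using polyb_add[of f "\<lambda>_. 1"] polyb_const[of 1] by simp

lemmas polyb_intros = polyb_const polyb_id polyb_add polyb_mult polyb_Suc

section \<open>Functions computed by stack programs in measured time\<close>

abbreviation put :: "'a::enc \<Rightarrow> nat list" where "put x \<equiv> ser (tr x)"

text \<open>The measure \<open>m\<close> allows for running times that are not polynomial in the input
  size.\<close>

definition PTB :: "('a::enc \<Rightarrow> nat) \<Rightarrow> ('a \<Rightarrow> 'b::enc) \<Rightarrow> bool" where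
  "PTB m f \<longleftrightarrow> (\<exists>c q. wf_com c \<and> polyb q \<and>
     (\<forall>x r. exec c (main (put x @ r)) (q (m x + sz x)) (main (put (f x) @ r))))"

abbreviation PT :: "('a::enc \<Rightarrow> 'b::enc) \<Rightarrow> bool" where
  "PT \<equiv> PTB (\<lambda>_. 0)"

lemma PTB_I:
  assumes "wf_com c" "polyb q"
    and "\<And>x r. exec c (main (put x @ r)) (q (m x + sz x)) (main (put (f x) @ r))"
  shows "PTB m f"
  using assms by (auto simp: PTB_def)

lemma PTB_E:
  assumes "PTB m f"
  obtains c q where "wf_com c" "polyb q"
    "\<And>x r n. m x + sz x \<le> n \<Longrightarrow> exec c (main (put x @ r)) (q n) (main (put (f x) @ r))"
  using assms unfolding PTB_def by (meson exec_mono polyb_mono)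

text \<open>The time bound is read as a size bound. Composition needs it, since the second program
  runs on the output of the first.\<close>

lemma PTB_size:
  assumes "PTB m f"
  obtains q where "polyb q" "\<And>x. sz (f x) \<le> q (m x + sz x)"
proof -
  from assms obtain c q where q: "wf_com c" "polyb q"
    "\<And>x r n. m x + sz x \<le> n \<Longrightarrow> exec c (main (put x @ r)) (q n) (main (put (f x) @ r))"
    by (rule PTB_E) (rule that)
  have "sz (f x) \<le> (m x + sz x) + q (m x + sz x)" for x
    using exec_length[OF q(3)[of x _ "[]"], of _ 1] by (force simp: main_def sz_def)
  moreover have "polyb (\<lambda>n. n + q n)" using q(2) by (intro polyb_intros)
  ultimately show thesis by (rule that[rotated])
qed

lemma PTB_measure:
  assumes "PTB m f" "polyb q" "\<And>x. m x \<le> q (m' x + sz x)"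
  shows "PTB m' f"
proof -
  from assms(1) obtain c p where c: "wf_com c" "polyb p"
    "\<And>x r n. m x + sz x \<le> n \<Longrightarrow> exec c (main (put x @ r)) (p n) (main (put (f x) @ r))"
    by (rule PTB_E) (rule that)
  show ?thesis
  proof (rule PTB_I[OF c(1)])
    show "polyb (\<lambda>n. p (q n + n))" using assms(2) by (intro polyb_comp[OF c(2)] polyb_intros)
    show "exec c (main (put x @ r)) (p (q (m' x + sz x) + (m' x + sz x))) (main (put (f x) @ r))" for x r
      using assms(3)[of x] by (intro c(3)) simp
  qed
qed

lemma PTB_comp:
  assumes "PTB m f" "PTB m' g" "\<And>x. m' (f x) \<le> m x"
  shows "PTB m (\<lambda>x. g (f x))"
proof -
  from assms(1) obtain c p where c: "wf_com c" "polyb p"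
    "\<And>x r n. m x + sz x \<le> n \<Longrightarrow> exec c (main (put x @ r)) (p n) (main (put (f x) @ r))"
    by (rule PTB_E) (rule that)
  from assms(2) obtain d q where d: "wf_com d" "polyb q"
    "\<And>x r n. m' x + sz x \<le> n \<Longrightarrow> exec d (main (put x @ r)) (q n) (main (put (g x) @ r))"
    by (rule PTB_E) (rule that)
  from assms(1) obtain s where s: "polyb s" "\<And>x. sz (f x) \<le> s (m x + sz x)" by (rule PTB_size) (rule that)
  show ?thesis
  proof (rule PTB_I)
    show "wf_com (Seq c d)" using c d by simp
    show "polyb (\<lambda>n. Suc (p n + q (n + s n)))"
      using c(2) s(1) by (intro polyb_comp[OF d(2)] polyb_intros)
    fix x r
    let ?n = "m x + sz x"
    have "m' (f x) + sz (f x) \<le> ?n + s ?n" using s(2)[of x] assms(3)[of x] by simp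
    from exec_Seq[OF c(3)[OF order_refl] d(3)[OF this]]
    show "exec (Seq c d) (main (put x @ r)) (Suc (p ?n + q (?n + s ?n))) (main (put (g (f x)) @ r))"
      by simp
  qed
qed

lemma PT_comp: "PT f \<Longrightarrow> PT g \<Longrightarrow> PT (\<lambda>x. g (f x))"
  by (rule PTB_comp) auto

lemma PT_id: "PT (\<lambda>x. x)"
proof (rule PTB_I)
  show "exec Skip (main (put x @ r)) (0 + sz x) (main (put x @ r))" for x :: 'a and r
    using sz_pos[of x] by (intro exec_Skip) simp
qed (auto intro: polyb_intros)

text \<open>Programs see trees only, so values of different types with equal trees are
  interchangeable: a nonempty list is a pair, a number is its list of digits, a symbol is a list of
  units.\<close>

lemma PT_same:
  assumes "PT f" "\<And>x. tr (g x) = tr (f x)"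
  shows "PT g"
  using assms unfolding PTB_def by simp

fun push_list :: "nat list \<Rightarrow> com" where
  "push_list [] = Skip"
| "push_list (a # u) = Seq (push_list u) (Push 1 a)"

lemma exec_push_list: "exec (push_list u) s (2 * length u + 1) (s(1 := u @ s 1))"
proof (induction u)
  case Nil
  then show ?case by (simp add: exec_Skip)
next
  case (Cons a u)
  have "exec (Push 1 a) (s(1 := u @ s 1)) 1 (s(1 := (a # u) @ s 1))"
    by (rule exec_Push) simp_all
  from exec_Seq[OF Cons.IH this order_refl] show ?case
    unfolding push_list.simps by (rule exec_mono) simp
qed

lemma exec_push_list_main: "exec (push_list u) (main r) (2 * length u + 1) (main (u @ r))"
proof -
  have "(main r)(1 := u @ main r 1) = main (u @ r)" by (simp add: main_def)
  then show ?thesis using exec_push_list[of u "main r"] by metis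
qed

lemma wf_push_list: "set u \<subseteq> {1, 2} \<Longrightarrow> wf_com (push_list u)"
  by (induction u) auto

lemma exec_drop_put: "8 * sz x + 3 \<le> n \<Longrightarrow> exec drop_tree (main (put x @ r)) n (main r)"
  unfolding sz_def by (rule exec_drop_tree)

lemma exec_dup_put: "22 * sz x + 10 \<le> n \<Longrightarrow> exec dup (main (put x @ r)) n (main (put x @ put x @ r))"
  unfolding sz_def by (rule exec_dup)

lemma exec_swap_put:
  "15 * (sz x + sz y) + 20 \<le> n \<Longrightarrow> exec swap (main (put x @ put y @ r)) n (main (put y @ put x @ r))"
  unfolding sz_def by (rule exec_swap) simp

lemma exec_rot_put:
  "15 * (sz x + sz y + sz z) + 20 \<le> n \<Longrightarrow>
     exec rot (main (put x @ put y @ put z @ r)) n (main (put x @ put z @ put y @ r))"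
  unfolding sz_def by (rule exec_rot)

lemma exec_Pop_main: "exec (Pop 1) (main (a # r)) 1 (main r)"
  by (rule exec_Pop) (simp_all add: main_def)

lemma exec_Push_main: "exec (Push 1 a) (main r) 1 (main (a # r))"
  by (rule exec_Push) (simp_all add: main_def)

text \<open>The program prints a fixed word, so \<open>c\<close> may be any value, whether or not
  there is a way to compute it. The entries of the clause table enter programs through this
  lemma.\<close>

lemma PT_const: "PT (\<lambda>_::'a::enc. c :: 'b::enc)"
proof (rule PTB_I)
  show "wf_com (Seq drop_tree (push_list (put c)))" using wf_push_list[OF set_ser, of "tr c"] by simp
  show "polyb (\<lambda>n. 8 * n + (2 * length (put c) + 10))" by (intro polyb_intros)
  show "exec (Seq drop_tree (push_list (put c))) (main (put x @ r))
      (8 * (0 + sz x) + (2 * length (put c) + 10)) (main (put c @ r))" for x :: 'a and r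
    by (rule exec_Seq[OF exec_drop_put[OF order_refl] exec_push_list_main]) simp
qed

lemma PT_fst0: "PT (fst :: 'a::enc \<times> 'b::enc \<Rightarrow> 'a)"
proof (rule PTB_I)
  show "wf_com (Seq (Pop 1) (Seq swap drop_tree))" by simp
  show "polyb (\<lambda>n. 50 * n + 50)" by (intro polyb_intros)
  fix z :: "'a \<times> 'b" and r
  obtain x y where z: "z = (x, y)" by fastforce
  show "exec (Seq (Pop 1) (Seq swap drop_tree)) (main (put z @ r)) (50 * (0 + sz z) + 50) (main (put (fst
      z) @ r))"
  proof -
    have "exec (Seq (Pop 1) (Seq swap drop_tree)) (main (2 # put x @ put y @ r)) (50 * sz z + 50) (main
        (put x @ r))"
      by (rule exec_Seq[OF exec_Pop_main exec_Seq[OF exec_swap_put[OF order_refl]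
        exec_drop_put[OF order_refl] order_refl]]) (simp add: z)
    then show ?thesis by (simp add: z)
  qed
qed

lemma PT_snd0: "PT (snd :: 'a::enc \<times> 'b::enc \<Rightarrow> 'b)"
proof (rule PTB_I)
  show "wf_com (Seq (Pop 1) drop_tree)" by simp
  show "polyb (\<lambda>n. 50 * n + 50)" by (intro polyb_intros)
  fix z :: "'a \<times> 'b" and r
  obtain x y where z: "z = (x, y)" by fastforce
  show "exec (Seq (Pop 1) drop_tree) (main (put z @ r)) (50 * (0 + sz z) + 50) (main (put (snd z) @ r))"
  proof -
    have "exec (Seq (Pop 1) drop_tree) (main (2 # put x @ put y @ r)) (50 * sz z + 50) (main (put y @ r))"
      by (rule exec_Seq[OF exec_Pop_main exec_drop_put[OF order_refl]]) (simp add: z)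
    then show ?thesis by (simp add: z)
  qed
qed

named_theorems pt

declare PT_id [pt] PT_const [pt]

lemma PT_fst [pt]: "PT f \<Longrightarrow> PT (\<lambda>x. fst (f x))" by (rule PT_comp[OF _ PT_fst0])
lemma PT_snd [pt]: "PT f \<Longrightarrow> PT (\<lambda>x. snd (f x))" by (rule PT_comp[OF _ PT_snd0])

lemma PT_Pair [pt]:
  fixes f :: "'a::enc \<Rightarrow> 'b::enc" and g :: "'a \<Rightarrow> 'c::enc"
  assumes "PT f" "PT g"
  shows "PT (\<lambda>x. (f x, g x))"
proof -
  from assms(1) obtain c p where c: "wf_com c" "polyb p"
    "\<And>x r n. 0 + sz x \<le> n \<Longrightarrow> exec c (main (put x @ r)) (p n) (main (put (f x) @ r))"
    by (rule PTB_E) (rule that)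
  from assms(2) obtain d q where d: "wf_com d" "polyb q"
    "\<And>x r n. 0 + sz x \<le> n \<Longrightarrow> exec d (main (put x @ r)) (q n) (main (put (g x) @ r))"
    by (rule PTB_E) (rule that)
  from assms(1) obtain s where s: "polyb s" "\<And>x. sz (f x) \<le> s (0 + sz x)" by (rule PTB_size) (rule that)
  from assms(2) obtain t where t: "polyb t" "\<And>x. sz (g x) \<le> t (0 + sz x)" by (rule PTB_size) (rule that)
  let ?c = "Seq dup (Seq c (Seq swap (Seq d (Seq swap (Push 1 2)))))"
  let ?b = "\<lambda>n. 22 * n + p n + q n + 30 * (n + s n + t n) + 100"
  show ?thesis
  proof (rule PTB_I)
    show "wf_com ?c" using c d by simp
    show "polyb ?b" using c(2) d(2) s(1) t(1) by (intro polyb_intros)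
    fix x :: 'a and r
    have st: "sz (f x) \<le> s (sz x)" "sz (g x) \<le> t (sz x)" using s(2)[of x] t(2)[of x] by simp_all
    have "exec ?c (main (put x @ r)) (?b (sz x)) (main (2 # put (f x) @ put (g x) @ r))"
      by (rule exec_Seq[OF exec_dup_put[OF order_refl] exec_Seq[OF c(3)[of x "sz x"] exec_Seq[OF
         exec_swap_put[OF order_refl] exec_Seq[OF d(3)[of x "sz x"] exec_Seq[OF exec_swap_put[OF order_refl]
         exec_Push_main order_refl] order_refl] order_refl] order_refl]])
        (use st in auto)
    then show "exec ?c (main (put x @ r)) (?b (0 + sz x)) (main (put (f x, g x) @ r))" by simp
  qed
qed

lemma PT_if [pt]:
  fixes f g :: "'a::enc \<Rightarrow> 'b::enc"
  assumes "PT b" "PT f" "PT g"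
  shows "PT (\<lambda>x. if b x then f x else g x)"
proof -
  from assms(1) obtain c p where c: "wf_com c" "polyb p"
    "\<And>x r n. 0 + sz x \<le> n \<Longrightarrow> exec c (main (put x @ r)) (p n) (main (put (b x) @ r))"
    by (rule PTB_E) (rule that)
  from assms(2) obtain d q where d: "wf_com d" "polyb q"
    "\<And>x r n. 0 + sz x \<le> n \<Longrightarrow> exec d (main (put x @ r)) (q n) (main (put (f x) @ r))"
    by (rule PTB_E) (rule that)
  from assms(3) obtain e t where e: "wf_com e" "polyb t"
    "\<And>x r n. 0 + sz x \<le> n \<Longrightarrow> exec e (main (put x @ r)) (t n) (main (put (g x) @ r))"
    by (rule PTB_E) (rule that)
  let ?i = "Cond 1 {2} (Seq drop_tree d) (Seq drop_tree e)"
  let ?c = "Seq dup (Seq c ?i)"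
  let ?b = "\<lambda>n. 22 * n + p n + (q n + t n) + 100"
  show ?thesis
  proof (rule PTB_I)
    show "wf_com ?c" using c d e by simp
    show "polyb ?b" using c(2) d(2) e(2) by (intro polyb_intros)
    fix x :: 'a and r
    let ?n = "sz x"
    have "exec ?i (main (put (b x) @ put x @ r)) (q ?n + t ?n + 50)
        (main (put (if b x then f x else g x) @ r))"
    proof (rule exec_Cond[where b = "q ?n + t ?n + 30"])
      assume "top_of (main (put (b x) @ put x @ r) 1) \<in> {2}"
      then have "b x" by (cases "b x") (auto simp: main_def)
      then show "exec (Seq drop_tree d) (main (put (b x) @ put x @ r)) (q ?n + t ?n + 30)
          (main (put (if b x then f x else g x) @ r))"
        using exec_Seq[OF exec_drop_put[OF order_refl] d(3)[of x ?n r], of "b x" "q ?n + t ?n + 30"] by simp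
    next
      assume "top_of (main (put (b x) @ put x @ r) 1) \<notin> {2}"
      then have "\<not> b x" by (cases "b x") (auto simp: main_def)
      then show "exec (Seq drop_tree e) (main (put (b x) @ put x @ r)) (q ?n + t ?n + 30)
          (main (put (if b x then f x else g x) @ r))"
        using exec_Seq[OF exec_drop_put[OF order_refl] e(3)[of x ?n r], of "b x" "q ?n + t ?n + 30"] by simp
    qed simp
    note i = this
    have "exec ?c (main (put x @ r)) (?b ?n) (main (put (if b x then f x else g x) @ r))"
      by (rule exec_Seq[OF exec_dup_put[OF order_refl] exec_Seq[OF c(3)[of x ?n] i order_refl]]) auto
    then show "exec ?c (main (put x @ r)) (?b (0 + ?n)) (main (put (if b x then f x else g x) @ r))"
      by simp
  qed
qed

lemma PT_Cons [pt]: "PT f \<Longrightarrow> PT g \<Longrightarrow> PT (\<lambda>x. f x # g x)"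
  by (rule PT_same[OF PT_Pair]) auto

lemma PT_Not [pt]: "PT b \<Longrightarrow> PT (\<lambda>x. \<not> b x)"
  by (rule PT_same[OF PT_if[of b "\<lambda>_. False" "\<lambda>_. True"]]) (simp_all add: PT_const)

lemma PT_conj [pt]: "PT b \<Longrightarrow> PT b' \<Longrightarrow> PT (\<lambda>x. b x \<and> b' x)"
  by (rule PT_same[OF PT_if[of b b' "\<lambda>_. False"]]) (simp_all add: PT_const)

lemma PT_disj [pt]: "PT b \<Longrightarrow> PT b' \<Longrightarrow> PT (\<lambda>x. b x \<or> b' x)"
  by (rule PT_same[OF PT_if[of b "\<lambda>_. True" b']]) (simp_all add: PT_const)

lemma PT_bool_eq [pt]: "PT b \<Longrightarrow> PT b' \<Longrightarrow> PT (\<lambda>x. (b x :: bool) = b' x)"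
  by (rule PT_same[OF PT_if[of b b' "\<lambda>x. \<not> b' x"]]) (simp_all add: PT_Not)

text \<open>After the test nothing has to be unpacked: a nonempty list has the tree of the pair of
  its head and tail, and pushing the symbol 2 pairs it with the environment
  \<open>x\<close>.\<close>

lemma PT_case_list:
  fixes l :: "'a::enc \<Rightarrow> 'c::enc list" and f :: "'a \<Rightarrow> 'b::enc"
  assumes "PT l" "PT f" "PT (\<lambda>z. g (snd z) (fst (fst z)) (snd (fst z)))"
  shows "PT (\<lambda>x. case l x of [] \<Rightarrow> f x | y # ys \<Rightarrow> g x y ys)"
proof -
  from assms(2) obtain d q where d: "wf_com d" "polyb q"
    "\<And>x r n. 0 + sz x \<le> n \<Longrightarrow> exec d (main (put x @ r)) (q n) (main (put (f x) @ r))"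
    by (rule PTB_E) (rule that)
  from assms(3) obtain e t where e: "wf_com e" "polyb t"
    "\<And>x r n. 0 + sz x \<le> n \<Longrightarrow> exec e (main (put x @ r)) (t n)
        (main (put (g (snd x) (fst (fst x)) (snd (fst x))) @ r))"
    by (rule PTB_E) (rule that)
  let ?i = "Cond 1 {2} (Seq (Push 1 2) e) (Seq drop_tree d)"
  let ?c = "Seq (Pop 1) ?i"
  let ?b = "\<lambda>n. (q n + t n) + 50"
  have "PT (\<lambda>z. case fst z of [] \<Rightarrow> f (snd z) | y # ys \<Rightarrow> g (snd z) y ys)"
  proof (rule PTB_I)
    show "wf_com ?c" using d e by simp
    show "polyb ?b" using d(2) e(2) by (intro polyb_intros)
    fix z :: "'c list \<times> 'a" and r
    obtain l x where z: "z = (l, x)" by fastforce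
    let ?n = "sz z"
    let ?v = "case l of [] \<Rightarrow> f x | y # ys \<Rightarrow> g x y ys"
    have i: "exec ?i (main (put l @ put x @ r)) (q ?n + t ?n + 40) (main (put ?v @ r))"
    proof (rule exec_Cond[where b = "q ?n + t ?n + 30"])
      assume "top_of (main (put l @ put x @ r) 1) \<in> {2}"
      then obtain y ys where l: "l = y # ys" by (cases l) (auto simp: main_def)
      have e': "exec e (main (put ((y, ys), x) @ r)) (t ?n) (main (put ?v @ r))"
        using e(3)[of "((y, ys), x)" ?n r] by (simp add: z l)
      show "exec (Seq (Push 1 2) e) (main (put l @ put x @ r)) (q ?n + t ?n + 30) (main (put ?v @ r))"
        using exec_Seq[OF exec_Push_main[of 2 "put l @ put x @ r"] , of e "t ?n" "main (put ?v @ r)" "q ?n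
            + t ?n + 30"]
          e' by (simp add: l)
    next
      assume "top_of (main (put l @ put x @ r) 1) \<notin> {2}"
      then have l: "l = []" by (cases l) (auto simp: main_def)
      show "exec (Seq drop_tree d) (main (put l @ put x @ r)) (q ?n + t ?n + 30) (main (put ?v @ r))"
        using exec_Seq[OF exec_drop_put[OF order_refl] d(3)[of x ?n r], of l "q ?n + t ?n + 30"]
        by (simp add: l z)
    qed simp
    have "exec ?c (main (2 # put l @ put x @ r)) (?b ?n) (main (put ?v @ r))"
      by (rule exec_Seq[OF exec_Pop_main i]) simp
    then show "exec ?c (main (put z @ r)) (?b (0 + ?n))
        (main (put (case fst z of [] \<Rightarrow> f (snd z) | y # ys \<Rightarrow> g (snd z) y ys) @ r))"
      unfolding z fst_conv snd_conv by simp
  qed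
  from PT_comp[OF PT_Pair[OF assms(1) PT_id] this] show ?thesis unfolding fst_conv snd_conv .
qed

section \<open>Folds over lists\<close>

definition fold_body :: "com \<Rightarrow> com" where
  "fold_body c = Seq (Pop 1) (Seq rot (Seq (Push 1 2) (Seq c swap)))"

lemma fold_loop:
  fixes l :: "'a::enc list" and s :: "'b::enc"
  assumes c: "\<And>x r n. 0 + sz x \<le> n \<Longrightarrow>
      exec c (main (put x @ r)) (q n) (main (put (f (fst x) (snd x)) @ r))"
    and "\<And>j. j \<le> length l \<Longrightarrow> sz (fold f (take j l) s) \<le> N" "sz l \<le> N"
  shows "exec (Loop 1 {2} (fold_body c)) (main (put l @ put s @ r))
    (length l * (q (2 * N) + 90 * N + 60) + 1) (main (1 # put (fold f l s) @ r))"
  using assms(2,3)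
proof (induction l arbitrary: s)
  case Nil
  have "exec (Loop 1 {2} (fold_body c)) (main (1 # put s @ r)) 1 (main (1 # put s @ r))"
    by (rule exec_Loop_done) (simp_all add: main_def)
  then show ?case by simp
next
  case (Cons y l)
  have s: "sz s \<le> N" using Cons.prems(1)[of 0] by simp
  have s': "sz (f y s) \<le> N" using Cons.prems(1)[of 1] by simp
  have le: "sz y + sz l + 1 \<le> N" using Cons.prems(2) by simp
  have rest: "exec (Loop 1 {2} (fold_body c)) (main (put l @ put (f y s) @ r))
    (length l * (q (2 * N) + 90 * N + 60) + 1) (main (1 # put (fold f l (f y s)) @ r))"
  proof (rule Cons.IH)
    show "sz (fold f (take j l) (f y s)) \<le> N" if "j \<le> length l" for j
      using Cons.prems(1)[of "Suc j"] that by simp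
  qed (use le in simp)
  have "exec c (main (put (y, s) @ put l @ r)) (q (2 * N)) (main (put (f y s) @ put l @ r))"
    using c[of "(y, s)" "2 * N"] s le by simp
  then have cc: "exec c (main (2 # put y @ put s @ put l @ r)) (q (2 * N)) (main (put (f y s) @ put l @ r))"
    by simp
  have body: "exec (fold_body c) (main (2 # put y @ put l @ put s @ r)) (q (2 * N) + 90 * N + 58)
      (main (put l @ put (f y s) @ r))"
    unfolding fold_body_def
    by (rule exec_Seq[OF exec_Pop_main exec_Seq[OF exec_rot_put[OF order_refl] exec_Seq[OF
        exec_Push_main exec_Seq[OF cc exec_swap_put[OF order_refl] order_refl] order_refl] order_refl]])
      (use s s' le in simp)
  have "exec (Loop 1 {2} (fold_body c)) (main (2 # put y @ put l @ put s @ r))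
     (length (y # l) * (q (2 * N) + 90 * N + 60) + 1) (main (1 # put (fold f l (f y s)) @ r))"
    by (rule exec_Loop_step[OF _ body rest]) (simp_all add: main_def)
  then show ?case by simp
qed

text \<open>The total size of all accumulators is taken as the measure, which replaces any growth
  condition on f. It bounds each accumulator, and the size of the input bounds the number of
  rounds.\<close>

lemma PTB_fold0:
  fixes f :: "'a::enc \<Rightarrow> 'b::enc \<Rightarrow> 'b"
  assumes "PT (\<lambda>z. f (fst z) (snd z))"
  shows "PTB (\<lambda>z. \<Sum>j\<le>length (fst z). sz (fold f (take j (fst z)) (snd z))) (\<lambda>z. fold f (fst z) (snd z))"
    (is "PTB ?m _")
proof -
  from assms obtain c q where c: "wf_com c" "polyb q"
    "\<And>x r n. 0 + sz x \<le> n \<Longrightarrow> exec c (main (put x @ r)) (q n) (main (put (f (fst x) (snd x)) @ r))"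
    by (rule PTB_E) (rule that)
  let ?c = "Seq (Pop 1) (Seq (Loop 1 {2} (fold_body c)) (Pop 1))"
  let ?b = "\<lambda>n. n * (q (2 * n) + 90 * n + 60) + 10"
  show ?thesis
  proof (rule PTB_I)
    show "wf_com ?c" using c by (simp add: fold_body_def)
    show "polyb ?b" by (intro polyb_comp[OF c(2)] polyb_intros)
    fix z :: "'a list \<times> 'b" and r
    obtain l s where z: "z = (l, s)" by fastforce
    let ?N = "?m z + sz z"
    have "sz (fold f (take j l) s) \<le> ?N" if "j \<le> length l" for j
    proof -
      have "sz (fold f (take j l) s) \<le> ?m z"
        unfolding z fst_conv snd_conv using that
        by (intro member_le_sum[of j "{..length l}" "\<lambda>j. sz (fold f (take j l) s)"]) auto
      then show ?thesis by simp
    qed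
    from fold_loop[OF c(3) this] have loop: "exec (Loop 1 {2} (fold_body c)) (main (put l @ put s @ r))
        (length l * (q (2 * ?N) + 90 * ?N + 60) + 1) (main (1 # put (fold f l s) @ r))"
      by (simp add: z)
    have "length l \<le> ?N" using length_le_sz[of l] by (simp add: z)
    then have "length l * (q (2 * ?N) + 90 * ?N + 60) \<le> ?N * (q (2 * ?N) + 90 * ?N + 60)"
      by (rule mult_right_mono) simp
    then have "exec ?c (main (2 # put l @ put s @ r)) (?b ?N) (main (put (fold f l s) @ r))"
      by (intro exec_Seq[OF exec_Pop_main exec_Seq[OF loop exec_Pop_main order_refl]]) linarith
    then show "exec ?c (main (put z @ r)) (?b ?N) (main (put (fold f (fst z) (snd z)) @ r))"
      by (simp add: z)
  qed
qed

text \<open>A fold program sees only the element and the accumulator, so the environment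
  \<open>x\<close> travels inside the accumulator.\<close>

lemma fold_with_env: "fold (\<lambda>y s. (fst s, f (fst s) y (snd s))) l (x, i) = (x, fold (f x) l i)"
  by (induction l arbitrary: i) auto

lemma PTB_fold:
  fixes f :: "'a::enc \<Rightarrow> 'c::enc \<Rightarrow> 'b::enc \<Rightarrow> 'b"
  assumes "PT l" "PT i" "PT (\<lambda>z. f (fst (snd z)) (fst z) (snd (snd z)))"
  shows "PTB (\<lambda>x. \<Sum>j\<le>length (l x). sz (fold (f x) (take j (l x)) (i x))) (\<lambda>x. fold (f x) (l x) (i x))"
proof -
  let ?F = "\<lambda>y s. (fst s, f (fst s) y (snd s))"
  let ?m0 = "\<lambda>z. \<Sum>j\<le>length (fst z). sz (fold ?F (take j (fst z)) (snd z))"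
  let ?M = "\<lambda>x. \<Sum>j\<le>length (l x). sz (fold ?F (take j (l x)) (x, i x))"
  have "PT (\<lambda>z. ?F (fst z) (snd z))" using assms(3) by (intro pt)
  then have *: "PTB ?m0 (\<lambda>z. fold ?F (fst z) (snd z))" by (rule PTB_fold0)
  have pre: "PT (\<lambda>x. (l x, (x, i x)))" using assms by (intro pt)
  have pre': "PTB ?M (\<lambda>x. (l x, (x, i x)))" by (rule PTB_measure[OF pre, of "\<lambda>_. 0"]) (auto intro:
      polyb_intros)
  have "PTB ?M (\<lambda>x. fold ?F (fst (l x, (x, i x))) (snd (l x, (x, i x))))"
    by (rule PTB_comp[OF pre' *]) simp
  then have "PTB ?M (\<lambda>x. snd (fold ?F (l x) (x, i x)))"
    by (intro PTB_comp[OF _ PT_snd0]) simp_all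
  then have main: "PTB ?M (\<lambda>x. fold (f x) (l x) (i x))" by (simp add: fold_with_env)
  from assms(1) obtain q where q: "polyb q" "\<And>x. sz (l x) \<le> q (0 + sz x)" by (rule PTB_size) (rule that)
  show ?thesis
  proof (rule PTB_measure[OF main])
    let ?m = "\<lambda>x. \<Sum>j\<le>length (l x). sz (fold (f x) (take j (l x)) (i x))"
    show "polyb (\<lambda>n. n + (q n + 1) * (n + 1))" using q(1) by (intro polyb_intros)
    fix x
    let ?n = "?m x + sz x"
    \<comment> \<open>Carrying \<open>x\<close> along adds \<open>sz x + 1\<close> to each of the
      \<open>length (l x) + 1\<close> accumulators.\<close>
    have "?M x = ?m x + (length (l x) + 1) * (sz x + 1)"
      by (simp add: fold_with_env sum.distrib sum_Suc algebra_simps)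
    also have "\<dots> \<le> ?n + (q ?n + 1) * (?n + 1)"
    proof (intro add_mono mult_mono)
      have "length (l x) \<le> q (sz x)" using q(2)[of x] length_le_sz[of "l x"] by simp
      also have "\<dots> \<le> q ?n" by (rule polyb_mono[OF q(1)]) simp
      finally show "length (l x) \<le> q ?n" .
    qed auto
    finally show "?M x \<le> ?n + (q ?n + 1) * (?n + 1)" .
  qed
qed

text \<open>The increment must not depend on the accumulator: an additive bound repeated
  \<open>length (l x)\<close> times stays polynomial, whereas doubling in each round would
  not.\<close>

lemma PT_fold:
  fixes f :: "'a::enc \<Rightarrow> 'c::enc \<Rightarrow> 'b::enc \<Rightarrow> 'b"
  assumes "PT l" "PT i" "PT (\<lambda>z. f (fst (snd z)) (fst z) (snd (snd z)))"
    and growth: "polyb g" "\<And>x y s. y \<in> set (l x) \<Longrightarrow> sz (f x y s) \<le> sz s + g (sz x)"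
  shows "PT (\<lambda>x. fold (f x) (l x) (i x))"
proof -
  from assms(1) obtain q where q: "polyb q" "\<And>x. sz (l x) \<le> q (0 + sz x)" by (rule PTB_size) (rule that)
  from assms(2) obtain p where p: "polyb p" "\<And>x. sz (i x) \<le> p (0 + sz x)" by (rule PTB_size) (rule that)
  have acc: "sz (fold (f x) ys s) \<le> sz s + length ys * g (sz x)" if "set ys \<subseteq> set (l x)" for x :: 'a and ys s
    using that
  proof (induction ys arbitrary: s)
    case (Cons y ys)
    then have "sz (fold (f x) ys (f x y s)) \<le> sz (f x y s) + length ys * g (sz x)" by simp
    also have "sz (f x y s) \<le> sz s + g (sz x)" using Cons.prems by (intro growth) simp
    finally show ?case by simp
  qed simp
  show ?thesis
  proof (rule PTB_measure[OF PTB_fold[OF assms(1-3)]])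
    show "polyb (\<lambda>n. (q n + 1) * (p n + q n * g n))" using q(1) p(1) growth(1) by (intro polyb_intros)
    fix x :: 'a
    let ?n = "sz x"
    have len: "length (l x) \<le> q ?n" using q(2)[of x] length_le_sz[of "l x"] by simp
    have "sz (fold (f x) (take j (l x)) (i x)) \<le> p ?n + q ?n * g ?n" for j
    proof -
      have "sz (fold (f x) (take j (l x)) (i x)) \<le> sz (i x) + length (take j (l x)) * g ?n"
        by (rule acc) (rule set_take_subset)
      also have "\<dots> \<le> p ?n + q ?n * g ?n"
        using p(2)[of x] len by (intro add_mono mult_right_mono) auto
      finally show ?thesis .
    qed
    then have "(\<Sum>j\<le>length (l x). sz (fold (f x) (take j (l x)) (i x))) \<le> (\<Sum>j\<le>length (l x). p ?n + q ?n * g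
        ?n)"
      by (intro sum_mono)
    also have "\<dots> = (length (l x) + 1) * (p ?n + q ?n * g ?n)" by simp
    also have "\<dots> \<le> (q ?n + 1) * (p ?n + q ?n * g ?n)" using len by (intro mult_right_mono) auto
    finally show "(\<Sum>j\<le>length (l x). sz (fold (f x) (take j (l x)) (i x)))
        \<le> (q (0 + sz x) + 1) * (p (0 + sz x) + q (0 + sz x) * g (0 + sz x))" by simp
  qed
qed

lemma PT_elem_size:
  assumes "PT (\<lambda>z. g (fst z) (snd z))" "PT l"
  obtains q where "polyb q" "\<And>x y. y \<in> set (l x) \<Longrightarrow> sz (g x y) \<le> q (sz x)"
proof -
  from assms(1) obtain p where p: "polyb p" "\<And>z. sz (g (fst z) (snd z)) \<le> p (0 + sz z)"
    by (rule PTB_size) (rule that)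
  from assms(2) obtain r where r: "polyb r" "\<And>x. sz (l x) \<le> r (0 + sz x)"
    by (rule PTB_size) (rule that)
  show thesis
  proof (rule that)
    show "polyb (\<lambda>n. p (n + r n))" using r(1) by (intro polyb_comp[OF p(1)] polyb_intros)
    show "sz (g x y) \<le> p (sz x + r (sz x))" if "y \<in> set (l x)" for x y
    proof -
      have "sz (x, y) \<le> sz x + r (sz x)" using sz_mem[OF that] r(2)[of x] by simp
      then have "p (sz (x, y)) \<le> p (sz x + r (sz x))" by (rule polyb_mono[OF p(1)])
      then show ?thesis using p(2)[of "(x, y)"] by simp
    qed
  qed
qed

section \<open>Operations on lists\<close>

lemma fold_Cons_rev: "fold (\<lambda>y s. y # s) ys s = rev ys @ s"
  by (induction ys arbitrary: s) auto

lemma PT_rev_append: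
  assumes "PT f" "PT g"
  shows "PT (\<lambda>x. rev (f x) @ g x)"
proof -
  from assms(1) obtain q where q: "polyb q" "\<And>x. sz (f x) \<le> q (0 + sz x)" by (rule PTB_size) (rule that)
  have "PT (\<lambda>x. fold (\<lambda>y s. y # s) (f x) (g x))"
  proof (rule PT_fold[OF assms _ q(1)])
    show "sz (y # s) \<le> sz s + q (sz x)" if "y \<in> set (f x)" for x y and s :: "'b list"
      using sz_mem[OF that] q(2)[of x] by simp
  qed (intro pt)
  then show ?thesis by (simp add: fold_Cons_rev)
qed

lemma PT_rev [pt]: "PT f \<Longrightarrow> PT (\<lambda>x. rev (f x))"
  using PT_rev_append[of f "\<lambda>_. []"] by (simp add: PT_const)

lemma PT_append [pt]: "PT f \<Longrightarrow> PT g \<Longrightarrow> PT (\<lambda>x. f x @ g x)"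
  using PT_rev_append[of "\<lambda>x. rev (f x)" g] by (simp add: PT_rev)

lemma PT_is_Nil [pt]: "PT f \<Longrightarrow> PT (\<lambda>x. f x = [])"
  by (rule PT_same[OF PT_case_list[of f "\<lambda>_. True" "\<lambda>_ _ _. False"]])
    (auto intro: PT_const split: list.splits)

lemma sz_append: "sz (xs @ ys) + 1 = sz xs + sz ys"
  by (induction xs) auto

lemma PT_Bex [pt]:
  assumes "PT (\<lambda>z. P (fst z) (snd z))" "PT l"
  shows "PT (\<lambda>x. \<exists>y\<in>set (l x). P x y)"
proof -
  have "fold (\<lambda>y b. b \<or> P x y) ys b = (b \<or> (\<exists>y\<in>set ys. P x y))" for x ys b
    by (induction ys arbitrary: b) auto
  moreover have "PT (\<lambda>x. fold (\<lambda>y b. b \<or> P x y) (l x) False)"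
  proof (rule PT_fold[OF assms(2) PT_const _ polyb_const[of 3]])
    have "PT (\<lambda>z. P (fst (snd z)) (fst z))" for z
      using PT_comp[OF _ assms(1), of "\<lambda>z. (fst (snd z), fst z)"] by (simp add: pt)
    then show "PT (\<lambda>z. snd (snd z) \<or> P (fst (snd z)) (fst z))" by (intro pt)
    show "sz (b \<or> P x y) \<le> sz b + 3" for x y b using sz_bool[of "b \<or> P x y"] by linarith
  qed
  ultimately show ?thesis by simp
qed

lemma PT_Ball [pt]:
  assumes "PT (\<lambda>z. P (fst z) (snd z))" "PT l"
  shows "PT (\<lambda>x. \<forall>y\<in>set (l x). P x y)"
  using PT_Not[OF PT_Bex[OF PT_Not[OF assms(1)] assms(2)]] by simp

lemma PT_filter [pt]:
  assumes "PT (\<lambda>z. P (fst z) (snd z))" "PT l"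
  shows "PT (\<lambda>x. filter (P x) (l x))"
proof -
  have "fold (\<lambda>y s. if P x y then y # s else s) ys s = rev (filter (P x) ys) @ s" for x ys s
    by (induction ys arbitrary: s) auto
  moreover
  from assms(2) obtain q where q: "polyb q" "\<And>x. sz (l x) \<le> q (0 + sz x)" by (rule PTB_size) (rule that)
  have "PT (\<lambda>x. rev (fold (\<lambda>y s. if P x y then y # s else s) (l x) []))"
  proof (rule PT_rev, rule PT_fold[OF assms(2) PT_const _ q(1)])
    have "PT (\<lambda>z. P (fst (snd z)) (fst z))" for z
      using PT_comp[OF _ assms(1), of "\<lambda>z. (fst (snd z), fst z)"] by (simp add: pt)
    then show "PT (\<lambda>z. if P (fst (snd z)) (fst z) then fst z # snd (snd z) else snd (snd z))"
      by (intro pt)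
    show "sz (if P x y then y # s else s) \<le> sz s + q (sz x)" if "y \<in> set (l x)" for x y s
      using sz_mem[OF that] q(2)[of x] by simp
  qed
  ultimately show ?thesis by simp
qed

lemma PT_map [pt]:
  assumes "PT (\<lambda>z. g (fst z) (snd z))" "PT l"
  shows "PT (\<lambda>x. map (g x) (l x))"
proof -
  have "fold (\<lambda>y s. g x y # s) ys s = rev (map (g x) ys) @ s" for x ys s
    by (induction ys arbitrary: s) auto
  moreover
  from assms obtain q where q: "polyb q" "\<And>x y. y \<in> set (l x) \<Longrightarrow> sz (g x y) \<le> q (sz x)"
    by (rule PT_elem_size) (rule that)
  have "PT (\<lambda>x. rev (fold (\<lambda>y s. g x y # s) (l x) []))"
  proof (rule PT_rev, rule PT_fold[OF assms(2) PT_const])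
    have "PT (\<lambda>z. g (fst (snd z)) (fst z))" for z
      using PT_comp[OF _ assms(1), of "\<lambda>z. (fst (snd z), fst z)"] by (simp add: pt)
    then show "PT (\<lambda>z. g (fst (snd z)) (fst z) # snd (snd z))" by (intro pt)
    show "polyb (\<lambda>n. Suc (q n))" using q(1) by (intro polyb_intros)
    show "sz (g x y # s) \<le> sz s + Suc (q (sz x))" if "y \<in> set (l x)" for x y s
      using q(2)[OF that] by simp
  qed
  ultimately show ?thesis by simp
qed

lemma PT_concat_map [pt]:
  assumes "PT (\<lambda>z. g (fst z) (snd z))" "PT l"
  shows "PT (\<lambda>x. concat (map (g x) (l x)))"
proof -
  have "fold (\<lambda>y s. s @ g x y) ys s = s @ concat (map (g x) ys)" for x ys s
    by (induction ys arbitrary: s) auto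
  moreover
  from assms obtain q where q: "polyb q" "\<And>x y. y \<in> set (l x) \<Longrightarrow> sz (g x y) \<le> q (sz x)"
    by (rule PT_elem_size) (rule that)
  have "PT (\<lambda>x. fold (\<lambda>y s. s @ g x y) (l x) [])"
  proof (rule PT_fold[OF assms(2) PT_const _ q(1)])
    have "PT (\<lambda>z. g (fst (snd z)) (fst z))" for z
      using PT_comp[OF _ assms(1), of "\<lambda>z. (fst (snd z), fst z)"] by (simp add: pt)
    then show "PT (\<lambda>z. snd (snd z) @ g (fst (snd z)) (fst z))" by (intro pt)
    show "sz (s @ g x y) \<le> sz s + q (sz x)" if "y \<in> set (l x)" for x y s
      using q(2)[OF that] sz_append[of s "g x y"] by simp
  qed
  ultimately show ?thesis by simp
qed

lemma PT_length_eq [pt]: "PT l \<Longrightarrow> PT (\<lambda>x. length (l x :: 'c::enc list) = c)"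
proof (elim PT_comp)
  show "PT (\<lambda>l :: 'c list. length l = c)"
  proof (induction c)
    case 0
    show ?case using PT_is_Nil[OF PT_id] by simp
  next
    case (Suc c)
    have "PT (\<lambda>z :: ('c \<times> 'c list) \<times> 'c list. length (snd (fst z)) = c)"
      by (rule PT_comp[OF _ Suc]) (intro pt)
    from PT_case_list[OF PT_id PT_const this, of False]
    show ?case by (rule PT_same) (auto split: list.splits)
  qed
qed

text \<open>Each value c may have its own program, so \<open>Q\<close> can depend on c in an
  arbitrary way; below \<open>N\<close> this is a disjunction of finitely many cases. Nested three
  times, it gives the lookup in the clause table.\<close>

lemma PT_length_table:
  assumes "PT l" "\<And>c. PT (\<lambda>x. Q x c)"
  shows "PT (\<lambda>x. length (l x) < N \<and> Q x (length (l x)))"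
proof (induction N)
  case 0
  show ?case by (simp add: PT_const)
next
  case (Suc N)
  have "PT (\<lambda>x. (length (l x) < N \<and> Q x (length (l x))) \<or> (length (l x) = N \<and> Q x N))"
    by (rule PT_disj[OF Suc.IH PT_conj[OF PT_length_eq[OF assms(1)] assms(2)]])
  moreover have "(\<lambda>x. (length (l x) < N \<and> Q x (length (l x))) \<or> (length (l x) = N \<and> Q x N)) =
      (\<lambda>x. length (l x) < Suc N \<and> Q x (length (l x)))"
    by (auto simp: fun_eq_iff less_Suc_eq)
  ultimately show ?case by simp
qed

lemma PT_Sym_eq [pt]:
  assumes "PT f" shows "PT (\<lambda>x. f x = Sym c)"
proof -
  have units: "tr (replicate n ()) = (Node Leaf ^^ n) Leaf" for n
    by (induction n) (auto simp: tr_unit_def)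
  have "PT (\<lambda>x. replicate (unSym (f x)) ())"
    by (rule PT_same[OF assms]) (simp add: units tr_sym_def)
  then have "PT (\<lambda>x. length (replicate (unSym (f x)) ()) = c)" by (rule PT_length_eq)
  moreover have "length (replicate (unSym a) ()) = c \<longleftrightarrow> a = Sym c" for a
    by (cases a) simp
  ultimately show ?thesis by simp
qed

subsection \<open>Binary numbers\<close>

declare bin.simps [simp del]

lemma bits_0 [simp]: "bits 0 = []"
  by (simp add: bits_def bin.simps)

lemma bits_rec: "0 < n \<Longrightarrow> bits n = bits (n div 2) @ [odd n]"
  by (simp add: bits_def bin.simps[of n] odd_iff_mod_2_eq_one)

lemma bits_eq_Nil [simp]: "bits n = [] \<longleftrightarrow> n = 0"
  using bits_rec[of n] by (cases "n = 0") auto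

text \<open>The state holds the digits of the right-hand number that are still unread. Running out
  of them settles the comparison as false. Digits left over at the end mean that the right-hand
  number is longer and hence larger, as there are no leading zeros.\<close>

definition less_step :: "bool \<Rightarrow> bool list \<times> bool \<Rightarrow> bool list \<times> bool" where
  "less_step d s = (case fst s of [] \<Rightarrow> ([], False) | e # es \<Rightarrow> (es, if d = e then snd s else e))"

lemma less_step_simps [simp]:
  "less_step d ([], r) = ([], False)"
  "less_step d (e # es, r) = (es, if d = e then r else e)"
  by (simp_all add: less_step_def)

lemma fold_less_step_Nil [simp]: "fold less_step ds ([], False) = ([], False)"
  by (induction ds) auto

text \<open>Digits are compared from the least significant one upwards; \<open>r\<close> is the verdict so
  far.\<close>

lemma fold_less_step:
  "fst (fold less_step (rev (bits a)) (rev (bits b), r)) \<noteq> [] \<or>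
   snd (fold less_step (rev (bits a)) (rev (bits b), r)) \<longleftrightarrow> a < b \<or> a = b \<and> r"
proof (induction a arbitrary: b r rule: less_induct)
  case (less a)
  show ?case
  proof (cases "a = 0 \<or> b = 0")
    case True
    then show ?thesis
      by (cases "a = 0") (auto simp: bits_rec)
  next
    case False
    have "fold less_step (rev (bits a)) (rev (bits b), r) =
      fold less_step (rev (bits (a div 2))) (rev (bits (b div 2)), if odd a = odd b then r else odd b)"
      using False by (simp add: bits_rec[of a] bits_rec[of b])
    moreover have "(a div 2 < b div 2 \<or> a div 2 = b div 2 \<and> (if odd a = odd b then r else odd b))
      \<longleftrightarrow> a < b \<or> a = b \<and> r"
      by (cases r; cases "odd a"; cases "odd b"; simp; presburger)
    ultimately show ?thesis using less.IH[of "a div 2"] False by simp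
  qed
qed

lemma PT_less_step:
  assumes "PT d" "PT s"
  shows "PT (\<lambda>x. less_step (d x) (s x))"
proof -
  have "PT (\<lambda>z. less_step (fst z) (snd z))"
    unfolding less_step_def by (intro PT_case_list pt)
  from PT_comp[OF PT_Pair[OF assms] this] show ?thesis by simp
qed

lemma sz_less_step: "sz (less_step d s) \<le> sz s + 3"
  using sz_bool[of "d = hd (fst s)"] sz_bool[of "snd s"] sz_bool[of "hd (fst s)"]
  by (cases s; cases "fst s") (auto simp: less_step_def)

lemma PT_bits: "PT f \<Longrightarrow> PT (\<lambda>x. bits (f x))"
  by (erule PT_same) (simp add: tr_nat_def)

lemma PT_less [pt]:
  assumes "PT f" "PT g"
  shows "PT (\<lambda>x. (f x :: nat) < g x)"
proof -
  have "PT (\<lambda>x. fold less_step (rev (bits (f x))) (rev (bits (g x)), False))"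
    by (rule PT_fold[OF _ _ _ polyb_const[of 3]])
      (use assms sz_less_step in \<open>auto intro!: pt PT_bits PT_less_step\<close>)
  then have "PT (\<lambda>x. \<not> fst (fold less_step (rev (bits (f x))) (rev (bits (g x)), False)) = [] \<or>
      snd (fold less_step (rev (bits (f x))) (rev (bits (g x)), False)))"
    by (intro pt)
  then show ?thesis unfolding fold_less_step by simp
qed

lemma PT_nat_eq [pt]:
  assumes "PT f" "PT g"
  shows "PT (\<lambda>x. (f x :: nat) = g x)"
proof -
  have "PT (\<lambda>x. \<not> f x < g x \<and> \<not> g x < f x)" using assms by (intro pt)
  moreover have "(\<lambda>x. \<not> f x < g x \<and> \<not> g x < f x) = (\<lambda>x. f x = g x)" by auto
  ultimately show ?thesis by simp
qed

lemma PT_nat_mem [pt]: "PT v \<Longrightarrow> PT l \<Longrightarrow> PT (\<lambda>x. (v x :: nat) \<in> set (l x))"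
  using PT_Bex[of "\<lambda>x y. v x = y" l] PT_nat_eq[OF PT_comp[OF PT_fst[OF PT_id]] PT_snd[OF PT_id], of v]
  by simp

definition num :: "bool list \<Rightarrow> nat" where
  "num ds = fold (\<lambda>d n. 2 * n + of_bool d) ds 0"

lemma num_snoc: "num (ds @ [d]) = 2 * num ds + of_bool d"
  by (simp add: num_def)

lemma num_bits [simp]: "num (bits n) = n"
proof (induction n rule: less_induct)
  case (less n)
  show ?case
  proof (cases "n = 0")
    case False
    then show ?thesis using less[of "n div 2"] by (simp add: bits_rec[of n] num_snoc)
  qed (simp add: num_def)
qed

lemma bits_double: "bits (2 * n + of_bool d) = (if n = 0 \<and> \<not> d then [] else bits n @ [d])"
  using bits_rec[of "2 * n + of_bool d"] by (cases d) auto

text \<open>Evaluating digits and encoding the value again merely strips leading zeros, so a program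
  computes \<open>num\<close> on digit lists without arithmetic.\<close>

lemma bits_num: "bits (num ds) = fold (\<lambda>d s. if s = [] \<and> \<not> d then [] else s @ [d]) ds []"
proof (induction ds rule: rev_induct)
  case (snoc d ds)
  show ?case unfolding num_snoc bits_double by (simp add: snoc[symmetric])
qed (simp add: num_def)

lemma PT_num [pt]:
  assumes "PT l" shows "PT (\<lambda>x. num (l x))"
proof -
  have "PT (\<lambda>x. fold (\<lambda>d s. if s = [] \<and> \<not> d then [] else s @ [d]) (l x) [])"
  proof (rule PT_fold[OF assms PT_const _ polyb_const[of 4]])
    show "sz (if s = [] \<and> \<not> d then [] else s @ [d]) \<le> sz s + 4" for d s
      using sz_append[of s "[d]"] sz_bool[of d] by auto
  qed (intro pt)
  then show ?thesis by (rule PT_same) (simp add: tr_nat_def bits_num)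
qed

section \<open>Strong backdoors of clause-defined classes\<close>

definition pos_vars :: "clause \<Rightarrow> nat set" where "pos_vars D = {v. (v, True) \<in> D}"
definition neg_vars :: "clause \<Rightarrow> nat set" where "neg_vars D = {v. (v, False) \<in> D}"

lemma clause_eq: "D = pos_vars D \<times> {True} \<union> neg_vars D \<times> {False}"
proof -
  have "x \<in> D \<longleftrightarrow> x \<in> pos_vars D \<times> {True} \<union> neg_vars D \<times> {False}" for x
    by (cases x; cases "snd x") (auto simp: pos_vars_def neg_vars_def)
  then show ?thesis by blast
qed

lemma finite_pos_neg: "finite D \<Longrightarrow> finite (pos_vars D) \<and> finite (neg_vars D)"
proof -
  have "pos_vars D \<subseteq> fst ` D" "neg_vars D \<subseteq> fst ` D"
    by (force simp: pos_vars_def neg_vars_def)+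
  then show "finite D \<Longrightarrow> ?thesis" by (meson finite_imageI finite_subset)
qed

text \<open>The three numbers fix the sizes of three disjoint groups: the variables with both signs,
  only positive ones, and only negative ones. Bijections between corresponding groups carry one
  clause to the other.\<close>

lemma renaming_exists:
  assumes "finite D" "finite D'" "card (pos_vars D) = card (pos_vars D')"
    "card (neg_vars D) = card (neg_vars D')"
    "card (pos_vars D \<inter> neg_vars D) = card (pos_vars D' \<inter> neg_vars D')"
  obtains \<rho> where "inj \<rho>" "rename \<rho> {D} = {D'}"
proof -
  define A1 A2 A3 where "A1 = pos_vars D \<inter> neg_vars D" "A2 = pos_vars D - neg_vars D"
    "A3 = neg_vars D - pos_vars D"
  define B1 B2 B3 where "B1 = pos_vars D' \<inter> neg_vars D'" "B2 = pos_vars D' - neg_vars D'"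
    "B3 = neg_vars D' - pos_vars D'"
  note defs = A1_A2_A3_def B1_B2_B3_def
  have fin: "finite A1" "finite A2" "finite A3" "finite B1" "finite B2" "finite B3"
    using finite_pos_neg[OF assms(1)] finite_pos_neg[OF assms(2)] by (auto simp: defs)
  have "card A1 = card B1" using assms by (simp add: defs)
  moreover have "card A2 = card B2" using assms finite_pos_neg[OF assms(1)] finite_pos_neg[OF assms(2)]
    by (simp add: defs card_Diff_subset_Int)
  moreover have "card A3 = card B3" using assms finite_pos_neg[OF assms(1)] finite_pos_neg[OF assms(2)]
    by (simp add: defs card_Diff_subset_Int Int_commute)
  ultimately obtain f1 f2 f3 where f: "bij_betw f1 A1 B1" "bij_betw f2 A2 B2" "bij_betw f3 A3 B3"
    using fin by (meson finite_same_card_bij)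
  \<comment> \<open>A renaming must be injective on all variables, so those outside the clause are
    shifted beyond every target.\<close>
  define M where "M = Suc (Max (insert 0 (B1 \<union> B2 \<union> B3)))"
  have M: "y < M" if "y \<in> B1 \<union> B2 \<union> B3" for y
    using that fin unfolding M_def less_Suc_eq_le by (intro Max_ge) auto
  define \<rho> where "\<rho> x = (if x \<in> A1 then f1 x else if x \<in> A2 then f2 x else if x \<in> A3 then f3 x else x +
      M)" for x
  have disj: "A1 \<inter> A2 = {}" "A1 \<inter> A3 = {}" "A2 \<inter> A3 = {}" "B1 \<inter> B2 = {}" "B1 \<inter> B3 = {}" "B2 \<inter> B3 = {}"
    by (auto simp: defs)
  have img: "\<rho> ` A1 = B1" "\<rho> ` A2 = B2" "\<rho> ` A3 = B3"
  proof -
    show "\<rho> ` A1 = B1" using f(1) by (auto simp: \<rho>_def bij_betw_def)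
    have "\<rho> ` A2 = f2 ` A2" using disj by (intro image_cong) (auto simp: \<rho>_def)
    then show "\<rho> ` A2 = B2" using f(2) by (simp add: bij_betw_def)
    have "\<rho> ` A3 = f3 ` A3" using disj by (intro image_cong) (auto simp: \<rho>_def)
    then show "\<rho> ` A3 = B3" using f(3) by (simp add: bij_betw_def)
  qed
  have cases: "(x \<in> A1 \<and> \<rho> x = f1 x \<and> \<rho> x \<in> B1) \<or> (x \<in> A2 \<and> \<rho> x = f2 x \<and> \<rho> x \<in> B2) \<or>
      (x \<in> A3 \<and> \<rho> x = f3 x \<and> \<rho> x \<in> B3) \<or> (x \<notin> A1 \<union> A2 \<union> A3 \<and> \<rho> x = x + M)" for x
    using img unfolding \<rho>_def by auto
  have "inj \<rho>"
  proof (rule injI)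
    fix x y assume eq: "\<rho> x = \<rho> y"
    have noM: "z + M \<notin> B1 \<union> B2 \<union> B3" for z using M[of "z + M"] by auto
    have inj: "inj_on f1 A1" "inj_on f2 A2" "inj_on f3 A3" using f by (auto simp: bij_betw_def)
    show "x = y"
      using cases[of x] cases[of y] eq disj noM[of x] noM[of y] inj
      by (elim disjE conjE) (auto dest: inj_onD)
  qed
  moreover have "rename \<rho> {D} = {D'}"
  proof -
    have "(\<lambda>(v, b). (\<rho> v, b)) ` (X \<times> {b}) = (\<rho> ` X) \<times> {b}" for X and b :: bool by auto
    then have "(\<lambda>(v, b). (\<rho> v, b)) ` D = \<rho> ` pos_vars D \<times> {True} \<union> \<rho> ` neg_vars D \<times> {False}"
      by (subst clause_eq[of D]) (simp only: image_Un)
    moreover have "pos_vars D = A1 \<union> A2" "neg_vars D = A1 \<union> A3" "pos_vars D' = B1 \<union> B2" "neg_vars D' = B1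
        \<union> B3"
      by (auto simp: defs)
    ultimately have "(\<lambda>(v, b). (\<rho> v, b)) ` D = D'"
      using img clause_eq[of D'] by (simp only: image_Un)
    then show ?thesis by (simp add: rename_def)
  qed
  ultimately show thesis by (rule that)
qed

text \<open>One representative with the given counts speaks for all of them, by closure under
  renaming.\<close>

definition clause_table :: "formula set \<Rightarrow> nat \<Rightarrow> nat \<Rightarrow> nat \<Rightarrow> bool" where
  "clause_table \<C> a b c \<longleftrightarrow> (\<exists>D. finite D \<and> {D} \<in> \<C> \<and> card (pos_vars D) = a \<and> card (neg_vars D) = b \<and>
     card (pos_vars D \<inter> neg_vars D) = c)"

lemma clause_table:
  assumes "base_class \<C>" "finite D"
  shows "clause_table \<C> (card (pos_vars D)) (card (neg_vars D)) (card (pos_vars D \<inter> neg_vars D))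
    \<longleftrightarrow> {D} \<in> \<C>"
proof
  assume "clause_table \<C> (card (pos_vars D)) (card (neg_vars D)) (card (pos_vars D \<inter> neg_vars D))"
  then obtain E where E: "finite E" "{E} \<in> \<C>" "card (pos_vars E) = card (pos_vars D)"
    "card (neg_vars E) = card (neg_vars D)" "card (pos_vars E \<inter> neg_vars E) = card (pos_vars D \<inter> neg_vars D)"
    by (auto simp: clause_table_def)
  from renaming_exists[OF E(1) assms(2) E(3-5)] obtain \<rho> where "inj \<rho>" "rename \<rho> {E} = {D}" .
  moreover have "cnf {E}" using E by (simp add: cnf_def)
  ultimately show "{D} \<in> \<C>" using assms(1) E(2) unfolding base_class_def by metis
qed (use assms in \<open>auto simp: clause_table_def\<close>)

text \<open>A clause \<open>D\<close> obstructs \<open>X\<close> if some assignment to \<open>X\<close> reduces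
  it to a clause outside the class.\<close>

definition complementary :: "clause \<Rightarrow> bool" where
  "complementary D \<longleftrightarrow> (\<exists>v. (v, True) \<in> D \<and> (v, False) \<in> D)"

definition obstructs :: "formula set \<Rightarrow> clause \<Rightarrow> nat set \<Rightarrow> bool" where
  "obstructs \<C> D X \<longleftrightarrow> \<not> complementary {l \<in> D. fst l \<in> X} \<and> {{l \<in> D. fst l \<notin> X}} \<notin> \<C>"

lemma ball_image_filter: "(\<forall>y\<in>f ` {x \<in> A. Q x}. P y) \<longleftrightarrow> (\<forall>x\<in>A. Q x \<longrightarrow> P (f x))"
  by blast

text \<open>A clause survives \<theta> iff \<theta> falsifies all its literals over X, and what is
  left is the part outside X whatever \<theta> is. Such a \<theta> exists iff no variable of X has
  both signs in the clause. Clause-definedness treats the clauses separately, so the quantifiers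
  over \<theta> and over clauses can be exchanged.\<close>

lemma reduct_in_class:
  assumes "clause_defined \<C>" "cnf \<phi>"
  shows "(\<forall>\<theta>. reduct X \<theta> \<phi> \<in> \<C>) \<longleftrightarrow> (\<forall>D\<in>\<phi>. \<not> obstructs \<C> D X)"
proof -
  have red: "reduct X \<theta> \<phi> \<in> \<C> \<longleftrightarrow>
      (\<forall>D\<in>\<phi>. (\<forall>(v, b)\<in>D. v \<in> X \<longrightarrow> \<theta> v \<noteq> b) \<longrightarrow> {{l \<in> D. fst l \<notin> X}} \<in> \<C>)" for \<theta>
  proof -
    have eq: "reduct X \<theta> \<phi> = (\<lambda>C. C - {(v, b). v \<in> X \<and> \<theta> v \<noteq> b}) `
        {C \<in> \<phi>. \<not> (\<exists>(v, b)\<in>C. v \<in> X \<and> \<theta> v = b)}"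
      unfolding reduct_def by (rule setcompr_eq_image)
    from eq have "cnf (reduct X \<theta> \<phi>)" using assms(2) by (auto simp: cnf_def)
    then have "reduct X \<theta> \<phi> \<in> \<C> \<longleftrightarrow> (\<forall>C\<in>reduct X \<theta> \<phi>. {C} \<in> \<C>)"
      using assms(1) by (simp add: clause_defined_def)
    also have "\<dots> \<longleftrightarrow> (\<forall>D\<in>\<phi>. \<not> (\<exists>(v, b)\<in>D. v \<in> X \<and> \<theta> v = b) \<longrightarrow>
        {D - {(v, b). v \<in> X \<and> \<theta> v \<noteq> b}} \<in> \<C>)"
      unfolding eq by (rule ball_image_filter)
    also have "\<dots> \<longleftrightarrow> (\<forall>D\<in>\<phi>. (\<forall>(v, b)\<in>D. v \<in> X \<longrightarrow> \<theta> v \<noteq> b) \<longrightarrow>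
        {D - {(v, b). v \<in> X \<and> \<theta> v \<noteq> b}} \<in> \<C>)"
    proof -
      have "\<not> (\<exists>(v, b)\<in>D. v \<in> X \<and> \<theta> v = b) \<longleftrightarrow> (\<forall>(v, b)\<in>D. v \<in> X \<longrightarrow> \<theta> v \<noteq> b)" for D
        by auto
      then show ?thesis by simp
    qed
    also have "\<dots> \<longleftrightarrow> (\<forall>D\<in>\<phi>. (\<forall>(v, b)\<in>D. v \<in> X \<longrightarrow> \<theta> v \<noteq> b) \<longrightarrow> {{l \<in> D. fst l \<notin> X}} \<in> \<C>)"
    proof (intro ball_cong refl imp_cong)
      fix D assume "\<forall>(v, b)\<in>D. v \<in> X \<longrightarrow> \<theta> v \<noteq> b"
      then have "D - {(v, b). v \<in> X \<and> \<theta> v \<noteq> b} = {l \<in> D. fst l \<notin> X}" by auto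
      then show "({D - {(v, b). v \<in> X \<and> \<theta> v \<noteq> b}} \<in> \<C>) = ({{l \<in> D. fst l \<notin> X}} \<in> \<C>)" by simp
    qed
    finally show ?thesis .
  qed
  have fals: "(\<exists>\<theta>. \<forall>(v, b)\<in>D. v \<in> X \<longrightarrow> \<theta> v \<noteq> b) \<longleftrightarrow> \<not> complementary {l \<in> D. fst l \<in> X}" for D
  proof
    assume "\<exists>\<theta>. \<forall>(v, b)\<in>D. v \<in> X \<longrightarrow> \<theta> v \<noteq> b"
    then obtain \<theta> where \<theta>: "\<forall>(v, b)\<in>D. v \<in> X \<longrightarrow> \<theta> v \<noteq> b" by blast
    show "\<not> complementary {l \<in> D. fst l \<in> X}"
    proof
      assume "complementary {l \<in> D. fst l \<in> X}"
      then obtain v where v: "(v, True) \<in> D" "(v, False) \<in> D" "v \<in> X" by (auto simp: complementary_def)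
      then have "\<theta> v \<noteq> True" "\<theta> v \<noteq> False" using \<theta> by blast+
      then show False by simp
    qed
  next
    assume *: "\<not> complementary {l \<in> D. fst l \<in> X}"
    \<comment> \<open>The witness makes v true exactly if v does not occur positively, which
      falsifies every literal over X unless some variable of X has both signs.\<close>
    have "((v, True) \<notin> D) \<noteq> b" if "(v, b) \<in> D" "v \<in> X" for v b
      using * that by (cases b) (auto simp: complementary_def)
    then have "\<forall>(v, b)\<in>D. v \<in> X \<longrightarrow> ((v, True) \<notin> D) \<noteq> b" by blast
    then show "\<exists>\<theta>. \<forall>(v, b)\<in>D. v \<in> X \<longrightarrow> \<theta> v \<noteq> b"
      by (rule exI[where x = "\<lambda>v. (v, True) \<notin> D"])
  qed
  have "(\<forall>\<theta>. \<forall>D\<in>\<phi>. P D \<theta> \<longrightarrow> Q D) \<longleftrightarrow> (\<forall>D\<in>\<phi>. \<not> ((\<exists>\<theta>. P D \<theta>) \<and> \<not> Q D))"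
    for P :: "clause \<Rightarrow> (nat \<Rightarrow> bool) \<Rightarrow> bool" and Q by blast
  then show ?thesis unfolding red obstructs_def fals[symmetric] .
qed

text \<open>Obstruction depends only on which variables of D lie in the set, so it can disappear in
  a larger set only if that set gains a variable of D. This justifies the branching.\<close>

lemma obstructs_extend:
  assumes "obstructs \<C> D X" "X \<subseteq> Y" "\<not> obstructs \<C> D Y"
  shows "\<exists>l\<in>D. fst l \<notin> X \<and> fst l \<in> Y"
proof (rule ccontr)
  assume "\<not> ?thesis"
  then have "{l \<in> D. fst l \<in> X} = {l \<in> D. fst l \<in> Y}" "{l \<in> D. fst l \<notin> X} = {l \<in> D. fst l \<notin> Y}"
    using assms(2) by auto
  with assms(1,3) show False by (simp add: obstructs_def)
qed

section \<open>The search\<close>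

definition taut :: "lit list \<Rightarrow> bool" where
  "taut C \<longleftrightarrow> (\<exists>l\<in>set C. \<exists>l'\<in>set C. fst l = fst l' \<and> \<not> (snd l = snd l'))"

definition mem_lit :: "lit \<Rightarrow> lit list \<Rightarrow> bool" where
  "mem_lit l C \<longleftrightarrow> (\<exists>l'\<in>set C. fst l = fst l' \<and> snd l = snd l')"

text \<open>The width bound counts distinct literals while a list may repeat them. Without
  repetitions, list lengths are the counts of the table and the branching is at most
  threefold.\<close>

definition dedup :: "lit list \<Rightarrow> lit list" where
  "dedup C = fold (\<lambda>l D. if mem_lit l D then D else l # D) C []"

definition remaining :: "nat list \<Rightarrow> lit list \<Rightarrow> lit list" where
  "remaining S C = dedup (filter (\<lambda>l. \<not> fst l \<in> set S) C)"

text \<open>The bounds by 4 hold for every clause of width three. They turn the lookup in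
  \<open>G\<close> into a finite case distinction, and the nesting fits
  \<open>PT_length_table\<close>.\<close>

definition admissible :: "(nat \<Rightarrow> nat \<Rightarrow> nat \<Rightarrow> bool) \<Rightarrow> lit list \<Rightarrow> bool" where
  "admissible G D \<longleftrightarrow> length (filter snd D) < 4 \<and> (length (filter (\<lambda>l. \<not> snd l) D) < 4 \<and>
     (length (filter (\<lambda>l. snd l \<and> mem_lit (fst l, False) D) D) < 4 \<and>
      G (length (filter snd D)) (length (filter (\<lambda>l. \<not> snd l) D))
        (length (filter (\<lambda>l. snd l \<and> mem_lit (fst l, False) D) D))))"

definition bad :: "(nat \<Rightarrow> nat \<Rightarrow> nat \<Rightarrow> bool) \<Rightarrow> nat list \<Rightarrow> lit list \<Rightarrow> bool" where
  "bad G S C \<longleftrightarrow> \<not> taut (filter (\<lambda>l. fst l \<in> set S) C) \<and> \<not> admissible G (remaining S C)"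

text \<open>Strictly sorted lists represent sets uniquely and already have the order in which a
  solution is printed.\<close>

definition insert_var :: "nat \<Rightarrow> nat list \<Rightarrow> nat list" where
  "insert_var v S = filter (\<lambda>u. u < v) S @ v # filter (\<lambda>u. v < u) S"

text \<open>One obstructing clause is enough to branch on, as every strong backdoor above S must
  remove this obstruction. If the clause has no variable left outside S, no strong backdoor includes
  S and the branch ends.\<close>

definition expand :: "nat list \<Rightarrow> lit list list \<Rightarrow> nat list list" where
  "expand S bads = (case bads of [] \<Rightarrow> [] | C # _ \<Rightarrow> map (\<lambda>l. insert_var (fst l) S) (remaining S C))"

definition collect :: "nat list \<Rightarrow> nat list list \<Rightarrow> nat list list" where
  "collect S outs = (if \<exists>T\<in>set outs. \<forall>v\<in>set T. v \<in> set S then outs else S # outs)"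

text \<open>A strong set is not expanded, because no proper superset of it is minimal.\<close>

definition process ::
  "(nat \<Rightarrow> nat \<Rightarrow> nat \<Rightarrow> bool) \<Rightarrow> lit list list \<Rightarrow> nat list \<Rightarrow> nat list list \<times> nat list list \<Rightarrow>
   nat list list \<times> nat list list" where
  "process G cs S s = (if filter (bad G S) cs = [] then (fst s, collect S (snd s))
     else (expand S (filter (bad G S) cs) @ fst s, snd s))"

definition level ::
  "(nat \<Rightarrow> nat \<Rightarrow> nat \<Rightarrow> bool) \<Rightarrow> lit list list \<Rightarrow> nat list list \<times> nat list list \<Rightarrow>
   nat list list \<times> nat list list" where
  "level G cs s = fold (process G cs) (fst s) ([], snd s)"

lemma mem_lit_iff: "mem_lit l C \<longleftrightarrow> l \<in> set C"
  unfolding mem_lit_def prod_eq_iff[symmetric] by blast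

lemma dedup: "set (dedup C) = set C" "distinct (dedup C)"
proof -
  have "set (fold (\<lambda>l D. if mem_lit l D then D else l # D) C D) = set C \<union> set D \<and>
      (distinct D \<longrightarrow> distinct (fold (\<lambda>l D. if mem_lit l D then D else l # D) C D))" for D
    by (induction C arbitrary: D) (auto simp: mem_lit_iff)
  from this[of "[]"] show "set (dedup C) = set C" "distinct (dedup C)" by (auto simp: dedup_def)
qed

lemma set_remaining: "set (remaining S C) = {l \<in> set C. fst l \<notin> set S}"
  by (auto simp: remaining_def dedup)

lemma length_remaining: "length (remaining S C) \<le> card (set C)"
proof -
  have "length (remaining S C) = card (set (remaining S C))"
    by (rule distinct_card[symmetric]) (simp add: remaining_def dedup)
  also have "\<dots> \<le> card (set C)" by (intro card_mono) (auto simp: set_remaining)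
  finally show ?thesis .
qed

lemma taut_iff: "taut C \<longleftrightarrow> complementary (set C)"
proof
  assume "taut C"
  then obtain l l' where l: "l \<in> set C" "l' \<in> set C" and eq: "fst l = fst l'" "snd l \<noteq> snd l'"
    unfolding taut_def by blast
  have "l' = (fst l, \<not> snd l)" using eq by (intro prod_eqI) simp_all
  with l have "(fst l, snd l) \<in> set C" "(fst l, \<not> snd l) \<in> set C" by simp_all
  then show "complementary (set C)"
    by (cases "snd l") (auto simp: complementary_def)
next
  assume "complementary (set C)"
  then obtain v where v: "(v, True) \<in> set C" "(v, False) \<in> set C" by (auto simp: complementary_def)
  show "taut C"
    unfolding taut_def by (rule bexI[OF _ v(1)], rule bexI[OF _ v(2)]) simp
qed

lemma length_filter_lits:
  assumes "distinct D" "\<And>l. P l \<Longrightarrow> snd l = b"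
  shows "length (filter P D) = card {v. (v, b) \<in> set D \<and> P (v, b)}"
proof -
  have "length (filter P D) = card (set (filter P D))"
    using distinct_card[OF distinct_filter[OF assms(1), of P]] by simp
  also have "set (filter P D) = (\<lambda>v. (v, b)) ` {v. (v, b) \<in> set D \<and> P (v, b)}"
  proof (intro set_eqI iffI)
    fix l assume "l \<in> set (filter P D)"
    then have l: "l \<in> set D" "P l" by simp_all
    have eq: "l = (fst l, b)" using assms(2)[OF l(2)] by (cases l) simp
    with l have "fst l \<in> {v. (v, b) \<in> set D \<and> P (v, b)}" by (metis mem_Collect_eq)
    then show "l \<in> (\<lambda>v. (v, b)) ` {v. (v, b) \<in> set D \<and> P (v, b)}" using eq by (rule image_eqI[rotated])
  qed auto
  also have "card \<dots> = card {v. (v, b) \<in> set D \<and> P (v, b)}" by (intro card_image) (auto simp: inj_on_def)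
  finally show ?thesis .
qed

lemma bad_iff:
  assumes "base_class \<C>" "card (set C) \<le> 3"
  shows "bad (clause_table \<C>) S C \<longleftrightarrow> obstructs \<C> (set C) (set S)"
proof -
  let ?D = "remaining S C"
  have dist: "distinct ?D" by (simp add: remaining_def dedup)
  have len: "length ?D \<le> 3" using length_remaining[of S C] assms(2) by simp
  have small: "length (filter P ?D) < 4" for P using length_filter_le[of P ?D] len by linarith
  have "length (filter snd ?D) = card (pos_vars (set ?D))"
    using length_filter_lits[OF dist, of snd True] by (simp add: pos_vars_def)
  moreover have "length (filter (\<lambda>l. \<not> snd l) ?D) = card (neg_vars (set ?D))"
    using length_filter_lits[OF dist, of "\<lambda>l. \<not> snd l" False] by (simp add: neg_vars_def)
  moreover have "length (filter (\<lambda>l. snd l \<and> mem_lit (fst l, False) ?D) ?D) =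
      card (pos_vars (set ?D) \<inter> neg_vars (set ?D))"
    using length_filter_lits[OF dist, of "\<lambda>l. snd l \<and> mem_lit (fst l, False) ?D" True]
    by (simp add: pos_vars_def neg_vars_def mem_lit_iff Int_def)
  ultimately have "admissible (clause_table \<C>) ?D \<longleftrightarrow> {set ?D} \<in> \<C>"
    using small[of snd] small[of "\<lambda>l. \<not> snd l"] small[of "\<lambda>l. snd l \<and> mem_lit (fst l, False) ?D"]
      clause_table[OF assms(1), of "set ?D"] unfolding admissible_def by simp
  then show ?thesis
    by (simp add: bad_def obstructs_def taut_iff set_remaining)
qed

lemma insert_var:
  assumes "sorted_wrt (<) S" "v \<notin> set S"
  shows "sorted_wrt (<) (insert_var v S)" "set (insert_var v S) = insert v (set S)"
    "length (insert_var v S) = Suc (length S)"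
proof -
  show set: "set (insert_var v S) = insert v (set S)" using assms(2) by (auto simp: insert_var_def)
  show "sorted_wrt (<) (insert_var v S)"
    using assms(1) by (auto simp: insert_var_def sorted_wrt_append intro: sorted_wrt_filter)
  then have "distinct (insert_var v S)" "distinct S" using assms(1) by (auto simp: strict_sorted_iff)
  then show "length (insert_var v S) = Suc (length S)"
    using set assms(2) by (metis card_insert_disjoint distinct_card finite_set)
qed

section \<open>Correctness of the search\<close>

locale search =
  fixes \<C> :: "formula set" and cs :: "lit list list"
  assumes base: "base_class \<C>" and clause_def: "clause_defined \<C>"
    and width: "C \<in> set cs \<Longrightarrow> card (set C) \<le> 3"
begin

abbreviation "V \<equiv> vars (formula_of cs)"
abbreviation "strong \<equiv> strong_backdoor \<C> (formula_of cs)"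
abbreviation "minimal \<equiv> min_strong_backdoor \<C> (formula_of cs)"
abbreviation "G \<equiv> clause_table \<C>"

lemma mem_V: "v \<in> V \<longleftrightarrow> (\<exists>C\<in>set cs. \<exists>l\<in>set C. v = fst l)"
  by (force simp: vars_def formula_of_def)

lemma finite_V: "finite V"
proof -
  have "v \<in> V \<longleftrightarrow> v \<in> fst ` (\<Union>C\<in>set cs. set C)" for v
    unfolding mem_V by blast
  then have "V = fst ` (\<Union>C\<in>set cs. set C)" by blast
  then show ?thesis by simp
qed

lemma strong_iff: "strong X \<longleftrightarrow> X \<subseteq> V \<and> (\<forall>C\<in>set cs. \<not> obstructs \<C> (set C) X)"
proof -
  have "cnf (formula_of cs)" by (auto simp: cnf_def formula_of_def)
  then show ?thesis unfolding strong_backdoor_def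
    by (simp add: reduct_in_class[OF clause_def]) (simp add: formula_of_def)
qed

lemma strong_list: "set S \<subseteq> V \<Longrightarrow> strong (set S) \<longleftrightarrow> filter (bad G S) cs = []"
  using bad_iff[OF base width] by (auto simp: strong_iff filter_empty_conv)

lemma minimal_below: "strong X \<Longrightarrow> \<exists>Y\<subseteq>X. minimal Y"
proof -
  assume X: "strong X"
  then obtain Y where Y: "Y \<subseteq> X" "strong Y" "\<And>Z. Z \<subseteq> X \<and> strong Z \<Longrightarrow> card Y \<le> card Z"
    using ex_has_least_nat[where P = "\<lambda>Y. Y \<subseteq> X \<and> strong Y" and m = card and k = X] by auto
  have "finite Y" using Y(2) finite_V finite_subset by (auto simp: strong_iff)
  then have "\<not> strong Z" if "Z \<subset> Y" for Z
    using Y(1) Y(3)[of Z] that psubset_card_mono[of Y Z] by (auto dest: leD)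
  then show ?thesis using Y by (auto simp: min_strong_backdoor_def)
qed

lemma minimal_antichain: "minimal X \<Longrightarrow> strong Y \<Longrightarrow> Y \<subseteq> X \<Longrightarrow> Y = X"
  by (auto simp: min_strong_backdoor_def)

definition vlist :: "nat \<Rightarrow> nat list \<Rightarrow> bool" where
  "vlist j S \<longleftrightarrow> sorted_wrt (<) S \<and> length S = j \<and> set S \<subseteq> V"

lemma card_vlist: "vlist j S \<Longrightarrow> card (set S) = j"
  by (auto simp: vlist_def strict_sorted_iff distinct_card)

lemma vlist_unique: "vlist i S \<Longrightarrow> vlist j T \<Longrightarrow> set S = set T \<Longrightarrow> S = T"
  by (auto simp: vlist_def strict_sorted_iff sorted_distinct_set_unique)

text \<open>Found sets are prepended, hence the descending lengths; the list is reversed for output.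
  \<open>Xs\<close> is the exact family found so far.\<close>

definition outs_ok :: "nat \<Rightarrow> nat set set \<Rightarrow> nat list list \<Rightarrow> bool" where
  "outs_ok j Xs outs \<longleftrightarrow> (\<forall>S\<in>set outs. \<exists>i\<le>j. vlist i S) \<and> set ` set outs = Xs \<and> distinct outs \<and>
     sorted_wrt (\<lambda>S T. length T \<le> length S) outs"

text \<open>All minimal backdoors of size below j are known when S is treated. If S is not minimal,
  one of them lies inside S; if S is minimal, a known set inside S can only be S itself. So a single
  inclusion test detects non-minimality and repetition alike.\<close>

lemma process_strong:
  assumes outs: "outs_ok j ({X. minimal X \<and> card X < j} \<union> {X. minimal X \<and> X \<in> set ` P}) outs"
    and S: "vlist j S" "strong (set S)"
  shows "outs_ok j ({X. minimal X \<and> card X < j} \<union> {X. minimal X \<and> X \<in> set ` insert S P}) (collect S outs)"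
proof (cases "\<exists>T\<in>set outs. set T \<subseteq> set S")
  case True
  then obtain T where T: "T \<in> set outs" "set T \<subseteq> set S" by blast
  then have "minimal (set T)" using outs by (auto simp: outs_ok_def)
  have "set S \<in> set ` set outs" if "minimal (set S)"
    using minimal_antichain[OF that, of "set T"] \<open>minimal (set T)\<close> T by (auto simp: min_strong_backdoor_def)
  then have "minimal (set S) \<Longrightarrow> set S \<in> {X. minimal X \<and> card X < j} \<union> {X. minimal X \<and> X \<in> set ` P}"
    using outs by (simp add: outs_ok_def)
  then have "{X. minimal X \<and> card X < j} \<union> {X. minimal X \<and> X \<in> set ` insert S P} =
      {X. minimal X \<and> card X < j} \<union> {X. minimal X \<and> X \<in> set ` P}" by auto
  moreover have "collect S outs = outs" using True by (auto simp: collect_def)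
  ultimately show ?thesis using outs by simp
next
  case False
  then have rec: "collect S outs = S # outs" by (auto simp: collect_def)
  have "minimal (set S)"
    unfolding min_strong_backdoor_def
  proof (intro conjI allI impI notI)
    fix Y assume "Y \<subset> set S" "strong Y"
    then obtain Z where Z: "Z \<subseteq> Y" "minimal Z" using minimal_below by blast
    have "card Z < card (set S)" using Z(1) \<open>Y \<subset> set S\<close> by (intro psubset_card_mono) auto
    then have "Z \<in> set ` set outs" using outs Z(2) card_vlist[OF S(1)] by (auto simp: outs_ok_def)
    then show False using False Z(1) \<open>Y \<subset> set S\<close> by auto
  qed (rule S(2))
  moreover have "S \<notin> set outs" using False by auto
  moreover have "\<forall>T\<in>set outs. length T \<le> length S"
    using outs S(1) by (auto simp: outs_ok_def vlist_def)
  ultimately show ?thesis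
    using outs S(1) unfolding rec outs_ok_def by (auto simp: image_iff)
qed

lemma expand:
  assumes S: "vlist j S" and "\<not> strong (set S)"
  shows "\<forall>T\<in>set (expand S (filter (bad G S) cs)). vlist (Suc j) T"
    and "\<And>X. strong X \<Longrightarrow> set S \<subseteq> X \<Longrightarrow> \<exists>T\<in>set (expand S (filter (bad G S) cs)). set T \<subseteq> X"
    and "length (expand S (filter (bad G S) cs)) \<le> 3"
proof -
  have "filter (bad G S) cs \<noteq> []" using strong_list[of S] assms by (auto simp: vlist_def)
  then obtain C r where C: "filter (bad G S) cs = C # r" by (cases "filter (bad G S) cs") auto
  then have "C \<in> set (filter (bad G S) cs)" by simp
  then have Cin: "C \<in> set cs" "bad G S C" by auto
  have ex: "expand S (filter (bad G S) cs) = map (\<lambda>l. insert_var (fst l) S) (remaining S C)"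
    by (simp add: expand_def C)
  have ins: "set (insert_var (fst l) S) = insert (fst l) (set S)" "vlist (Suc j) (insert_var (fst l) S)"
    if "l \<in> set C" "fst l \<notin> set S" for l
    using insert_var[of S "fst l"] that S Cin(1) mem_V by (auto simp: vlist_def)
  show "\<forall>T\<in>set (expand S (filter (bad G S) cs)). vlist (Suc j) T"
    using ins by (auto simp: ex set_remaining)
  show "length (expand S (filter (bad G S) cs)) \<le> 3"
    using length_remaining[of S C] width[OF Cin(1)] by (simp add: ex)
  fix X assume X: "strong X" "set S \<subseteq> X"
  have "obstructs \<C> (set C) (set S)" using bad_iff[OF base width[OF Cin(1)]] Cin(2) by simp
  moreover have "\<not> obstructs \<C> (set C) X" using X(1) Cin(1) by (simp add: strong_iff)
  ultimately obtain l where l: "l \<in> set C" "fst l \<notin> set S" "fst l \<in> X"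
    using obstructs_extend X(2) by blast
  then show "\<exists>T\<in>set (expand S (filter (bad G S) cs)). set T \<subseteq> X"
    using ins[OF l(1,2)] X(2) l unfolding ex set_map set_remaining
    by (intro bexI[of _ "insert_var (fst l) S"]) auto
qed

text \<open>The third conjunct is completeness: whatever is still to be found lies above some
  current candidate. The length bounds count repeated candidates too, since different branches may
  reach the same set.\<close>

definition level_ok :: "nat \<Rightarrow> nat list list \<times> nat list list \<Rightarrow> bool" where
  "level_ok j s \<longleftrightarrow> (\<forall>S\<in>set (fst s). vlist j S) \<and> outs_ok j {X. minimal X \<and> card X < j} (snd s) \<and>
     (\<forall>X. minimal X \<and> j \<le> card X \<longrightarrow> (\<exists>S\<in>set (fst s). set S \<subseteq> X)) \<and>
     length (fst s) \<le> 3 ^ j \<and> length (snd s) \<le> 3 ^ j"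

lemma fold_process:
  assumes outs: "outs_ok j {X. minimal X \<and> card X < j} outs" and "\<forall>S\<in>set P. vlist j S"
  defines "s \<equiv> fold (process G cs) P ([], outs)"
  shows "(\<forall>S\<in>set (fst s). vlist (Suc j) S) \<and>
     outs_ok j ({X. minimal X \<and> card X < j} \<union> {X. minimal X \<and> X \<in> set ` set P}) (snd s) \<and>
     (\<forall>X. minimal X \<and> j < card X \<and> (\<exists>S\<in>set P. set S \<subseteq> X) \<longrightarrow> (\<exists>S\<in>set (fst s). set S \<subseteq> X)) \<and>
     length (fst s) \<le> 3 * length P \<and> length (snd s) \<le> length outs + length P"
  using assms(2) unfolding s_def
proof (induction P rule: rev_induct)
  case Nil
  then show ?case using outs by simp
next
  case (snoc S P)
  let ?s = "fold (process G cs) P ([], outs)"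
  from snoc have IH: "\<forall>S\<in>set (fst ?s). vlist (Suc j) S"
    "outs_ok j ({X. minimal X \<and> card X < j} \<union> {X. minimal X \<and> X \<in> set ` set P}) (snd ?s)"
    "\<And>X. minimal X \<Longrightarrow> j < card X \<Longrightarrow> \<exists>S\<in>set P. set S \<subseteq> X \<Longrightarrow> \<exists>S\<in>set (fst ?s). set S \<subseteq> X"
    "length (fst ?s) \<le> 3 * length P" "length (snd ?s) \<le> length outs + length P" by auto
  have S: "vlist j S" using snoc.prems by simp
  have step: "fold (process G cs) (P @ [S]) ([], outs) = process G cs S ?s" by simp
  show ?case
  proof (cases "strong (set S)")
    case True
    then have p: "process G cs S ?s = (fst ?s, collect S (snd ?s))"
      using strong_list[of S] S by (simp add: process_def vlist_def)
    have "\<exists>T\<in>set P. set T \<subseteq> X" if X: "minimal X" "j < card X" and T: "\<exists>T\<in>set (P @ [S]). set T \<subseteq> X" for X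
    proof -
      have "\<not> set S \<subseteq> X" using minimal_antichain[OF X(1) True] X(2) card_vlist[OF S] by auto
      then show ?thesis using T by auto
    qed
    moreover have "length (collect S (snd ?s)) \<le> Suc (length (snd ?s))" by (simp add: collect_def)
    ultimately show ?thesis
      using IH process_strong[OF IH(2) S True] unfolding step p by fastforce
  next
    case False
    then have "filter (bad G S) cs \<noteq> []" using strong_list[of S] S by (simp add: vlist_def)
    then have p: "process G cs S ?s = (expand S (filter (bad G S) cs) @ fst ?s, snd ?s)"
      by (simp add: process_def)
    have "{X. minimal X \<and> X \<in> set ` set (P @ [S])} = {X. minimal X \<and> X \<in> set ` set P}"
      using False by (auto simp: min_strong_backdoor_def)
    then have o: "outs_ok j ({X. minimal X \<and> card X < j} \<union> {X. minimal X \<and> X \<in> set ` set (P @ [S])}) (snd ?s)"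
      using IH(2) by simp
    have c: "\<exists>T\<in>set (expand S (filter (bad G S) cs) @ fst ?s). set T \<subseteq> X"
      if X: "minimal X" "j < card X" and T: "\<exists>T\<in>set (P @ [S]). set T \<subseteq> X" for X
    proof (cases "set S \<subseteq> X")
      case True
      then show ?thesis using expand(2)[OF S False, of X] X(1) by (auto simp: min_strong_backdoor_def)
    next
      case nS: False
      then show ?thesis using IH(3)[OF X] T by auto
    qed
    show ?thesis
      unfolding step p fst_conv snd_conv
      using expand(1,3)[OF S False] IH(1,4,5) o c by auto
  qed
qed

lemma level_ok_level:
  assumes "level_ok j s" shows "level_ok (Suc j) (level G cs s)"
proof -
  let ?t = "fold (process G cs) (fst s) ([], snd s)"
  have s: "outs_ok j {X. minimal X \<and> card X < j} (snd s)" "\<forall>S\<in>set (fst s). vlist j S"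
    "\<And>X. minimal X \<Longrightarrow> j \<le> card X \<Longrightarrow> \<exists>S\<in>set (fst s). set S \<subseteq> X"
    "length (fst s) \<le> 3 ^ j" "length (snd s) \<le> 3 ^ j"
    using assms by (auto simp: level_ok_def)
  note t = fold_process[OF s(1,2)]
  \<comment> \<open>A minimal set of size j includes a candidate, which also has j elements and
    therefore equals it.\<close>
  have "{X. minimal X \<and> card X < j} \<union> {X. minimal X \<and> X \<in> set ` set (fst s)} = {X. minimal X \<and> card X <
      Suc j}"
  proof (intro equalityI subsetI)
    fix X assume X: "X \<in> {X. minimal X \<and> card X < Suc j}"
    show "X \<in> {X. minimal X \<and> card X < j} \<union> {X. minimal X \<and> X \<in> set ` set (fst s)}"
    proof (cases "card X < j")
      case False
      then obtain S where S: "S \<in> set (fst s)" "set S \<subseteq> X" using s(3)[of X] X by auto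
      have "finite X" using X finite_V finite_subset by (auto simp: min_strong_backdoor_def strong_iff)
      moreover have "card X \<le> card (set S)" using X card_vlist S(1) s(2) by auto
      ultimately have "set S = X" using S(2) by (metis card_seteq)
      then show ?thesis using X S(1) by auto
    qed (use X in auto)
  qed (use s(2) card_vlist in auto)
  then have o: "outs_ok j {X. minimal X \<and> card X < Suc j} (snd ?t)" using t by simp
  then have "outs_ok (Suc j) {X. minimal X \<and> card X < Suc j} (snd ?t)"
    unfolding outs_ok_def by (meson le_SucI)
  \<comment> \<open>Each candidate adds at most three successors or one found set, and
    \<open>3 ^ j + 3 ^ j \<le> 3 ^ Suc j\<close>.\<close>
  moreover have "length (fst ?t) \<le> 3 ^ Suc j" "length (snd ?t) \<le> 3 ^ Suc j" using t s(4,5) by auto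
  moreover have "\<exists>S\<in>set (fst ?t). set S \<subseteq> X" if "minimal X" "Suc j \<le> card X" for X
    using t s(3)[of X] that by auto
  ultimately show ?thesis using t unfolding level_ok_def level_def by blast
qed

lemma level_ok_init: "level_ok 0 ([[]], [])"
  by (auto simp: level_ok_def outs_ok_def vlist_def)

lemma level_ok_iterate: "level_ok (length us) (fold (\<lambda>_. level G cs) us ([[]], []))"
  by (induction us rule: rev_induct) (auto simp: level_ok_init level_ok_level)

lemma correct_enum_outs:
  assumes "level_ok (Suc k) s"
  shows "correct_enum {S. minimal S \<and> card S \<le> k} (map set (rev (snd s)))"
    and "T \<in> set (snd s) \<Longrightarrow> sorted_list_of_set (set T) = T"
proof -
  have o: "outs_ok (Suc k) {X. minimal X \<and> card X < Suc k} (snd s)"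
    using assms by (simp add: level_ok_def)
  then have vl: "\<exists>i. vlist i S" if "S \<in> set (snd s)" for S using that by (auto simp: outs_ok_def)
  show "sorted_list_of_set (set T) = T" if T: "T \<in> set (snd s)"
  proof -
    from vl[OF T] have "sorted T" "distinct T" by (auto simp: vlist_def strict_sorted_iff)
    then show ?thesis by (rule sorted_list_of_set.idem_if_sorted_distinct)
  qed
  let ?ys = "map set (rev (snd s))"
  have "inj_on set (set (snd s))" by (rule inj_onI) (meson vl vlist_unique)
  then have "distinct ?ys" using o by (simp add: distinct_map outs_ok_def)
  moreover have "set ?ys = {S. minimal S \<and> card S \<le> k}"
    using o by (simp add: outs_ok_def less_Suc_eq_le)
  moreover have "i < j" if ij: "i < length ?ys" "j < length ?ys" "card (?ys ! i) < card (?ys ! j)" for i j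
  proof (rule ccontr)
    assume "\<not> i < j"
    have card: "card (?ys ! n) = length (rev (snd s) ! n)" if "n < length ?ys" for n
    proof -
      have "rev (snd s) ! n \<in> set (snd s)" using that by (metis length_map nth_mem set_rev)
      then obtain i where "vlist i (rev (snd s) ! n)" using vl by blast
      then show ?thesis using card_vlist that by (auto simp: vlist_def)
    qed
    have "sorted_wrt (\<lambda>S T. length S \<le> length T) (rev (snd s))"
      using o by (simp add: outs_ok_def sorted_wrt_rev)
    then have "length (rev (snd s) ! j) \<le> length (rev (snd s) ! i)"
      using \<open>\<not> i < j\<close> ij(1,2) by (cases "i = j") (auto simp: sorted_wrt_iff_nth_less)
    then show False using ij card by simp
  qed
  ultimately show "correct_enum {S. minimal S \<and> card S \<le> k} ?ys" unfolding correct_enum_def by blast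
qed

end

section \<open>One level of the search in polynomial time\<close>

lemma PT_comp2:
  assumes "PT (\<lambda>z. f (fst z) (snd z))" "PT a" "PT b"
  shows "PT (\<lambda>x. f (a x) (b x))"
  using PT_comp[OF PT_Pair[OF assms(2,3)] assms(1)] by simp

lemma PT_mem_lit [pt]:
  assumes "PT l" "PT C" shows "PT (\<lambda>x. mem_lit (l x) (C x))"
proof (rule PT_comp2[where f = mem_lit, OF _ assms])
  show "PT (\<lambda>z. mem_lit (fst z) (snd z))" unfolding mem_lit_def by (intro pt)
qed

lemma PT_taut: "PT taut"
  unfolding taut_def by (intro pt)

lemma PT_dedup: "PT dedup"
  unfolding dedup_def
proof (rule PT_fold[OF PT_id PT_const _ polyb_id])
  show "PT (\<lambda>z. if mem_lit (fst z) (snd (snd z)) then snd (snd z) else fst z # snd (snd z))"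
    by (intro pt)
  show "sz (if mem_lit y s then s else y # s) \<le> sz s + sz x" if "y \<in> set x" for x s and y :: lit
    using sz_mem[OF that] by simp
qed

lemma PT_remaining [pt]:
  assumes "PT S" "PT C" shows "PT (\<lambda>x. remaining (S x) (C x))"
proof (rule PT_comp2[where f = remaining, OF _ assms])
  show "PT (\<lambda>z. remaining (fst z) (snd z))"
    unfolding remaining_def by (rule PT_comp[OF _ PT_dedup]) (intro pt)
qed

lemma PT_admissible: "PT (admissible G)"
proof -
  let ?p = "\<lambda>D :: lit list. filter snd D" and ?n = "\<lambda>D :: lit list. filter (\<lambda>l. \<not> snd l) D"
    and ?b = "\<lambda>D. filter (\<lambda>l. snd l \<and> mem_lit (fst l, False) D) D"
  have l: "PT ?p" "PT ?n" "PT ?b" by (intro pt)+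
  have 1: "PT (\<lambda>D. length (?b D) < 4 \<and> G i j (length (?b D)))" for i j
    by (rule PT_length_table[OF l(3), of "\<lambda>_. G i j"]) (rule PT_const)
  have 2: "PT (\<lambda>D. length (?n D) < 4 \<and> (length (?b D) < 4 \<and> G i (length (?n D)) (length (?b D))))" for i
    by (rule PT_length_table[OF l(2), of "\<lambda>D j. length (?b D) < 4 \<and> G i j (length (?b D))"]) (rule 1)
  have "PT (\<lambda>D. length (?p D) < 4 \<and> (length (?n D) < 4 \<and> (length (?b D) < 4 \<and>
      G (length (?p D)) (length (?n D)) (length (?b D)))))"
    by (rule PT_length_table[OF l(1), of "\<lambda>D i. length (?n D) < 4 \<and> (length (?b D) < 4 \<and>
      G i (length (?n D)) (length (?b D)))"]) (rule 2)
  then show ?thesis unfolding admissible_def .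
qed

lemma PT_bad: "PT (\<lambda>z. bad G (fst z) (snd z))"
  unfolding bad_def
  by (intro pt PT_comp[OF _ PT_taut] PT_comp[OF _ PT_admissible])

lemma PT_insert_var [pt]:
  assumes "PT v" "PT S" shows "PT (\<lambda>x. insert_var (v x) (S x))"
proof (rule PT_comp2[where f = insert_var, OF _ assms])
  show "PT (\<lambda>z. insert_var (fst z) (snd z))" unfolding insert_var_def by (intro pt)
qed

lemma PT_expand: "PT (\<lambda>z. expand (fst z) (snd z))"
  unfolding expand_def by (intro PT_case_list pt)

lemma PT_collect: "PT (\<lambda>z. collect (fst z) (snd z))"
  unfolding collect_def by (intro pt)

lemma PT_bads [pt]:
  assumes "PT S" "PT cs" shows "PT (\<lambda>x. filter (bad G (S x)) (cs x))"
  by (rule PT_filter[OF _ assms(2)])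
    (rule PT_comp2[OF PT_bad PT_comp[OF PT_fst[OF PT_id] assms(1)] PT_snd[OF PT_id]])

lemma PT_process:
  "PT (\<lambda>z. process G (fst z) (fst (snd z)) (snd (snd z)))"
  unfolding process_def
  by (intro pt PT_comp2[OF PT_expand] PT_comp2[OF PT_collect])

text \<open>The bound is polynomial in the formula and the current level together; the level itself
  may be exponential in k. The growth condition of the fold holds because processing a set only puts
  new lists in front of the old ones.\<close>

lemma PT_level: "PT (\<lambda>z. level G (fst z) (snd z))"
proof -
  have "PT (\<lambda>z. expand (snd z) (filter (bad G (snd z)) (fst (fst z))))"
    by (intro pt PT_comp2[OF PT_expand])
  then obtain q where q: "polyb q"
    "\<And>(x :: lit list list \<times> nat list list \<times> nat list list) S. S \<in> set (fst (snd x)) \<Longrightarrow>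
       sz (expand S (filter (bad G S) (fst x))) \<le> q (sz x)"
    using PT_elem_size[of "\<lambda>x S. expand S (filter (bad G S) (fst x))" "\<lambda>x. fst (snd x)"]
      PT_fst[OF PT_snd[OF PT_id]] by blast
  show ?thesis
    unfolding level_def
  proof (rule PT_fold)
    show "PT (\<lambda>x. fst (snd x))" "PT (\<lambda>x. ([], snd (snd x)))" by (intro pt)+
    show "PT (\<lambda>z. process G (fst (fst (snd z))) (fst z) (snd (snd z)))"
      using PT_comp[OF _ PT_process, of "\<lambda>z. (fst (fst (snd z)), fst z, snd (snd z))"] by (simp add: pt)
    show "polyb (\<lambda>n. q n + n)" using q(1) by (intro polyb_intros)
    fix x :: "lit list list \<times> nat list list \<times> nat list list" and S and s :: "nat list list \<times> nat list list"
    assume S: "S \<in> set (fst (snd x))"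
    obtain a b where s: "s = (a, b)" by fastforce
    have "sz S < sz (fst (snd x))" by (rule sz_mem[OF S])
    then have "sz S < sz x" by (cases x) auto
    then have "sz (collect S b) \<le> sz b + sz x" by (simp add: collect_def)
    moreover have "sz (expand S (filter (bad G S) (fst x)) @ a) \<le> q (sz x) + sz a"
      using sz_append[of "expand S (filter (bad G S) (fst x))" a] q(2)[OF S] by simp
    ultimately show "sz (process G (fst x) S s) \<le> sz s + (q (sz x) + sz x)"
      by (simp add: process_def s)
  qed
qed

section \<open>Reading and writing\<close>

text \<open>Read backwards, the terminator of a clause precedes its literals and the digits of a
  variable precede its sign. So the clause to extend is already the first one when a literal is
  complete.\<close>

definition add_lit :: "lit \<Rightarrow> lit list list \<Rightarrow> lit list list" where
  "add_lit l cs = (case cs of [] \<Rightarrow> [[l]] | c # r \<Rightarrow> (l # c) # r)"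

text \<open>The instance is read from its end. The components of the state are the digits of the current number,
  the clauses, and the digits of the parameter.\<close>

definition parse_step :: "sym \<Rightarrow> bool list \<times> lit list list \<times> bool list \<Rightarrow> bool list \<times> lit list list \<times> bool
    list" where
  "parse_step a s =
     (if a = Sym 2 then (False # fst s, snd s)
      else if a = Sym 3 then (True # fst s, snd s)
      else if a = Sym 4 then ([], add_lit (num (fst s), True) (fst (snd s)), snd (snd s))
      else if a = Sym 5 then ([], add_lit (num (fst s), False) (fst (snd s)), snd (snd s))
      else if a = Sym 6 then (fst s, [] # fst (snd s), snd (snd s))
      else if a = Sym 7 then ([], fst (snd s), fst s)
      else s)"

definition parse :: "sym list \<Rightarrow> bool list \<times> lit list list \<times> bool list" where
  "parse w = fold parse_step (rev w) ([], [], [])"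

lemma PT_add_lit: "PT (\<lambda>z. add_lit (fst z) (snd z))"
  unfolding add_lit_def by (intro PT_case_list pt)

lemma PT_parse_step: "PT (\<lambda>z. parse_step (fst z) (snd z))"
  unfolding parse_step_def by (intro pt PT_comp2[OF PT_add_lit])

lemma sz_num: "sz (num ds) \<le> sz ds"
proof -
  have "sz (fold (\<lambda>d s. if s = [] \<and> \<not> d then [] else s @ [d]) ds []) \<le> sz ds"
  proof (induction ds rule: rev_induct)
    case (snoc d ds)
    let ?u = "fold (\<lambda>d s. if s = [] \<and> \<not> d then [] else s @ [d]) ds []"
    show ?case using snoc sz_append[of ds "[d]"] sz_append[of ?u "[d]"] sz_pos[of "ds @ [d]"] by auto
  qed simp
  then show ?thesis by (simp add: sz_def tr_nat_def bits_num)
qed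

lemma sz_add_lit: "sz (add_lit l cs) \<le> sz l + sz cs + 3"
  by (cases cs) (simp_all add: add_lit_def)

lemma sz_parse_step: "sz (parse_step a s) \<le> sz s + 12"
proof -
  obtain ds cs ks where s: "s = (ds, cs, ks)" by (cases s) auto
  have "sz (add_lit (num ds, b) cs) \<le> sz ds + sz cs + 9" for b
    using sz_add_lit[of "(num ds, b)" cs] sz_num[of ds] sz_bool[of b] by simp
  from this[of True] this[of False] show ?thesis by (simp add: parse_step_def s)
qed

lemma PT_parse: "PT parse"
  unfolding parse_def
proof (rule PT_fold[OF _ PT_const _ polyb_const[of 12]])
  show "PT (\<lambda>z. parse_step (fst z) (snd (snd z)))"
    by (rule PT_comp2[OF PT_parse_step]) (intro pt)+
qed (intro pt, rule sz_parse_step)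

lemma bin_digits: "set (bin n) \<subseteq> {0, 1}"
proof (induction n rule: less_induct)
  case (less n)
  show ?case
  proof (cases "n = 0")
    case False
    then show ?thesis using less[of "n div 2"] by (subst bin.simps) auto
  qed (simp add: bin.simps)
qed

lemma parse_digits:
  "set ds \<subseteq> {0, 1} \<Longrightarrow> foldr parse_step (map Sym (map (\<lambda>d. d + 2) ds)) (es, r) = (map (\<lambda>d. d = 1) ds @ es, r)"
  by (induction ds) (auto simp: parse_step_def)

lemma parse_num: "foldr parse_step (map Sym (enc_num n)) ([], r) = (bits n, r)"
  using parse_digits[OF bin_digits, of n "[]" r] by (simp add: enc_num_def bits_def)

lemma parse_lit: "foldr parse_step (map Sym (enc_lit l)) ([], cs, ks) = ([], add_lit l cs, ks)"
proof -
  obtain v b where l: "l = (v, b)" by fastforce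
  show ?thesis by (cases b) (simp_all add: enc_lit_def parse_num parse_step_def l)
qed

lemma parse_lits:
  "foldr parse_step (map Sym (concat (map enc_lit c))) ([], d # cs, ks) = ([], (c @ d) # cs, ks)"
proof (induction c)
  case (Cons l c)
  then show ?case using parse_lit[of l "(c @ d) # cs" ks] by (simp add: add_lit_def)
qed simp

lemma parse_step_marks:
  "parse_step (Sym 6) (ds, cs, ks) = (ds, [] # cs, ks)"
  "parse_step (Sym 7) (ds, cs, ks) = ([], cs, ds)"
  by (simp_all add: parse_step_def)

lemma parse_clauses:
  "foldr parse_step (map Sym (enc_formula cs)) ([], ds, ks) = ([], cs @ ds, ks)"
proof (induction cs)
  case (Cons c cs)
  then show ?case using parse_lits[of c "[]" "cs @ ds" ks]
    by (simp add: enc_formula_def enc_clause_def parse_step_marks)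
qed (simp add: enc_formula_def)

lemma parse_instance: "parse (map Sym (enc_instance cs k)) = ([], cs, bits k)"
proof -
  have "parse w = foldr parse_step w ([], [], [])" for w
    by (simp add: parse_def foldr_conv_fold)
  then show ?thesis using parse_clauses[of cs "[]" "bits k"]
    by (simp add: enc_instance_def parse_num parse_step_marks)
qed

section \<open>The parameter in unary\<close>

definition unary_step :: "bool \<Rightarrow> lit list list \<times> unit list \<Rightarrow> lit list list \<times> unit list" where
  "unary_step d s = (fst s, if d then () # snd s @ snd s else snd s @ snd s)"

text \<open>The search needs a list to iterate over, and k units can be exponentially more than the
  digits of k. Hence this fold, too, has a measure in place of a growth bound. The clauses ride
  along for the next stage.\<close>

definition unary :: "bool list \<times> lit list list \<times> bool list \<Rightarrow> lit list list \<times> unit list" where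
  "unary x = fold unary_step (snd (snd x)) (fst (snd x), [])"

lemma fold_unary_step: "fold unary_step ds (cs, []) = (cs, replicate (num ds) ())"
proof (induction ds rule: rev_induct)
  case (snoc d ds)
  then show ?case
    by (cases d) (simp_all add: unary_step_def num_snoc replicate_add[symmetric] mult_2)
qed (simp add: num_def)

lemma num_append: "num ds \<le> num (ds @ es)"
proof (induction es rule: rev_induct)
  case (snoc e es)
  then show ?case unfolding append_assoc[symmetric] num_snoc by simp
qed simp

lemma PTB_unary:
  "PTB (\<lambda>x. \<Sum>j\<le>length (snd (snd x)). sz (fold unary_step (take j (snd (snd x))) (fst (snd x), []))) unary"
proof -
  have "PT (\<lambda>z. unary_step (fst z) (snd (snd z)))"
    unfolding unary_step_def by (intro pt)
  then show ?thesis unfolding unary_def by (intro PTB_fold pt)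
qed

text \<open>Round j + 1 tests the sets of size j, so the additional unit is what lets the sets of
  size k be tested.\<close>

definition solve :: "(nat \<Rightarrow> nat \<Rightarrow> nat \<Rightarrow> bool) \<Rightarrow> lit list list \<times> unit list \<Rightarrow> nat list list \<times> nat list list"
    where
  "solve G x = fold (\<lambda>_. level G (fst x)) (() # snd x) ([[]], [])"

lemma PTB_solve:
  "PTB (\<lambda>x. \<Sum>j\<le>length (() # snd x). sz (fold (\<lambda>_. level G (fst x)) (take j (() # snd x)) ([[]], [])))
      (solve G)"
proof -
  have "PT (\<lambda>z :: unit \<times> (lit list list \<times> unit list) \<times> nat list list \<times> nat list list.
      level G (fst (fst (snd z))) (snd (snd z)))"
    by (intro pt PT_comp2[OF PT_level])
  then show ?thesis unfolding solve_def by (intro PTB_fold pt)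
qed

section \<open>Printing solutions and converting symbols\<close>

definition print_var :: "nat \<Rightarrow> sym list" where
  "print_var v = map (\<lambda>b. if b then Sym 3 else Sym 2) (bits v) @ [Sym 4]"

definition print_sets :: "nat list list \<times> nat list list \<Rightarrow> sym list" where
  "print_sets s = concat (map (\<lambda>S. concat (map print_var S) @ [Sym 1]) (rev (snd s)))"

lemma PT_print_sets: "PT print_sets"
proof -
  show ?thesis unfolding print_sets_def print_var_def by (intro pt PT_bits)
qed

lemma print_var: "print_var v = map Sym (enc_num v @ [4])"
proof -
  have "map (\<lambda>b. if b then Sym 3 else Sym 2) (map (\<lambda>d. d = 1) ds) = map Sym (map (\<lambda>d. d + 2) ds)"
    if "set ds \<subseteq> {0, 1}" for ds :: "nat list"
    using that by (induction ds) auto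
  from this[OF bin_digits] show ?thesis by (simp add: print_var_def bits_def enc_num_def)
qed

lemma print_sets:
  assumes "\<And>S. S \<in> set outs \<Longrightarrow> sorted_list_of_set (set S) = S"
  shows "print_sets (nxt, outs) = map Sym (concat (map (\<lambda>y. enc_varset y @ [1]) (map set (rev outs))))"
proof -
  have "concat (map print_var S) = map Sym (concat (map (\<lambda>v. enc_num v @ [4]) S))" for S
    by (induction S) (simp_all add: print_var)
  then have "concat (map print_var S) @ [Sym 1] = map Sym (enc_varset (set S) @ [1])" if "S \<in> set outs" for S
    using assms[OF that] by (simp add: enc_varset_def)
  then have "print_sets (nxt, outs) = concat (map (\<lambda>S. map Sym (enc_varset (set S) @ [1])) (rev outs))"
    unfolding print_sets_def by (intro arg_cong[of _ _ concat] map_cong) auto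
  also have "\<dots> = map Sym (concat (map (\<lambda>y. enc_varset y @ [1]) (map set (rev outs))))"
    by (simp add: map_concat comp_def)
  finally show ?thesis .
qed

text \<open>Moves the top input symbol to the front of a list on stack 1; the 2 is the node that
  joins them. As the end of the input is on top, the list comes out in reading order.\<close>

definition read_sym :: com where
  "read_sym = foldr (\<lambda>a c. Cond 0 {a} (Seq (Pop 0) (push_list (2 # put (Sym a)))) c) [1..<8] Skip"

text \<open>The unary code is counted in the control state: \<open>a\<close> is the count so far and
  \<open>m\<close> limits what may follow. The guard for a = 0 keeps the program well-formed, since
  0 cannot be pushed.\<close>

fun write_sym :: "nat \<Rightarrow> nat \<Rightarrow> com" where
  "write_sym 0 a = Skip"
| "write_sym (Suc m) a = Cond 1 {2} (Seq (Pop 1) (Seq (Pop 1) (write_sym m (Suc a))))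
     (Seq (Pop 1) (if a = 0 then Skip else Push 6 a))"

lemma put_Sym: "put (Sym 0) = [1]" "put (Sym (Suc n)) = 2 # 1 # put (Sym n)"
  by (simp_all add: tr_sym_def)

lemma sz_Sym: "sz (Sym n) = 2 * n + 1"
  by (induction n) (simp_all add: sz_def put_Sym)

lemma sz_word: "\<forall>a\<in>set w. a < 8 \<Longrightarrow> sz (map Sym w) \<le> 16 * length w + 1"
  by (induction w) (auto simp: sz_Sym)

definition io_state :: "nat list \<Rightarrow> nat list \<Rightarrow> nat list \<Rightarrow> stacks" where
  "io_state i u out = (\<lambda>_. [])(0 := i, 1 := u, 6 := out)"

lemma exec_read_sym:
  assumes "0 < a" "a < 8"
  shows "exec read_sym (io_state (a # i) u []) 60 (io_state i (2 # put (Sym a) @ u) [])"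
proof -
  have body: "exec (Seq (Pop 0) (push_list (2 # put (Sym a)))) (io_state (a # i) u []) 40
      (io_state i (2 # put (Sym a) @ u) [])"
  proof (rule exec_Seq[OF exec_Pop[OF refl order_refl]])
    let ?s = "(io_state (a # i) u [])(0 := tl (io_state (a # i) u [] 0))"
    have "?s(1 := (2 # put (Sym a)) @ ?s 1) = io_state i (2 # put (Sym a) @ u) []"
      by (simp add: io_state_def fun_eq_iff)
    then show "exec (push_list (2 # put (Sym a))) ?s (2 * length (2 # put (Sym a)) + 1)
        (io_state i (2 # put (Sym a) @ u) [])"
      using exec_push_list[of "2 # put (Sym a)" ?s] by metis
    have "length (put (Sym a)) = 2 * a + 1" using sz_Sym[of a] by (simp add: sz_def)
    then show "1 + (2 * length (2 # put (Sym a)) + 1) + 1 \<le> 40" using assms(2) by simp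
  qed
  have gen: "a \<in> set xs \<Longrightarrow> exec (foldr (\<lambda>a c. Cond 0 {a} (Seq (Pop 0) (push_list (2 # put (Sym a)))) c) xs
      Skip)
      (io_state (a # i) u []) (40 + length xs) (io_state i (2 # put (Sym a) @ u) [])" for xs
  proof (induction xs)
    case (Cons x xs)
    show ?case
      unfolding foldr.simps o_def
    proof (rule exec_Cond[where b = "40 + length xs"])
      assume "top_of (io_state (a # i) u [] 0) \<in> {x}"
      then have "x = a" by (simp add: io_state_def)
      then show "exec (Seq (Pop 0) (push_list (2 # put (Sym x)))) (io_state (a # i) u []) (40 + length xs)
          (io_state i (2 # put (Sym a) @ u) [])"
        using exec_mono[OF body, of "40 + length xs"] by simp
    next
      assume "top_of (io_state (a # i) u [] 0) \<notin> {x}"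
      then have "a \<in> set xs" using Cons.prems by (simp add: io_state_def)
      then show "exec (foldr (\<lambda>a c. Cond 0 {a} (Seq (Pop 0) (push_list (2 # put (Sym a)))) c) xs Skip)
         (io_state (a # i) u []) (40 + length xs) (io_state i (2 # put (Sym a) @ u) [])"
        by (rule Cons.IH)
    qed simp
  qed simp
  have "a \<in> set [1..<8]" using assms by simp
  from gen[OF this] show ?thesis
    unfolding read_sym_def by (rule exec_mono) simp
qed

lemma exec_read:
  "\<forall>a\<in>set i. 0 < a \<and> a < 8 \<Longrightarrow>
     exec (Loop 0 {0<..<8} read_sym) (io_state i (put ws) []) (61 * length i + 1)
       (io_state [] (put (map Sym (rev i) @ ws)) [])"
proof (induction i arbitrary: ws)
  case Nil
  show ?case by (simp add: io_state_def) (rule exec_Loop_done, simp_all)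
next
  case (Cons a i)
  have "exec (Loop 0 {0<..<8} read_sym) (io_state i (put (Sym a # ws)) []) (61 * length i + 1)
       (io_state [] (put (map Sym (rev i) @ Sym a # ws)) [])"
    using Cons.prems by (intro Cons.IH) simp
  then have rest: "exec (Loop 0 {0<..<8} read_sym) (io_state i (2 # put (Sym a) @ put ws) []) (61 * length
      i + 1)
       (io_state [] (put (map Sym (rev (a # i)) @ ws)) [])"
    by simp
  show ?case
    by (rule exec_Loop_step[OF _ exec_read_sym rest]) (use Cons.prems in \<open>auto simp: io_state_def\<close>)
qed

lemma exec_write_sym:
  "n < m \<Longrightarrow> 0 < a + n \<Longrightarrow> exec (write_sym m a) (io_state [] (put (Sym n) @ u) out) (6 * m)
     (io_state [] u ((a + n) # out))"
proof (induction m arbitrary: n a)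
  case (Suc m)
  show ?case
  proof (cases n)
    case 0
    let ?s = "io_state [] (put (Sym n) @ u) out"
    have "exec (Seq (Pop 1) (Push 6 a)) ?s 3 (io_state [] u ((a + n) # out))"
      by (rule exec_Seq[OF exec_Pop[OF refl order_refl] exec_Push[OF _ order_refl]])
        (simp_all add: io_state_def 0 put_Sym fun_eq_iff)
    then have "exec (Seq (Pop 1) (if a = 0 then Skip else Push 6 a)) ?s 3 (io_state [] u ((a + n) # out))"
      using Suc.prems 0 by simp
    moreover have "top_of (?s 1) = 1" by (simp add: io_state_def 0 put_Sym)
    ultimately show ?thesis
      unfolding write_sym.simps by (intro exec_Cond[where b = 3]) simp_all
  next
    case n: (Suc n')
    let ?s = "io_state [] (put (Sym n) @ u) out"
    have "exec (Pop 1) ?s 1 (io_state [] (1 # put (Sym n') @ u) out)"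
      by (rule exec_Pop) (simp_all add: io_state_def n put_Sym fun_eq_iff)
    moreover have "exec (Pop 1) (io_state [] (1 # put (Sym n') @ u) out) 1 (io_state [] (put (Sym n') @ u)
        out)"
      by (rule exec_Pop) (simp_all add: io_state_def fun_eq_iff)
    moreover have "exec (write_sym m (Suc a)) (io_state [] (put (Sym n') @ u) out) (6 * m)
        (io_state [] u ((Suc a + n') # out))"
      using Suc.prems n by (intro Suc.IH) auto
    ultimately have "exec (Seq (Pop 1) (Seq (Pop 1) (write_sym m (Suc a)))) ?s (6 * m + 4)
        (io_state [] u ((Suc a + n') # out))"
      by (intro exec_Seq[OF _ exec_Seq[OF _ _ order_refl]]) auto
    moreover have "top_of (?s 1) = 2" by (simp add: io_state_def n put_Sym)
    ultimately show ?thesis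
      unfolding write_sym.simps by (intro exec_Cond[where b = "6 * m + 4"]) (simp_all add: n)
  qed
qed simp

lemma exec_write:
  "\<forall>a\<in>set ys. 0 < a \<and> a < 8 \<Longrightarrow>
     exec (Loop 1 {2} (Seq (Pop 1) (write_sym 8 0))) (io_state [] (put (map Sym ys)) out) (51 * length ys + 1)
       (io_state [] [1] (rev ys @ out))"
proof (induction ys arbitrary: out)
  case Nil
  show ?case by simp (rule exec_Loop_done, simp_all add: io_state_def)
next
  case (Cons a ys)
  have p: "exec (Pop 1) (io_state [] (2 # put (Sym a) @ put (map Sym ys)) out) 1
      (io_state [] (put (Sym a) @ put (map Sym ys)) out)"
    by (rule exec_Pop) (simp_all add: io_state_def fun_eq_iff)
  have w: "exec (write_sym 8 0) (io_state [] (put (Sym a) @ put (map Sym ys)) out) (6 * 8)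
      (io_state [] (put (map Sym ys)) ((0 + a) # out))"
    using Cons.prems by (intro exec_write_sym) auto
  have rest: "exec (Loop 1 {2} (Seq (Pop 1) (write_sym 8 0))) (io_state [] (put (map Sym ys)) ((0 + a) # out))
      (51 * length ys + 1) (io_state [] [1] (rev (a # ys) @ out))"
    using Cons.IH[of "a # out"] Cons.prems by simp
  have "exec (Loop 1 {2} (Seq (Pop 1) (write_sym 8 0))) (io_state [] (2 # put (Sym a) @ put (map Sym ys)) out)
      (51 * length (a # ys) + 1) (io_state [] [1] (rev (a # ys) @ out))"
    by (rule exec_Loop_step[OF _ exec_Seq[OF p w order_refl] rest]) (simp_all add: io_state_def)
  then show ?case by simp
qed

lemma wf_write_sym: "m + a \<le> 8 \<Longrightarrow> wf_com (write_sym m a)"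
  by (induction m arbitrary: a) auto

lemma wf_read_sym: "wf_com read_sym"
proof -
  have "wf_com (foldr (\<lambda>a c. Cond 0 {a} (Seq (Pop 0) (push_list (2 # put (Sym a)))) c) xs Skip)" for xs
  proof (induction xs)
    case (Cons a xs)
    have "wf_com (push_list (put (Sym a)))" by (rule wf_push_list[OF set_ser])
    with Cons show ?case by simp
  qed simp
  then show ?thesis unfolding read_sym_def .
qed

text \<open>The program is wrapped between a reading and a printing loop. Both are linear,
  compilation costs a quadratic slowdown, and the measure stays in the bound.\<close>

theorem PTB_machine:
  assumes "PTB m F"
  shows "\<exists>M q. wf_tm M \<and> polyb q \<and> (\<forall>w ys. (\<forall>a\<in>set w. 0 < a \<and> a < 8) \<longrightarrow> (\<forall>a\<in>set ys. 0 < a \<and> a < 8) \<longrightarrow>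
     F (map Sym w) = map Sym ys \<longrightarrow>
     (\<exists>T. T \<le> q (m (map Sym w) + length w) \<and> tm_halted M (run M w T) \<and> tm_output M w T = ys))"
proof -
  from assms obtain c p where c: "wf_com c" "polyb p"
    "\<And>x r n. m x + sz x \<le> n \<Longrightarrow> exec c (main (put x @ r)) (p n) (main (put (F x) @ r))"
    by (rule PTB_E) (rule that)
  let ?W = "Loop 1 {2} (Seq (Pop 1) (write_sym 8 0))" and ?R = "Loop 0 {0<..<8} read_sym"
  let ?c = "Seq (Push 1 1) (Seq ?R (Seq c ?W))"
  have "wf_com ?c" using c(1) wf_read_sym wf_write_sym[of 8 0] by simp
  from compile[OF this] obtain M where M: "wf_tm M"
    "\<And>w n s. \<forall>a\<in>set w. 0 < a \<and> a < 8 \<Longrightarrow> (cstep ^^ n) ([?c], (\<lambda>_. [])(0 := rev w)) = ([], s) \<Longrightarrow>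
     \<exists>T. T \<le> n * (2 * (length w + n) + 4) + 2 \<and> tm_halted M (run M w T) \<and> tm_output M w T = rev (s 6)"
    by blast
  \<comment> \<open>An encoded word of length n has size at most \<open>16 * n + 1\<close>; 61 and
    51 are the costs per symbol of the reading and the printing loop. The length of the output is
    bounded through the running time.\<close>
  define P where "P n = p (n + (16 * n + 1))" for n
  define q0 where "q0 n = 61 * n + 1 + (P n + (51 * (16 * n + 1 + P n) + 1) + 1) + 10" for n
  define q where "q n = q0 n * (2 * (n + q0 n) + 4) + 2" for n
  have "polyb P" unfolding P_def by (intro polyb_comp[OF c(2)] polyb_intros)
  then have "polyb q" unfolding q_def q0_def by (intro polyb_intros)
  moreover have "\<exists>T. T \<le> q (m (map Sym w) + length w) \<and> tm_halted M (run M w T) \<and> tm_output M w T = ys"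
    if w: "\<forall>a\<in>set w. 0 < a \<and> a < 8" and ys: "\<forall>a\<in>set ys. 0 < a \<and> a < 8" and F: "F (map Sym w) = map Sym ys"
        for w ys
  proof -
    let ?x = "map Sym w" and ?n = "m (map Sym w) + length w"
    have szx: "sz ?x \<le> 16 * ?n + 1" using sz_word[of w] w by (auto simp: algebra_simps intro: order_trans)
    have push: "exec (Push 1 1) ((\<lambda>_. [])(0 := rev w)) 1 (io_state (rev w) (put ([] :: sym list)) [])"
      by (rule exec_Push) (simp_all add: io_state_def fun_eq_iff)
    have read: "exec ?R (io_state (rev w) (put ([] :: sym list)) []) (61 * length w + 1) (main (put ?x))"
    proof -
      have "io_state [] (put ?x) [] = main (put ?x)" by (simp add: io_state_def main_def fun_eq_iff)
      then show ?thesis using exec_read[of "rev w" "[]"] w by simp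
    qed
    have cc: "exec c (main (put ?x)) (P ?n) (main (put (map Sym ys)))"
      unfolding P_def using c(3)[of ?x "?n + (16 * ?n + 1)" "[]"] szx F by simp
    have "io_state [] (put (map Sym ys)) [] = main (put (map Sym ys))"
      by (simp add: io_state_def main_def fun_eq_iff)
    then have wr: "exec ?W (main (put (map Sym ys))) (51 * length ys + 1) (io_state [] [1] (rev ys))"
      using exec_write[OF ys, of "[]"] by simp
    have "sz (map Sym ys) \<le> sz ?x + P ?n" using exec_length[OF cc, of 1] by (simp add: main_def sz_def)
    then have len: "length ys \<le> 16 * ?n + 1 + P ?n" using length_le_sz[of "map Sym ys"] szx by simp
    have "exec ?c ((\<lambda>_. [])(0 := rev w)) (q0 ?n) (io_state [] [1] (rev ys))"
      by (rule exec_Seq[OF push exec_Seq[OF read exec_Seq[OF cc wr order_refl] order_refl]])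
        (use len in \<open>simp add: q0_def\<close>)
    then obtain n where n: "n \<le> q0 ?n" "(cstep ^^ n) ([?c], (\<lambda>_. [])(0 := rev w)) = ([], io_state [] [1]
        (rev ys))"
      unfolding exec_def steps_def by blast
    from M(2)[OF w n(2)] obtain T where T: "T \<le> n * (2 * (length w + n) + 4) + 2"
      "tm_halted M (run M w T)" "tm_output M w T = rev (io_state [] [1] (rev ys) 6)" by blast
    note T(1)
    also have "n * (2 * (length w + n) + 4) + 2 \<le> q ?n"
      unfolding q_def using n(1) by (intro add_mono mult_mono) auto
    finally show ?thesis using T by (auto simp: io_state_def)
  qed
  ultimately show ?thesis using M(1) by blast
qed

section \<open>A machine for exponential functions\<close>

text \<open>A base-\<open>B\<close> counter with digits \<open>2, \<dots>, B + 1\<close> whose least significant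
  digit is leftmost; it emits one symbol per increment and halts on overflow.\<close>

definition counter :: "nat \<Rightarrow> tm" where
  "counter B q s =
     (if q = 0 then
        if s = 0 then Some (2, 0, 0, Some 2)
        else if 2 \<le> s \<and> s \<le> B then Some (1, s + 1, 0, Some 2)
        else if s = B + 1 then Some (0, 2, 1, None)
        else None
      else if q = 1 then
        if s = 0 then Some (0, 0, 1, None)
        else if 2 \<le> s \<and> s \<le> B + 1 then Some (1, s, -1, None)
        else None
      else None)"

lemma wf_counter: "wf_tm (counter B)"
  unfolding wf_tm_def by (rule exI[of _ "B + 4"]) (auto simp: counter_def split: if_splits)

lemma counter_return:
  assumes "tp (-1) = 0" "\<forall>j\<le>p. 2 \<le> tp (int j) \<and> tp (int j) \<le> B + 1"
  shows "\<exists>n. trun (counter B) n (1, tp, int p) (0, tp, 0) []"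
  using assms(2)
proof (induction p)
  case 0
  have "trun (counter B) (Suc 0) (1, tp, -1) (0, tp, 0) []"
    by (rule trun_stay[where d = 1]) (use assms(1) in \<open>auto simp: counter_def intro: trun_refl\<close>)
  then have "trun (counter B) (Suc (Suc 0)) (1, tp, int 0) (0, tp, 0) []"
    using 0 by (intro trun_stay[of _ _ _ _ 1 "-1" "Suc 0"]) (simp_all add: counter_def)
  then show ?case by blast
next
  case (Suc p)
  then obtain n where "trun (counter B) n (1, tp, int p) (0, tp, 0) []" by auto
  moreover have "2 \<le> tp (int (Suc p)) \<and> tp (int (Suc p)) \<le> B + 1" using Suc.prems by blast
  ultimately have "trun (counter B) (Suc n) (1, tp, int (Suc p)) (0, tp, 0) []"
    by (intro trun_stay[of _ _ _ _ 1 "-1" n]) (simp_all add: counter_def)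
  then show ?case by blast
qed

text \<open>The next digit takes B values, and each of them admits a full sweep of the n lower
  digits, which gives \<open>B * (B ^ n - 1) + (B - 1) = B ^ Suc n - 1\<close> emissions. Carries
  reset digits to 2, so the initial tape is restored at the end.\<close>

lemma counter_sweep:
  assumes "1 \<le> B" "tp (-1) = 0" "\<forall>j<n. tp (int j) = 2"
  shows "\<exists>m. trun (counter B) m (0, tp, 0) (0, tp, int n) (replicate (B ^ n - 1) 2)"
  using assms(2,3)
proof (induction n arbitrary: tp)
  case 0
  show ?case by (auto intro: trun_refl)
next
  case (Suc n)
  let ?tp = "\<lambda>k. tp(int n := 2 + k)"
  have IH: "\<exists>m. trun (counter B) m (0, ?tp k, 0) (0, ?tp k, int n) (replicate (B ^ n - 1) 2)" for k
    by (rule Suc.IH) (use Suc.prems in auto)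
  \<comment> \<open>The count is that of k + 1 sweeps of the lower digits and k increments of digit
    n.\<close>
  have "\<exists>m. trun (counter B) m (0, ?tp 0, 0) (0, ?tp k, int n) (replicate ((k + 1) * (B ^ n - 1) + k) 2)"
    if "k \<le> B - 1" for k
    using that
  proof (induction k)
    case 0
    show ?case using IH[of 0] by (simp only: add_0 mult_1 add_0_right)
  next
    case (Suc k)
    from Suc.IH[OF Suc_leD[OF Suc.prems]] obtain m1 where m1:
      "trun (counter B) m1 (0, ?tp 0, 0) (0, ?tp k, int n) (replicate ((k + 1) * (B ^ n - 1) + k) 2)"
      by blast
    have "2 + k \<le> B" using Suc.prems by linarith
    then have "counter B 0 (?tp k (int n)) = Some (1, 2 + Suc k, 0, Some 2)"
      by (simp add: counter_def)
    from trun_one[of "counter B" 0 "?tp k" "int n", OF this]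
    have inc: "trun (counter B) (Suc 0) (0, ?tp k, int n) (1, ?tp (Suc k), int n) [2]" by simp
    have "\<forall>j\<le>n. 2 \<le> ?tp (Suc k) (int j) \<and> ?tp (Suc k) (int j) \<le> B + 1"
      using \<open>\<forall>j<Suc n. tp (int j) = 2\<close> Suc.prems assms(1) by auto
    then obtain m2 where m2: "trun (counter B) m2 (1, ?tp (Suc k), int n) (0, ?tp (Suc k), 0) []"
      using counter_return[of "?tp (Suc k)" n B] \<open>tp (-1) = 0\<close> by auto
    obtain m3 where m3: "trun (counter B) m3 (0, ?tp (Suc k), 0) (0, ?tp (Suc k), int n)
        (replicate (B ^ n - 1) 2)" using IH by blast
    have "replicate ((k + 1) * D + k) 2 @ [2] @ [] @ replicate D (2::nat) =
        replicate ((Suc k + 1) * D + Suc k) 2" for D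
    proof -
      have "(Suc k + 1) * D + Suc k = ((k + 1) * D + k) + Suc D" by simp
      then show ?thesis by (simp only: replicate_add replicate_Suc append_Cons append_Nil)
    qed
    with trun_trans[OF m1 trun_trans[OF inc trun_trans[OF m2 m3]]] show ?case by metis
  qed
  from this[of "B - 1"] obtain m where m: "trun (counter B) m (0, ?tp 0, 0) (0, ?tp (B - 1), int n)
      (replicate (B * (B ^ n - 1) + (B - 1)) 2)" using assms(1) by auto
  have tp2: "tp(int n := 2) = tp" using Suc.prems by (intro fun_upd_idem) simp
  then have tp: "?tp 0 = tp" by simp
  have "trun (counter B) (Suc 0) (0, ?tp (B - 1), int n) (0, tp, int (Suc n)) []"
    by (rule trun_Suc[where a = 2 and d = 1 and q' = 0])
      (use assms(1) in \<open>simp_all add: counter_def tp2 trun_refl add.commute\<close>)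
  from trun_trans[OF m this] have "\<exists>m. trun (counter B) m (0, tp, 0) (0, tp, int (Suc n))
      (replicate (B * (B ^ n - 1) + (B - 1)) 2)" unfolding tp by auto
  moreover have "B * (B ^ n - 1) + (B - 1) = B ^ Suc n - 1"
    using assms(1) by (simp add: diff_mult_distrib2)
  ultimately show ?case by simp
qed

lemma computable_power:
  assumes "1 \<le> B"
  shows "computable_fun (\<lambda>n. B ^ n)"
  unfolding computable_fun_def
proof (intro exI[of _ "counter B"] conjI allI wf_counter)
  fix n
  define tp :: "int \<Rightarrow> nat" where "tp = (\<lambda>i. if 0 \<le> i \<and> nat i < n then replicate n 2 ! nat i else 0)"
  have init: "init_config (replicate n 2) = (0, tp, 0)" by (simp add: init_config_def tp_def)
  obtain m where m: "trun (counter B) m (0, tp, 0) (0, tp, int n) (replicate (B ^ n - 1) 2)"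
    using counter_sweep[OF assms, of tp n] by (auto simp: tp_def)
  \<comment> \<open>The carry past the last digit emits the missing symbol, which completes
    \<open>B ^ n\<close>.\<close>
  have "counter B 0 (tp (int n)) = Some (2, tp (int n), 0, Some 2)"
    by (simp add: counter_def tp_def)
  from trun_one[of "counter B" 0 tp "int n", OF this]
  have "trun (counter B) (Suc 0) (0, tp, int n) (2, tp, int n) [2]" by simp
  from trun_trans[OF m this]
  have "trun (counter B) (m + Suc 0) (init_config (replicate n 2)) (2, tp, int n)
      (replicate (B ^ n - 1) 2 @ [2])" by (simp add: init)
  note r = trun_run[OF this]
  have "replicate (B ^ n - 1) 2 @ [2] = replicate (B ^ n) (2::nat)"
    using assms by (simp add: replicate_append_same flip: replicate_Suc)
  moreover have "tm_halted (counter B) (2, tp, int n)" by (simp add: counter_def)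
  ultimately show "\<exists>T. tm_halted (counter B) (run (counter B) (replicate n 2) T) \<and>
      tm_output (counter B) (replicate n 2) T = replicate (B ^ n) 2"
    using r by metis
qed

section \<open>The running time of the search\<close>

lemma sz_units: "sz (replicate n ()) = 2 * n + 1"
proof (induction n)
  case (Suc n)
  have "sz () = 1" by (simp add: sz_def tr_unit_def)
  with Suc show ?case by simp
qed simp

lemma sz_list_le: "\<forall>x\<in>set xs. sz x \<le> c \<Longrightarrow> sz xs \<le> 1 + length xs * (c + 1)"
  by (induction xs) auto

definition cost_unary :: "bool list \<times> lit list list \<times> bool list \<Rightarrow> nat" where
  "cost_unary x = (\<Sum>j\<le>length (snd (snd x)). sz (fold unary_step (take j (snd (snd x))) (fst (snd x), [])))"

definition cost_solve :: "(nat \<Rightarrow> nat \<Rightarrow> nat \<Rightarrow> bool) \<Rightarrow> lit list list \<times> unit list \<Rightarrow> nat" where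
  "cost_solve G x = (\<Sum>j\<le>length (() # snd x). sz (fold (\<lambda>_. level G (fst x)) (take j (() # snd x)) ([[]],
      [])))"

lemma unary_bits: "unary ([], cs, bits k) = (cs, replicate k ())"
  by (simp add: unary_def fold_unary_step)

text \<open>Leading digits of k denote a number that is at most k, so no intermediate list has more
  than k units.\<close>

lemma cost_unary_le: "cost_unary ([], cs, bits k) \<le> (length (bits k) + 1) * (sz cs + 2 * k + 2)"
proof -
  have "sz (fold unary_step (take j (bits k)) (cs, [])) \<le> sz cs + 2 * k + 2" for j
  proof -
    have "num (take j (bits k)) \<le> k"
      using num_append[of "take j (bits k)" "drop j (bits k)"] by simp
    then show ?thesis by (simp add: fold_unary_step sz_units)
  qed
  then have "cost_unary ([], cs, bits k) \<le> (\<Sum>j\<le>length (bits k). sz cs + 2 * k + 2)"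
    unfolding cost_unary_def by (simp only: fst_conv snd_conv) (intro sum_mono)
  also have "\<dots> = (length (bits k) + 1) * (sz cs + 2 * k + 2)" by simp
  finally show ?thesis .
qed

context search
begin

lemma sz_vlist:
  assumes "vlist i S" "i \<le> j"
  shows "sz S \<le> 1 + j * (sz cs + 1)"
proof -
  have "sz v \<le> sz cs" if v: "v \<in> set S" for v
  proof -
    have "v \<in> V" using v assms(1) by (auto simp: vlist_def)
    then obtain C l where l: "C \<in> set cs" "l \<in> set C" "v = fst l" unfolding mem_V by blast
    have "sz v < sz l" by (cases l) (simp add: l(3))
    then show ?thesis using sz_mem[OF l(2)] sz_mem[OF l(1)] by simp
  qed
  then have "sz S \<le> 1 + length S * (sz cs + 1)" by (intro sz_list_le) blast
  also have "\<dots> \<le> 1 + j * (sz cs + 1)"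
    using assms by (intro add_mono mult_mono) (auto simp: vlist_def)
  finally show ?thesis .
qed

text \<open>Each component has at most \<open>3 ^ n\<close> lists of at most n variables, and a
  variable occurs in the formula, so its code is no larger than that of \<open>cs\<close>.\<close>

lemma sz_level:
  assumes "level_ok j s" "j \<le> n"
  shows "sz s \<le> 3 + 2 * 3 ^ n * (2 + n * (sz cs + 1))"
proof -
  let ?c = "1 + n * (sz cs + 1)"
  have L: "\<forall>S\<in>set (fst s). sz S \<le> ?c" "length (fst s) \<le> 3 ^ j"
    and O: "\<forall>S\<in>set (snd s). sz S \<le> ?c" "length (snd s) \<le> 3 ^ j"
    using assms unfolding level_ok_def outs_ok_def by (meson sz_vlist le_trans)+
  have p: "(3::nat) ^ j \<le> 3 ^ n" using assms(2) by (intro power_increasing) auto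
  have "sz (fst s) \<le> 1 + length (fst s) * (?c + 1)" by (rule sz_list_le[OF L(1)])
  also have "\<dots> \<le> 1 + 3 ^ n * (?c + 1)"
    by (intro add_mono mult_mono le_trans[OF L(2) p]) auto
  finally have a: "sz (fst s) \<le> 1 + 3 ^ n * (?c + 1)" .
  have "sz (snd s) \<le> 1 + length (snd s) * (?c + 1)" by (rule sz_list_le[OF O(1)])
  also have "\<dots> \<le> 1 + 3 ^ n * (?c + 1)"
    by (intro add_mono mult_mono le_trans[OF O(2) p]) auto
  finally have b: "sz (snd s) \<le> 1 + 3 ^ n * (?c + 1)" .
  have "sz s = Suc (sz (fst s) + sz (snd s))" by (cases s) simp
  with a b show ?thesis by (simp add: algebra_simps)
qed

lemma cost_solve_le:
  "cost_solve G (cs, replicate k ()) \<le> (k + 2) * (3 + 2 * 3 ^ (k + 1) * (2 + (k + 1) * (sz cs + 1)))"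
proof -
  let ?us = "() # replicate k ()"
  have "sz (fold (\<lambda>_. level G cs) (take j ?us) ([[]], [])) \<le> 3 + 2 * 3 ^ (k + 1) * (2 + (k + 1) * (sz cs +
      1))"
    if "j \<le> length ?us" for j
  proof -
    have "level_ok (length (take j ?us)) (fold (\<lambda>_. level G cs) (take j ?us) ([[]], []))"
      by (rule level_ok_iterate)
    then show ?thesis by (rule sz_level) simp
  qed
  then have "cost_solve G (cs, replicate k ()) \<le>
      (\<Sum>j\<le>length ?us. 3 + 2 * 3 ^ (k + 1) * (2 + (k + 1) * (sz cs + 1)))"
    unfolding cost_solve_def fst_conv snd_conv by (intro sum_mono) simp
  then show ?thesis by simp
qed

lemma solve_correct:
  "correct_enum {S. minimal S \<and> card S \<le> k} (map set (rev (snd (solve G (cs, replicate k ())))))"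
  "print_sets (solve G (cs, replicate k ())) =
     map Sym (concat (map (\<lambda>y. enc_varset y @ [1]) (map set (rev (snd (solve G (cs, replicate k ())))))))"
proof -
  have "level_ok (length (() # replicate k ())) (solve G (cs, replicate k ()))"
    unfolding solve_def fst_conv snd_conv by (rule level_ok_iterate)
  then have ok: "level_ok (Suc k) (solve G (cs, replicate k ()))" by simp
  show "correct_enum {S. minimal S \<and> card S \<le> k} (map set (rev (snd (solve G (cs, replicate k ())))))"
    by (rule correct_enum_outs(1)[OF ok])
  have "print_sets (fst s, snd s) = map Sym (concat (map (\<lambda>y. enc_varset y @ [1]) (map set (rev (snd s)))))"
    if "level_ok (Suc k) s" for s
    by (rule print_sets) (rule correct_enum_outs(2)[OF that])
  from this[OF ok] show "print_sets (solve G (cs, replicate k ())) =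
     map Sym (concat (map (\<lambda>y. enc_varset y @ [1]) (map set (rev (snd (solve G (cs, replicate k ())))))))"
    unfolding prod.collapse .
qed

end

section \<open>Assembling the machine\<close>

lemma enc_num_symbols: "set (enc_num n) \<subseteq> {2, 3}"
  using bin_digits[of n] by (auto simp: enc_num_def)

lemma enc_instance_symbols: "a \<in> set (enc_instance cs k) \<Longrightarrow> 0 < a \<and> a < 8"
  using enc_num_symbols
  by (fastforce simp: enc_instance_def enc_formula_def enc_clause_def enc_lit_def split: if_splits)

lemma output_symbols: "a \<in> set (concat (map (\<lambda>y. enc_varset y @ [1]) ys)) \<Longrightarrow> 0 < a \<and> a < 8"
proof -
  have y: "set (enc_varset y @ [1]) \<subseteq> {1, 2, 3, 4}" for y
    using enc_num_symbols by (auto simp: enc_varset_def dest: subsetD[OF enc_num_symbols])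
  assume "a \<in> set (concat (map (\<lambda>y. enc_varset y @ [1]) ys))"
  then obtain y where "a \<in> set (enc_varset y @ [1])"
    unfolding set_concat set_map by blast
  with y have "a \<in> {1, 2, 3, 4}" by blast
  then show ?thesis by auto
qed

definition whole :: "(nat \<Rightarrow> nat \<Rightarrow> nat \<Rightarrow> bool) \<Rightarrow> sym list \<Rightarrow> sym list" where
  "whole G w = print_sets (solve G (unary (parse w)))"

definition cost_whole :: "(nat \<Rightarrow> nat \<Rightarrow> nat \<Rightarrow> bool) \<Rightarrow> sym list \<Rightarrow> nat" where
  "cost_whole G w = cost_unary (parse w) + cost_solve G (unary (parse w))"

lemma PTB_whole: "PTB (cost_whole G) (whole G)"
proof -
  have 1: "PTB (cost_whole G) parse"
    by (rule PTB_measure[OF PT_parse polyb_id]) simp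
  have "PTB cost_unary unary"
    using PTB_unary unfolding cost_unary_def .
  from PTB_comp[OF 1 this] have 2: "PTB (cost_whole G) (\<lambda>w. unary (parse w))"
    by (simp add: cost_whole_def)
  have "PTB (cost_solve G) (solve G)"
    using PTB_solve unfolding cost_solve_def .
  from PTB_comp[OF 2 this] have "PTB (cost_whole G) (\<lambda>w. solve G (unary (parse w)))"
    by (simp add: cost_whole_def)
  from PTB_comp[OF this PT_print_sets] show ?thesis
    by (simp add: whole_def[abs_def])
qed

text \<open>The argument of q dominates \<open>k + 1\<close>, \<open>3 ^ k\<close> and the input
  length at once, so both costs become polynomial in one variable. The function q is chosen before
  the class and the instance.\<close>

lemma cost_whole_instance:
  obtains q where "polyb q"
    "\<And>\<C> cs k. search \<C> cs \<Longrightarrow>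
       cost_whole (clause_table \<C>) (map Sym (enc_instance cs k)) \<le> q (3 ^ k * (length (enc_instance cs k)
           + 1))"
proof -
  from PT_parse obtain p where p: "polyb p" "\<And>w. sz (parse w) \<le> p (0 + sz w)" by (rule PTB_size) (rule that)
  define c where "c z = p (16 * z + 1)" for z
  have pc: "polyb c" unfolding c_def by (intro polyb_comp[OF p(1)] polyb_intros)
  \<comment> \<open>The summands are the bounds of the two costs, with \<open>k + 2\<close> replaced
    by \<open>2 * z\<close>, \<open>3 ^ (k + 1)\<close> by \<open>3 * z\<close>, and
    \<open>sz cs\<close> by \<open>c z\<close>, as the parser produces \<open>cs\<close> in
    polynomial time.\<close>
  define q where "q z = (z + 1) * (c z + 2 * z + 2) + 2 * z * (3 + 6 * z * (2 + z * (c z + 1)))" for z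
  show thesis
  proof (rule that)
    show "polyb q" unfolding q_def using pc by (intro polyb_intros)
    fix \<C> cs k assume s: "search \<C> cs"
    interpret search \<C> cs by (rule s)
    let ?w = "enc_instance cs k"
    let ?z = "3 ^ k * (length ?w + 1)"
    have "k + 1 \<le> 3 ^ k" by (induction k) auto
    moreover have "(3::nat) ^ k * 1 \<le> ?z" by (rule mult_left_mono) auto
    moreover have "1 * (length ?w + 1) \<le> ?z" by (rule mult_right_mono) auto
    ultimately have z: "k + 1 \<le> ?z" "3 ^ k \<le> ?z" "length ?w \<le> ?z" "3 ^ (k + 1) \<le> 3 * ?z" by simp_all
    have bits: "length (bits k) \<le> ?z"
    proof -
      have "length (bits k) \<le> length ?w" by (simp add: bits_def enc_instance_def enc_num_def)
      then show ?thesis using z(3) by (rule le_trans)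
    qed
    have cs: "sz cs \<le> c ?z"
    proof -
      have "sz cs \<le> sz (parse (map Sym ?w))" by (simp add: parse_instance)
      also have "\<dots> \<le> p (sz (map Sym ?w))" using p(2) by simp
      also have "\<dots> \<le> p (16 * ?z + 1)"
      proof (rule polyb_mono[OF p(1)])
        have "sz (map Sym ?w) \<le> 16 * length ?w + 1" using enc_instance_symbols by (intro sz_word) blast
        then show "sz (map Sym ?w) \<le> 16 * ?z + 1" using z(3) by linarith
      qed
      finally show ?thesis by (simp add: c_def)
    qed
    have "cost_whole G (map Sym ?w) = cost_unary ([], cs, bits k) + cost_solve G (cs, replicate k ())"
      by (simp add: cost_whole_def parse_instance unary_bits)
    also have "\<dots> \<le> q ?z"
      unfolding q_def
    proof (rule add_mono)
      have "(length (bits k) + 1) * (sz cs + 2 * k + 2) \<le> (?z + 1) * (c ?z + 2 * ?z + 2)"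
        using bits cs z(1) by (intro mult_mono add_mono) auto
      then show "cost_unary ([], cs, bits k) \<le> (?z + 1) * (c ?z + 2 * ?z + 2)"
        using cost_unary_le[of cs k] by (rule le_trans[rotated])
      have "(k + 2) * (3 + 2 * 3 ^ (k + 1) * (2 + (k + 1) * (sz cs + 1))) \<le>
          2 * ?z * (3 + (2 * (3 * ?z)) * (2 + ?z * (c ?z + 1)))"
        using cs z by (intro mult_mono add_mono) linarith+
      then show "cost_solve G (cs, replicate k ()) \<le> 2 * ?z * (3 + 6 * ?z * (2 + ?z * (c ?z + 1)))"
        using cost_solve_le[of k] by simp
    qed
    finally show "cost_whole G (map Sym ?w) \<le> q ?z" .
  qed
qed

theorem mainTheorem14:
  fixes \<C> :: "formula set"
  assumes "base_class \<C>"
    and "clause_defined \<C>"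
  shows "min_strong_backdoors_3cnf_in_TotalFPT \<C>"
proof -
  let ?G = "clause_table \<C>"
  from PTB_machine[OF PTB_whole[of ?G]] obtain M q where M: "wf_tm M" "polyb q"
    "\<And>w ys. \<forall>a\<in>set w. 0 < a \<and> a < 8 \<Longrightarrow> \<forall>a\<in>set ys. 0 < a \<and> a < 8 \<Longrightarrow> whole ?G (map Sym w) = map Sym ys \<Longrightarrow>
       \<exists>T. T \<le> q (cost_whole ?G (map Sym w) + length w) \<and> tm_halted M (run M w T) \<and> tm_output M w T = ys"
    by blast
  obtain r where r: "polyb r"
    "\<And>\<C> cs k. search \<C> cs \<Longrightarrow>
       cost_whole (clause_table \<C>) (map Sym (enc_instance cs k)) \<le> r (3 ^ k * (length (enc_instance cs k)
           + 1))"
    by (rule cost_whole_instance) (rule that)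
  have "polyb (\<lambda>z. q (r z + z))" using r(1) by (intro polyb_comp[OF M(2)] polyb_intros)
  then obtain K where K: "\<And>z. q (r z + z) \<le> (z + 2) ^ K" by (auto simp: polyb_def)
  \<comment> \<open>The time will be at most \<open>(3 * z) ^ K\<close> with
    \<open>z = 3 ^ k * (n + 1)\<close>. Its factor \<open>(3 ^ k) ^ K\<close> becomes
    \<open>t k\<close>, and \<open>3 ^ K * (n + 1) ^ K\<close> is the polynomial in the input length
    n.\<close>
  define t :: "nat \<Rightarrow> nat" where "t k = (3 ^ K) ^ k" for k
  define p :: "nat poly" where "p = smult (3 ^ K) ([:1, 1:] ^ K)"
  show ?thesis
    unfolding min_strong_backdoors_3cnf_in_TotalFPT_def
  proof (intro exI[of _ M] exI[of _ t] exI[of _ p] conjI allI impI)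
    show "wf_tm M" by (rule M(1))
    show "computable_fun t" unfolding t_def by (rule computable_power) simp
    fix cs :: "lit list list" and k :: nat
    assume width: "\<forall>c\<in>set cs. card (set c) \<le> 3"
    interpret search \<C> cs by unfold_locales (use assms width in auto)
    let ?w = "enc_instance cs k"
    let ?ys = "map set (rev (snd (solve ?G (cs, replicate k ()))))"
    let ?z = "3 ^ k * (length ?w + 1)"
    have "whole ?G (map Sym ?w) = map Sym (concat (map (\<lambda>y. enc_varset y @ [1]) ?ys))"
      unfolding whole_def parse_instance unary_bits by (rule solve_correct(2))
    from M(3)[OF _ _ this] obtain T where T: "T \<le> q (cost_whole ?G (map Sym ?w) + length ?w)"
      "tm_halted M (run M ?w T)" "tm_output M ?w T = concat (map (\<lambda>y. enc_varset y @ [1]) ?ys)"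
      using enc_instance_symbols output_symbols by blast
    have "1 * (length ?w + 1) \<le> ?z" by (rule mult_right_mono) auto
    then have z: "length ?w \<le> ?z" "1 \<le> ?z" by simp_all
    note T(1)
    also have "q (cost_whole ?G (map Sym ?w) + length ?w) \<le> q (r ?z + ?z)"
      using r(2)[OF search_axioms, of k] z(1) by (intro polyb_mono[OF M(2)] add_mono)
    also have "\<dots> \<le> (?z + 2) ^ K" by (rule K)
    also have "\<dots> \<le> (3 * ?z) ^ K"
    proof (rule power_mono)
      show "?z + 2 \<le> 3 * ?z" using z(2) by linarith
    qed simp
    also have "\<dots> = t k * poly p (length ?w)"
    proof -
      have "poly p n = 3 ^ K * (n + 1) ^ K" for n by (simp add: p_def poly_power)
      moreover have "((3::nat) ^ k) ^ K = (3 ^ K) ^ k" by (simp only: power_mult[symmetric] mult.commute)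
      ultimately show ?thesis by (simp only: t_def power_mult_distrib mult_ac)
    qed
    finally show "\<exists>T ys. enum_run M ?w T ys \<and>
       correct_enum {S. min_strong_backdoor \<C> (formula_of cs) S \<and> card S \<le> k} ys \<and> T \<le> t k * poly p
           (length ?w)"
      using T(2,3) solve_correct(1)[of k] unfolding enum_run_def by blast
  qed
qed

end
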